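(* Suppose $1<q<\infty$, $\gamma>0$, $\alpha>-1$ and $0<p<\infty$. Then, for any holomorphic function $f$ on $\mathbb{B}_n$, the following conditions are equivalent: (a) $f\in\mathcal{A}^p_\alpha$. (b) $A^{\gamma,q}_{\mathcal{R}}(f)$ is in $L^p(\mathbb{B}_n,dv_\alpha)$. (c) $A^{\gamma,q}_{\nabla}(f)$ is in $L^p(\mathbb{B}_n,dv_\alpha)$. (d) $A^{\gamma,q}_{\tilde\nabla}(f)$ is in $L^p(\mathbb{B}_n,dv_\alpha)$. Moreover, the quantities $$\|A^{\gamma,q}_{\mathcal{R}}(f)\|_{p,\alpha},\quad \|A^{\gamma,q}_{\nabla}(f)\|_{p,\alpha},\quad \|A^{\gamma,q}_{\tilde\nabla}(f)\|_{p,\alpha}$$ are all comparable to $\|f-f(0)\|_{p,\alpha}$, where the comparability constants depend only on $q,\gamma,\alpha,p$ and $n$.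
   Context: Fix a positive integer $n$. $\mathbb{B}_n=\{z\in\mathbb{C}^n:|z|<1\}$ is the open unit ball, $\langle z,w\rangle=\sum_k z_k\overline{w_k}$, and $\mathcal{H}(\mathbb{B}_n)$ is the space of holomorphic functions on $\mathbb{B}_n$. $dv$ is Lebesgue measure on $\mathbb{B}_n$ normalized to be a probability measure. For $\alpha>-1$, $dv_\alpha(z)=c_\alpha(1-|z|^2)^\alpha dv(z)$ with $c_\alpha=\Gamma(n+\alpha+1)/[n!\,\Gamma(\alpha+1)]$; $\|g\|_{p,\alpha}=\left(\int_{\mathbb{B}_n}|g|^p\,dv_\alpha\right)^{1/p}$; and $\mathcal{A}^p_\alpha=\mathcal{H}(\mathbb{B}_n)\cap L^p(\mathbb{B}_n,dv_\alpha)$. The invariant measure is $d\tau(z)=(1-|z|^2)^{-(n+1)}dv(z)$. For $z\in\mathbb{B}_n$, $\varphi_z$ is the standard involutive automorphism of $\mathbb{B}_n$, a biholomorphic self-map with $\varphi_z(0)=z$, $\varphi_z(z)=0$, $\varphi_z\circ\varphi_z=\mathrm{id}$. The Bergman metric is $\beta(z,w)=\frac12\log\frac{1+|\varphi_z(w)|}{1-|\varphi_z(w)|}$ and $D(z,\gamma)=\{w\in\mathbb{B}_n:\beta(z,w)<\gamma\}$. For $f\in\mathcal{H}(\mathbb{B}_n)$: the radial derivative is $\mathcal{R}f(z)=\sum_{k=1}^n z_k\frac{\partial f}{\partial z_k}(z)$; the complex gradient is $\nabla f(z)=\left(\frac{\partial f}{\partial z_1}(z),\dots,\frac{\partial f}{\partial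 z_n}(z)\right)$; the invariant gradient is $\tilde\nabla f(z)=\nabla(f\circ\varphi_z)(0)$ (with $|\cdot|$ the Euclidean norm on $\mathbb{C}^n$). The area integral functions are $$A^{\gamma,q}_{\mathcal{R}}(f)(z)=\left(\int_{D(z,\gamma)}|(1-|w|^2)\mathcal{R}f(w)|^q d\tau(w)\right)^{1/q},$$ $$A^{\gamma,q}_{\nabla}(f)(z)=\left(\int_{D(z,\gamma)}|(1-|w|^2)\nabla f(w)|^q d\tau(w)\right)^{1/q},$$ $$A^{\gamma,q}_{\tilde\nabla}(f)(z)=\left(\int_{D(z,\gamma)}|\tilde\nabla f(w)|^q d\tau(w)\right)^{1/q}.$$ Two nonnegative (possibly infinite) quantities $X,Y$ are comparable if $C^{-1}Y\le X\le CY$ for some constant $C>0$ not depending on $f$. *)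

theory Defs
  imports "HOL-Analysis.Analysis"
begin

section \<open>Holomorphic functions on the unit ball of complex n-space\<close>

text \<open>
  Complex n-space is \<open>complex ^ 'n\<close> with \<open>n = CARD('n)\<close>; its \<open>norm\<close> is the
  Euclidean one, so the unit ball is \<open>ball 0 1\<close>.  Functions are total, but everything
  below depends only on their values on the ball.
\<close>

abbreviation unit_ball :: "(complex ^ 'n) set" where
  "unit_ball \<equiv> ball 0 1"

definition herm :: "complex ^ 'n \<Rightarrow> complex ^ 'n \<Rightarrow> complex" where
  "herm z w = (\<Sum>k\<in>UNIV. z $ k * cnj (w $ k))"

text \<open>Holomorphic means that the real Frechet derivative exists and is complex linear.\<close>

definition hol_ball :: "(complex ^ 'n \<Rightarrow> complex) set" where
  "hol_ball = {f. \<forall>z\<in>unit_ball. \<exists>D. (f has_derivative D) (at z) \<and> (\<forall>c v. D (c *s v) = c * D v)}"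

section \<open>Measures, norms and Bergman spaces\<close>

text \<open>All measures live on the ball itself as underlying space.\<close>

definition vol :: "(complex ^ 'n) measure" where
  "vol = uniform_measure (restrict_space lborel unit_ball) unit_ball"

definition c_const :: "'n itself \<Rightarrow> real \<Rightarrow> real" where
  "c_const _ \<alpha> = Gamma (real CARD('n) + \<alpha> + 1) / (fact CARD('n) * Gamma (\<alpha> + 1))"

definition vol_w :: "real \<Rightarrow> (complex ^ 'n) measure" where
  "vol_w \<alpha> = density vol (\<lambda>z. ennreal (c_const TYPE('n) \<alpha> * (1 - (norm z)\<^sup>2) powr \<alpha>))"

definition inv_meas :: "(complex ^ 'n) measure" where
  "inv_meas = density vol (\<lambda>z. ennreal (1 / (1 - (norm z)\<^sup>2) ^ (CARD('n) + 1)))"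

text \<open>Power with positive exponent \<open>r\<close> on extended nonnegative reals.\<close>

definition epowr :: "ennreal \<Rightarrow> real \<Rightarrow> ennreal" where
  "epowr x r = (if x = top then top else ennreal (enn2real x powr r))"

text \<open>
  The quantity \<open>\<parallel>g\<parallel>\<close> for nonnegative, possibly infinite \<open>g\<close>; for complex-valued \<open>f\<close> it is
  applied to \<open>|f|\<close>.
\<close>

definition Lp_norm :: "real \<Rightarrow> real \<Rightarrow> (complex ^ 'n \<Rightarrow> ennreal) \<Rightarrow> ennreal" where
  "Lp_norm p \<alpha> g = epowr (\<integral>\<^sup>+ z. epowr (g z) p \<partial>vol_w \<alpha>) (1 / p)"

definition Lp_space :: "real \<Rightarrow> real \<Rightarrow> (complex ^ 'n \<Rightarrow> ennreal) set" where
  "Lp_space p \<alpha> = {g. g \<in> borel_measurable (vol_w \<alpha>) \<and> Lp_norm p \<alpha> g < top}"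

definition bergman_space :: "real \<Rightarrow> real \<Rightarrow> (complex ^ 'n \<Rightarrow> complex) set" where
  "bergman_space p \<alpha> =
     {f \<in> hol_ball. f \<in> borel_measurable (vol_w \<alpha>) \<and> Lp_norm p \<alpha> (\<lambda>z. ennreal (norm (f z))) < top}"

section \<open>Involutive automorphisms and the Bergman metric\<close>

text \<open>
  With \<open>P\<close> the orthogonal projection onto the complex line spanned by \<open>a\<close> and \<open>Q = I - P\<close>,
  this is \<open>(a - P w - sqrt (1 - |a|^2) Q w) / (1 - <w, a>)\<close>.  For \<open>a = 0\<close> division by zero
  makes \<open>P = 0\<close>, giving the standard convention \<open>w \<mapsto> - w\<close>.
\<close>

definition line_proj :: "complex ^ 'n \<Rightarrow> complex ^ 'n \<Rightarrow> complex ^ 'n" where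
  "line_proj a w = (herm w a / herm a a) *s a"

definition ball_aut :: "complex ^ 'n \<Rightarrow> complex ^ 'n \<Rightarrow> complex ^ 'n" where
  "ball_aut a w = (1 / (1 - herm w a)) *s
     (a - line_proj a w - sqrt (1 - (norm a)\<^sup>2) *\<^sub>R (w - line_proj a w))"

definition berg_dist :: "complex ^ 'n \<Rightarrow> complex ^ 'n \<Rightarrow> real" where
  "berg_dist z w = 1 / 2 * ln ((1 + norm (ball_aut z w)) / (1 - norm (ball_aut z w)))"

definition berg_ball :: "complex ^ 'n \<Rightarrow> real \<Rightarrow> (complex ^ 'n) set" where
  "berg_ball z \<gamma> = {w \<in> unit_ball. berg_dist z w < \<gamma>}"

section \<open>Derivatives and area integral functions\<close>

definition cpartial :: "'n \<Rightarrow> (complex ^ 'n \<Rightarrow> complex) \<Rightarrow> complex ^ 'n \<Rightarrow> complex" where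
  "cpartial k f z = deriv (\<lambda>t. f (z + axis k t)) 0"

definition radial_deriv :: "(complex ^ 'n \<Rightarrow> complex) \<Rightarrow> complex ^ 'n \<Rightarrow> complex" where
  "radial_deriv f z = (\<Sum>k\<in>UNIV. z $ k * cpartial k f z)"

definition cgrad :: "(complex ^ 'n \<Rightarrow> complex) \<Rightarrow> complex ^ 'n \<Rightarrow> complex ^ 'n" where
  "cgrad f z = (\<chi> k. cpartial k f z)"

definition inv_grad :: "(complex ^ 'n \<Rightarrow> complex) \<Rightarrow> complex ^ 'n \<Rightarrow> complex ^ 'n" where
  "inv_grad f z = cgrad (f \<circ> ball_aut z) 0"

definition area_int ::
  "real \<Rightarrow> real \<Rightarrow> (complex ^ 'n \<Rightarrow> real) \<Rightarrow> complex ^ 'n \<Rightarrow> ennreal" where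
  "area_int \<gamma> q h z = epowr (\<integral>\<^sup>+ w\<in>berg_ball z \<gamma>. ennreal (h w powr q) \<partial>inv_meas) (1 / q)"

definition area_R ::
  "real \<Rightarrow> real \<Rightarrow> (complex ^ 'n \<Rightarrow> complex) \<Rightarrow> complex ^ 'n \<Rightarrow> ennreal" where
  "area_R \<gamma> q f = area_int \<gamma> q (\<lambda>w. norm ((1 - (norm w)\<^sup>2) *\<^sub>R radial_deriv f w))"

definition area_grad ::
  "real \<Rightarrow> real \<Rightarrow> (complex ^ 'n \<Rightarrow> complex) \<Rightarrow> complex ^ 'n \<Rightarrow> ennreal" where
  "area_grad \<gamma> q f = area_int \<gamma> q (\<lambda>w. norm ((1 - (norm w)\<^sup>2) *\<^sub>R cgrad f w))"

definition area_inv_grad ::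
  "real \<Rightarrow> real \<Rightarrow> (complex ^ 'n \<Rightarrow> complex) \<Rightarrow> complex ^ 'n \<Rightarrow> ennreal" where
  "area_inv_grad \<gamma> q f = area_int \<gamma> q (\<lambda>w. norm (inv_grad f w))"

section \<open>Comparability\<close>

definition comparable_on :: "'a set \<Rightarrow> ('a \<Rightarrow> ennreal) \<Rightarrow> ('a \<Rightarrow> ennreal) \<Rightarrow> bool" where
  "comparable_on S X Y \<longleftrightarrow>
     (\<exists>C::real. C > 0 \<and> (\<forall>f\<in>S. ennreal (inverse C) * Y f \<le> X f \<and> X f \<le> ennreal C * Y f))"

end

theory Submission
  imports Defs "HOL-Complex_Analysis.Complex_Analysis"
begin

text \<open>
  On the ball, \<open>(1 - |w|^2) |Rf| \<le> (1 - |w|^2) |grad f| \<le> |inv_grad f|\<close> pointwise, so the three area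
  functions are ordered in the same way.  The equivalences and the comparability of the norms
  therefore follow from two inequalities: the largest area function is dominated in norm by
  \<open>f - f 0\<close> (\<open>nn_integral_area_inv_grad_le\<close>), and \<open>f - f 0\<close> is dominated in norm by the smallest one
  (\<open>nn_integral_le_area_R\<close>).

  Geometry.  Let \<open>L\<close> be the dilation of complex n-space by \<open>1 - |a|^2\<close> on the complex line through \<open>a\<close>
  and by \<open>sqrt (1 - |a|^2)\<close> on its orthogonal complement (\<open>frame_map a\<close>).  In the coordinate \<open>v\<close> with
  \<open>w = a + L v\<close> the involution centred at \<open>a\<close> becomes \<open>v \<mapsto> - v / (1 - <v,a>)\<close>.  This elementary formula
  replaces the general theory of ball automorphisms: it gives the symmetry and the triangle
  inequality of the Bergman metric, it traps Bergman balls between ellipsoids \<open>a + L B\<close> with \<open>B\<close> a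
  Euclidean ball around 0, and, since \<open>L\<close> has real determinant \<open>(1 - |a|^2)^(n+1)\<close>, it gives their
  volume and shows that the invariant measure of a Bergman ball is of order 1.

  Averages.  If \<open>h\<close> is holomorphic on complex lines, then \<open>|h(a)|^p\<close> is at most a constant times the
  integral of \<open>|h|^p\<close> over a Bergman ball around \<open>a\<close> with respect to the invariant measure
  (\<open>sub_mean_value_berg_ball\<close>).  Suprema over Bergman balls may therefore be replaced by integrals
  over larger ones, and since \<open>w \<in> D(z,\<gamma>)\<close> is symmetric in \<open>z\<close> and \<open>w\<close>, integrating such integrals
  against \<open>(1 - |z|^2)^\<alpha>\<close> costs only a constant (\<open>nn_integral_berg_average_le\<close>).  With Cauchy's
  estimate for the invariant gradient this proves the first inequality.

  The second inequality is a Hardy inequality along rays.  The ball is cut into shells on which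
  \<open>1 - |z|\<close> is comparable to \<open>\<mu>^k\<close>, with \<open>\<mu>\<close> so close to 1 that the part of a ray inside one shell
  has small Bergman diameter.  There the oscillation of \<open>f\<close> along the ray is bounded by the radial area
  function at any point of that part (\<open>oscillation_le_area_R\<close>).  The difference \<open>f z - f 0\<close> is a sum of
  such increments over the shells crossed by the segment from 0 to \<open>z\<close>.  An increment depends only on
  the direction of \<open>z\<close>, so its integrals over two shells are in the ratio of the volumes of the shells;
  because \<open>\<alpha> + 1 > 0\<close>, the resulting sums converge geometrically.
\<close>

section \<open>Linear changes of variables\<close>

lemma nn_integral_lborel_shift:
  fixes F :: "'a::euclidean_space \<Rightarrow> ennreal"
  assumes [measurable]: "F \<in> borel_measurable borel"
  shows "(\<integral>\<^sup>+x. F (c + x) \<partial>lborel) = (\<integral>\<^sup>+x. F x \<partial>lborel)"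
proof -
  have "(\<integral>\<^sup>+x. F x \<partial>lborel) = (\<integral>\<^sup>+x. F x \<partial>distr lborel borel ((+) c))"
    by (simp add: lborel_distr_plus)
  also have "\<dots> = (\<integral>\<^sup>+x. F (c + x) \<partial>lborel)"
    by (subst nn_integral_distr) auto
  finally show ?thesis by simp
qed

lemma nn_integral_lborel_scale:
  fixes F :: "'a::euclidean_space \<Rightarrow> ennreal"
  assumes [measurable]: "F \<in> borel_measurable borel" and "c \<noteq> 0"
  shows "(\<integral>\<^sup>+x. F x \<partial>lborel) = ennreal (\<bar>c\<bar> ^ DIM('a)) * (\<integral>\<^sup>+x. F (c *\<^sub>R x) \<partial>lborel)"
proof -
  have "(\<integral>\<^sup>+x. F x \<partial>lborel)
      = (\<integral>\<^sup>+x. F x \<partial>density (distr lborel borel (\<lambda>x. 0 + c *\<^sub>R x)) (\<lambda>_. \<bar>c\<bar> ^ DIM('a)))"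
    by (subst lborel_affine[OF \<open>c \<noteq> 0\<close>, of 0]) simp
  also have "\<dots> = ennreal (\<bar>c\<bar> ^ DIM('a)) * (\<integral>\<^sup>+x. F (c *\<^sub>R x) \<partial>lborel)"
    by (simp add: nn_integral_density nn_integral_distr nn_integral_cmult)
  finally show ?thesis .
qed

text \<open>
  Both sides equal the double integral of \<open>G x * F (x + T y)\<close>: the image of Lebesgue measure under
  \<open>T\<close> is invariant under translations and reflection, so either order of integration separates the two
  factors.  Hence \<open>T\<close> multiplies all integrals by one constant, which can be read off from any
  convenient \<open>G\<close>.
\<close>

lemma nn_integral_linear_scaling:
  fixes T :: "'a::euclidean_space \<Rightarrow> 'a"
  assumes T: "linear T" "surj T"
    and [measurable]: "F \<in> borel_measurable borel" "G \<in> borel_measurable borel"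
  shows "(\<integral>\<^sup>+x. G x \<partial>lborel) * (\<integral>\<^sup>+x. F (T x) \<partial>lborel)
       = (\<integral>\<^sup>+x. F x \<partial>lborel) * (\<integral>\<^sup>+x. G (T x) \<partial>lborel)"
proof -
  have [measurable]: "T \<in> borel_measurable borel"
    using T(1) by (intro borel_measurable_continuous_onI linear_continuous_on linear_linear[THEN iffD1]) (simp add: linear_conv_bounded_linear)
  have trans: "(\<integral>\<^sup>+y. H (x + T y) \<partial>lborel) = (\<integral>\<^sup>+y. H (T y) \<partial>lborel)"
    if [measurable]: "H \<in> borel_measurable borel" for H :: "'a \<Rightarrow> ennreal" and x
  proof -
    obtain x' where "x = T x'" using T(2) by (metis surjD)
    then have "(\<integral>\<^sup>+y. H (x + T y) \<partial>lborel) = (\<integral>\<^sup>+y. H (T (x' + y)) \<partial>lborel)"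
      by (simp add: linear_add[OF T(1)])
    also have "\<dots> = (\<integral>\<^sup>+y. H (T y) \<partial>lborel)"
      by (rule nn_integral_lborel_shift) measurable
    finally show ?thesis .
  qed
  have "(\<integral>\<^sup>+x. G x \<partial>lborel) * (\<integral>\<^sup>+x. F (T x) \<partial>lborel) = (\<integral>\<^sup>+x. \<integral>\<^sup>+y. G x * F (x + T y) \<partial>lborel \<partial>lborel)"
    by (simp add: nn_integral_cmult nn_integral_multc trans)
  also have "\<dots> = (\<integral>\<^sup>+y. \<integral>\<^sup>+x. G x * F (x + T y) \<partial>lborel \<partial>lborel)"
    by (rule lborel_pair.Fubini') measurable
  also have "\<dots> = (\<integral>\<^sup>+y. \<integral>\<^sup>+x. G (x + T (- y)) * F x \<partial>lborel \<partial>lborel)"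
  proof (rule nn_integral_cong)
    fix y
    have "(\<integral>\<^sup>+x. G x * F (x + T y) \<partial>lborel) = (\<integral>\<^sup>+x. G (- T y + x) * F ((- T y + x) + T y) \<partial>lborel)"
      by (rule nn_integral_lborel_shift[symmetric]) measurable
    also have "\<dots> = (\<integral>\<^sup>+x. G (x + T (- y)) * F x \<partial>lborel)"
      by (simp add: linear_neg[OF T(1)])
    finally show "(\<integral>\<^sup>+x. G x * F (x + T y) \<partial>lborel) = (\<integral>\<^sup>+x. G (x + T (- y)) * F x \<partial>lborel)" .
  qed
  also have "\<dots> = (\<integral>\<^sup>+y. \<integral>\<^sup>+x. G (x + T y) * F x \<partial>lborel \<partial>lborel)"
    using nn_integral_lborel_scale[of "\<lambda>y. \<integral>\<^sup>+x. G (x + T y) * F x \<partial>lborel" "-1"] by simp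
  also have "\<dots> = (\<integral>\<^sup>+x. \<integral>\<^sup>+y. G (x + T y) * F x \<partial>lborel \<partial>lborel)"
    by (rule lborel_pair.Fubini') measurable
  also have "\<dots> = (\<integral>\<^sup>+x. F x \<partial>lborel) * (\<integral>\<^sup>+x. G (T x) \<partial>lborel)"
    by (simp add: nn_integral_cmult nn_integral_multc trans mult.commute)
  finally show ?thesis .
qed

text \<open>
  The unit ball is mapped to itself, so the scaling constant is 1.
\<close>

lemma nn_integral_linear_isometry:
  fixes T :: "'a::euclidean_space \<Rightarrow> 'a"
  assumes T: "linear T" "\<And>x. norm (T x) = norm x"
    and [measurable]: "F \<in> borel_measurable borel"
  shows "(\<integral>\<^sup>+x. F (T x) \<partial>lborel) = (\<integral>\<^sup>+x. F x \<partial>lborel)"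
proof -
  have "inj T"
    unfolding linear_injective_0[OF T(1)] by (metis T(2) norm_eq_zero)
  then have surj: "surj T"
    using linear_inj_imp_surj[OF T(1)] by blast
  define V where "V = (\<integral>\<^sup>+x. indicator (ball 0 1 :: 'a set) x \<partial>lborel :: ennreal)"
  have V: "V = emeasure lborel (ball 0 1 :: 'a set)"
    unfolding V_def by simp
  have V0: "V \<noteq> 0" "V \<noteq> top"
    unfolding V using unit_ball_vol_pos[of "real DIM('a)"]
    by (simp_all add: emeasure_ball del: unit_ball_vol_pos)
  have "(\<lambda>x. indicator (ball 0 1) (T x) :: ennreal) = indicator (ball 0 1)"
    by (auto simp: indicator_def T(2) fun_eq_iff)
  then have "V * (\<integral>\<^sup>+x. F (T x) \<partial>lborel) = V * (\<integral>\<^sup>+x. F x \<partial>lborel)"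
    using nn_integral_linear_scaling[OF T(1) surj assms(3), of "indicator (ball 0 1)"]
    unfolding V_def by (simp add: mult.commute borel_measurable_indicator)
  then show ?thesis
    using V0 by (simp add: ennreal_mult_cancel_left)
qed

text \<open>
  A reflection carries the unit vector to a coordinate axis, where the stretch is diagonal.
\<close>

lemma nn_integral_stretch_unit_vector:
  fixes \<zeta> :: "'a::euclidean_space"
  assumes \<zeta>: "norm \<zeta> = 1" and c: "0 < c"
    and [measurable]: "F \<in> borel_measurable borel"
  shows "(\<integral>\<^sup>+x. F x \<partial>lborel) = ennreal c * (\<integral>\<^sup>+x. F (x + ((c - 1) * (x \<bullet> \<zeta>)) *\<^sub>R \<zeta>) \<partial>lborel)"
proof -
  obtain e :: 'a where e: "e \<in> Basis" using nonempty_Basis by blast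
  have \<zeta>\<zeta>: "\<zeta> \<bullet> \<zeta> = 1" and ee: "e \<bullet> e = 1"
    using \<zeta> e by (simp_all add: dot_square_norm)
  \<comment> \<open>the reflection that exchanges e and zeta\<close>
  define n where "n = e - \<zeta>"
  define U where "U x = x - (2 * (x \<bullet> n) / (n \<bullet> n)) *\<^sub>R n" for x
  have linU: "linear U"
    by (rule linearI) (simp_all add: U_def inner_simps algebra_simps add_divide_distrib)
  have UU: "U (U x) = x" for x
    by (cases "n = 0") (simp_all add: U_def inner_simps algebra_simps)
  have Uin: "U x \<bullet> y = x \<bullet> U y" for x y
    by (simp add: U_def inner_simps inner_commute)
  have Unorm: "norm (U x) = norm x" for x
    using Uin[of x "U x"] by (simp add: UU norm_eq_sqrt_inner)
  have Ue: "U e = \<zeta>"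
  proof (cases "n = 0")
    case True then show ?thesis by (simp add: U_def n_def)
  next
    case False
    have "n \<bullet> n = 2 * (e \<bullet> n)"
      by (simp add: n_def inner_simps \<zeta>\<zeta> ee inner_commute)
    then have "2 * (e \<bullet> n) / (n \<bullet> n) = 1" using False
      by (metis div_self inner_eq_zero_iff)
    then have "U e = e - 1 *\<^sub>R n" by (simp only: U_def)
    then show ?thesis by (simp add: n_def)
  qed
  define S where "S x = x + ((c - 1) * (x \<bullet> e)) *\<^sub>R e" for x :: 'a
  have mU [measurable]: "U \<in> borel_measurable borel"
    using linU by (intro borel_measurable_continuous_onI linear_continuous_on) (simp add: linear_conv_bounded_linear)
  have mS [measurable]: "S \<in> borel_measurable borel"
    unfolding S_def by (intro borel_measurable_continuous_onI continuous_intros)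
  have S: "0 + (\<Sum>j\<in>Basis. ((if j = e then c else 1) * (x \<bullet> j)) *\<^sub>R j) = S x" for x
  proof -
    have "(\<Sum>j\<in>Basis. ((if j = e then c else 1) * (x \<bullet> j)) *\<^sub>R j)
        = (\<Sum>j\<in>Basis. (x \<bullet> j) *\<^sub>R j + (if j = e then ((c - 1) * (x \<bullet> e)) *\<^sub>R e else 0))"
      by (intro sum.cong) (auto simp: algebra_simps)
    also have "\<dots> = S x"
      using e by (simp add: sum.distrib euclidean_representation S_def)
    finally show ?thesis by simp
  qed
  have axis: "(\<integral>\<^sup>+x. H x \<partial>lborel) = ennreal c * (\<integral>\<^sup>+x. H (S x) \<partial>lborel)"
    if [measurable]: "H \<in> borel_measurable borel" for H :: "'a \<Rightarrow> ennreal"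
  proof -
    have "(\<Prod>j\<in>Basis. \<bar>if j = e then c else 1\<bar>) = c"
      using e c by (simp add: prod.delta if_distrib[of abs] cong: if_cong)
    then have "lborel = density (distr lborel borel S) (\<lambda>_. c)"
      using lborel_affine_euclidean[of "\<lambda>j. if j = e then c else 1" 0] c by (simp only: S) auto
    then have "(\<integral>\<^sup>+x. H x \<partial>lborel) = (\<integral>\<^sup>+x. H x \<partial>density (distr lborel borel S) (\<lambda>_. c))"
      by simp
    also have "\<dots> = ennreal c * (\<integral>\<^sup>+x. H (S x) \<partial>lborel)"
      by (simp add: nn_integral_density nn_integral_distr nn_integral_cmult)
    finally show ?thesis .
  qed
  have USU: "U (S (U x)) = x + ((c - 1) * (x \<bullet> \<zeta>)) *\<^sub>R \<zeta>" for x
    by (simp add: S_def linear_add[OF linU] linear_scale[OF linU] UU Ue Uin)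
  have "(\<integral>\<^sup>+x. F x \<partial>lborel) = (\<integral>\<^sup>+x. F (U x) \<partial>lborel)"
    by (rule nn_integral_linear_isometry[symmetric, OF linU Unorm]) measurable
  also have "\<dots> = ennreal c * (\<integral>\<^sup>+x. F (U (S x)) \<partial>lborel)"
    by (rule axis) measurable
  also have "(\<integral>\<^sup>+x. F (U (S x)) \<partial>lborel) = (\<integral>\<^sup>+x. F (U (S (U x))) \<partial>lborel)"
    by (rule nn_integral_linear_isometry[symmetric, OF linU Unorm, of "\<lambda>x. F (U (S x))"]) measurable
  finally show ?thesis by (simp add: USU)
qed

section \<open>The Hermitian form and the adapted dilation\<close>

lemma herm_add_left: "herm (x + y) w = herm x w + herm y w"
  by (simp add: herm_def distrib_right sum.distrib)

lemma herm_add_right: "herm w (x + y) = herm w x + herm w y"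
  by (simp add: herm_def distrib_left sum.distrib)

lemma herm_scale_left: "herm (c *s x) w = c * herm x w"
  by (simp add: herm_def sum_distrib_left mult.assoc)

lemma herm_scale_right: "herm w (c *s x) = cnj c * herm w x"
  by (simp add: herm_def sum_distrib_left algebra_simps)

lemma scaleR_eq_vector_scalar_mult: "r *\<^sub>R (x :: complex ^ 'n) = of_real r *s x"
  by (simp add: vec_eq_iff scaleR_conv_of_real[where 'a = complex])

lemma herm_scaleR_left: "herm (r *\<^sub>R x) w = of_real r * herm x w"
  by (simp add: scaleR_eq_vector_scalar_mult herm_scale_left)

lemma herm_scaleR_right: "herm w (r *\<^sub>R x) = of_real r * herm w x"
  by (simp add: scaleR_eq_vector_scalar_mult herm_scale_right)

lemma herm_diff_left: "herm (x - y) w = herm x w - herm y w"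
  using herm_add_left[of "x - y" y w] by simp

lemma herm_diff_right: "herm w (x - y) = herm w x - herm w y"
  using herm_add_right[of w "x - y" y] by simp

lemma herm_zero [simp]: "herm 0 w = 0" "herm w 0 = 0"
  by (simp_all add: herm_def)

lemmas herm_simps = herm_add_left herm_add_right herm_diff_left herm_diff_right
  herm_scale_left herm_scale_right herm_scaleR_left herm_scaleR_right

lemma cnj_herm: "cnj (herm z w) = herm w z"
  by (simp add: herm_def mult.commute)

lemma Re_herm: "Re (herm z w) = z \<bullet> w"
  by (simp add: herm_def inner_vec_def inner_complex_def Re_sum)

lemma herm_self: "herm z z = of_real ((norm z)\<^sup>2)"
proof (rule complex_eqI)
  show "Re (herm z z) = Re (of_real ((norm z)\<^sup>2))"
    by (simp add: Re_herm dot_square_norm)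
  have "cnj (herm z z) = herm z z" by (rule cnj_herm)
  then show "Im (herm z z) = Im (of_real ((norm z)\<^sup>2))"
    by (metis Im_complex_of_real complex_cnj_cancel_iff Reals_cnj_iff complex_is_Real_iff)
qed

lemma norm_vector_scalar_mult: "norm (c *s (x :: complex ^ 'n)) = cmod c * norm x"
proof -
  have "complex_of_real ((norm (c *s x))\<^sup>2) = of_real ((cmod c * norm x)\<^sup>2)"
    unfolding herm_self[symmetric] herm_simps
    by (simp add: herm_self power_mult_distrib complex_norm_square[of c] mult.assoc mult.left_commute del: of_real_power)
  then have "(norm (c *s x))\<^sup>2 = (cmod c * norm x)\<^sup>2"
    by (simp only: of_real_eq_iff)
  then show ?thesis by (simp add: power2_eq_iff_nonneg)
qed

lemma herm_Cauchy_Schwarz: "cmod (herm z w) \<le> norm z * norm w"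
proof (cases "herm z w = 0")
  case False
  define c where "c = cnj (herm z w) / cmod (herm z w)"
  have c: "cmod c = 1" using False by (simp add: c_def norm_divide)
  have "c * herm z w = of_real (cmod (herm z w))"
    using False by (simp add: c_def complex_norm_square[symmetric] power2_eq_square mult.commute)
  then have "cmod (herm z w) = Re (herm (c *s z) w)"
    by (simp add: herm_scale_left)
  also have "\<dots> \<le> norm (c *s z) * norm w"
    unfolding Re_herm by (rule norm_cauchy_schwarz)
  finally show ?thesis by (simp add: norm_vector_scalar_mult c)
qed simp

lemma line_proj_add: "line_proj a (x + y) = line_proj a x + line_proj a y"
  by (simp add: line_proj_def herm_simps add_divide_distrib vec_eq_iff algebra_simps)

lemma line_proj_scale: "line_proj a (c *s x) = c *s line_proj a x"
  by (simp add: line_proj_def herm_simps)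

lemma line_proj_self [simp]: "line_proj a a = a"
  by (cases "a = 0") (simp_all add: line_proj_def herm_self)

lemma herm_line_proj_left_self: "herm (line_proj a x) a = herm x a"
  by (cases "a = 0") (simp_all add: line_proj_def herm_simps herm_self)

lemma herm_line_proj_line_proj:
  "of_real ((norm a)\<^sup>2) * herm (line_proj a x) (line_proj a y) = herm x a * herm a y"
  by (cases "a = 0") (simp_all add: line_proj_def herm_simps herm_self cnj_herm)

lemma herm_line_proj_left: "herm (line_proj a x) y = herm (line_proj a x) (line_proj a y)"
  by (cases "a = 0") (simp_all add: line_proj_def herm_simps herm_self cnj_herm)

lemma herm_line_proj_right: "herm x (line_proj a y) = herm (line_proj a x) (line_proj a y)"
  by (cases "a = 0") (simp_all add: line_proj_def herm_simps herm_self cnj_herm)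

definition defect :: "complex ^ 'n \<Rightarrow> real" where
  "defect z = 1 - (norm z)\<^sup>2"

lemma defect_pos: "norm z < 1 \<Longrightarrow> 0 < defect z"
  by (simp add: defect_def abs_square_less_1)

lemma norm_less_1_iff_defect: "norm z < 1 \<longleftrightarrow> 0 < defect z"
  by (simp add: defect_def abs_square_less_1)

text \<open>
  Up to sign this is the derivative at 0 of the involution centred at \<open>a\<close>; it describes the shape and
  the size of Bergman balls around \<open>a\<close>.
\<close>

definition frame_map :: "complex ^ 'n \<Rightarrow> complex ^ 'n \<Rightarrow> complex ^ 'n" where
  "frame_map a v = defect a *\<^sub>R line_proj a v + sqrt (defect a) *\<^sub>R (v - line_proj a v)"

lemma frame_map_add: "frame_map a (x + y) = frame_map a x + frame_map a y"
  by (simp add: frame_map_def line_proj_add algebra_simps)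

lemma frame_map_scale: "frame_map a (c *s x) = c *s frame_map a x"
  by (simp add: frame_map_def line_proj_scale vec_eq_iff algebra_simps)

lemma frame_map_scaleR: "frame_map a (c *\<^sub>R x) = c *\<^sub>R frame_map a x"
  by (simp add: scaleR_eq_vector_scalar_mult frame_map_scale)

lemma linear_frame_map: "linear (frame_map a)"
  by (rule linearI) (simp_all add: frame_map_add frame_map_scaleR)

lemma herm_frame_map_self: "herm (frame_map a v) a = of_real (defect a) * herm v a"
  by (simp add: frame_map_def herm_simps herm_line_proj_left_self)

lemma herm_self_frame_map: "herm a (frame_map a v) = of_real (defect a) * herm a v"
  by (metis cnj_herm complex_cnj_complex_of_real complex_cnj_mult herm_frame_map_self)

text \<open>
  Orthogonally to \<open>a\<close> the dilation multiplies the form by \<open>1 - |a|^2\<close>, along \<open>a\<close> by its square; the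
  missing factor \<open>1 - |a|^2\<close> produces the correction \<open>herm v a * herm a u\<close>.
\<close>

lemma herm_frame_map:
  assumes "norm a < 1"
  shows "herm (frame_map a v) (frame_map a u) = of_real (defect a) * (herm v u - herm v a * herm a u)"
proof -
  define d where "d = defect a"
  have d: "0 < d" using assms by (simp add: d_def defect_pos)
  have dd: "complex_of_real (sqrt d) * of_real (sqrt d) = of_real d"
    using d by (simp flip: of_real_mult)
  define P where "P = herm (line_proj a v) (line_proj a u)"
  have 1: "herm (frame_map a v) (frame_map a u) = of_real d * of_real d * P
      + of_real (sqrt d) * of_real (sqrt d) * (herm v u - P)"
    unfolding frame_map_def d_def[symmetric]
    by (simp add: herm_simps herm_line_proj_left[of a v u] herm_line_proj_right[of v a u] P_def[symmetric] algebra_simps)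
  have "complex_of_real d = 1 - of_real ((norm a)\<^sup>2)" by (simp add: d_def defect_def)
  then have "of_real d * P = P - herm v a * herm a u"
    using herm_line_proj_line_proj[of a v u] by (simp only: P_def left_diff_distrib) simp
  then have "of_real d * of_real d * P = of_real d * (P - herm v a * herm a u)"
    by (simp only: mult.assoc)
  then show ?thesis
    unfolding 1 dd by (simp add: d_def[symmetric] algebra_simps)
qed

text \<open>
  All of the geometry of the ball used below comes from this identity: \<open>u = 0\<close> gives \<open>1 - <z,a>\<close>,
  \<open>u = v\<close> gives \<open>1 - |z|^2\<close>, and the general case gives the triangle inequality.
\<close>

lemma one_minus_herm_frame_map:
  assumes "norm a < 1"
  shows "1 - herm (a + frame_map a v) (a + frame_map a u)
       = of_real (defect a) * ((1 - herm v a) * (1 - herm a u) - herm v u)"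
proof -
  have "herm a a = 1 - of_real (defect a)"
    by (simp add: herm_self defect_def)
  then show ?thesis
    by (simp add: herm_simps herm_frame_map[OF assms] herm_frame_map_self herm_self_frame_map algebra_simps)
qed

lemma defect_frame_map:
  assumes "norm a < 1"
  shows "defect (a + frame_map a v) = defect a * ((cmod (1 - herm v a))\<^sup>2 - (norm v)\<^sup>2)"
proof -
  have "complex_of_real (defect (a + frame_map a v))
      = of_real (defect a * ((cmod (1 - herm v a))\<^sup>2 - (norm v)\<^sup>2))"
  proof -
    have "complex_of_real (defect (a + frame_map a v)) = 1 - herm (a + frame_map a v) (a + frame_map a v)"
      by (simp add: defect_def herm_self)
    also have "\<dots> = of_real (defect a) * ((1 - herm v a) * cnj (1 - herm v a) - herm v v)"
      unfolding one_minus_herm_frame_map[OF assms] by (simp add: cnj_herm)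
    also have "\<dots> = of_real (defect a * ((cmod (1 - herm v a))\<^sup>2 - (norm v)\<^sup>2))"
      by (simp only: complex_norm_square[symmetric] herm_self of_real_diff of_real_mult)
    finally show ?thesis .
  qed
  then show ?thesis by (simp only: of_real_eq_iff)
qed

lemma norm_frame_map:
  assumes "norm a < 1"
  shows "(norm (frame_map a v))\<^sup>2 = defect a * ((norm v)\<^sup>2 - (cmod (herm v a))\<^sup>2)"
proof -
  have "complex_of_real ((norm (frame_map a v))\<^sup>2) = herm (frame_map a v) (frame_map a v)"
    by (simp add: herm_self)
  also have "\<dots> = of_real (defect a) * (herm v v - herm v a * cnj (herm v a))"
    unfolding herm_frame_map[OF assms] by (simp add: cnj_herm)
  also have "\<dots> = of_real (defect a * ((norm v)\<^sup>2 - (cmod (herm v a))\<^sup>2))"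
    by (simp only: complex_norm_square[symmetric] herm_self of_real_diff of_real_mult)
  finally show ?thesis by (simp only: of_real_eq_iff)
qed

lemma norm_frame_map_ge:
  assumes "norm a < 1"
  shows "defect a * norm v \<le> norm (frame_map a v)"
proof -
  have "(cmod (herm v a))\<^sup>2 \<le> (norm v * norm a)\<^sup>2"
    by (intro power_mono herm_Cauchy_Schwarz) auto
  then have "(norm v)\<^sup>2 * defect a \<le> (norm v)\<^sup>2 - (cmod (herm v a))\<^sup>2"
    by (simp add: defect_def power_mult_distrib algebra_simps)
  then have "defect a * ((norm v)\<^sup>2 * defect a) \<le> (norm (frame_map a v))\<^sup>2"
    unfolding norm_frame_map[OF assms] using defect_pos[OF assms] by (intro mult_left_mono) auto
  then have "(defect a * norm v)\<^sup>2 \<le> (norm (frame_map a v))\<^sup>2"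
    by (simp add: power2_eq_square algebra_simps)
  then show ?thesis by (rule power2_le_imp_le) simp
qed

lemma frame_map_surj:
  assumes "norm a < 1"
  obtains v where "z = a + frame_map a v"
proof -
  have "inj (frame_map a)"
    unfolding linear_injective_0[OF linear_frame_map]
    using norm_frame_map_ge[OF assms] defect_pos[OF assms]
    by (metis mult_pos_pos norm_eq_zero not_less zero_less_norm_iff)
  then have "surj (frame_map a)"
    using linear_inj_imp_surj[OF linear_frame_map] by blast
  then obtain v where "frame_map a v = z - a" by (metis surjD)
  then show thesis using that[of v] by simp
qed

text \<open>
  With \<open>s^2 = 1 - |a|^2\<close> and \<open>\<zeta> = a / |a|\<close>, the dilation is \<open>s\<close> times the product of the two real
  stretches by \<open>s\<close> along the orthonormal vectors \<open>\<zeta>\<close> and \<open>\<i> \<zeta>\<close>, so its real determinant is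
  \<open>s^(2n) * s * s\<close>.
\<close>

lemma nn_integral_frame_map:
  fixes a :: "complex ^ 'n" and F :: "complex ^ 'n \<Rightarrow> ennreal"
  assumes a: "norm a < 1" and c: "0 < c" and [measurable]: "F \<in> borel_measurable borel"
  shows "(\<integral>\<^sup>+y. F y \<partial>lborel)
       = ennreal (c ^ (2 * CARD('n)) * defect a ^ (CARD('n) + 1)) * (\<integral>\<^sup>+u. F (a + frame_map a (c *\<^sub>R u)) \<partial>lborel)"
proof (cases "a = 0")
  case True
  then have "frame_map a u = u" for u
    by (simp add: frame_map_def line_proj_def defect_def)
  then show ?thesis using True nn_integral_lborel_scale[of F c] c
    by (simp add: defect_def mult.commute)
next
  case False
  define s where "s = sqrt (defect a)"
  have s: "0 < s" "s\<^sup>2 = defect a" using defect_pos[OF a] by (simp_all add: s_def)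
  define \<zeta> where "\<zeta> = (1 / norm a) *\<^sub>R a"
  define \<eta> where "\<eta> = \<i> *s \<zeta>"
  have n\<zeta>: "norm \<zeta> = 1" and n\<eta>: "norm \<eta> = 1"
    using False by (simp_all add: \<zeta>_def \<eta>_def norm_vector_scalar_mult)
  have orth: "\<eta> \<bullet> \<zeta> = 0"
    unfolding Re_herm[symmetric] by (simp add: \<eta>_def herm_simps herm_self)
  have P: "line_proj a u = (u \<bullet> \<zeta>) *\<^sub>R \<zeta> + (u \<bullet> \<eta>) *\<^sub>R \<eta>" for u
  proof -
    have "herm u \<zeta> = of_real (u \<bullet> \<zeta>) + \<i> * of_real (u \<bullet> \<eta>)"
      unfolding Re_herm[symmetric] by (simp add: \<eta>_def herm_simps complex_eq_iff)
    moreover have "line_proj a u = herm u \<zeta> *s \<zeta>"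
      using False by (simp add: line_proj_def \<zeta>_def herm_simps herm_self scaleR_eq_vector_scalar_mult power2_eq_square)
    ultimately show ?thesis
      by (simp add: \<eta>_def vec_eq_iff scaleR_conv_of_real[where 'a = complex] algebra_simps)
  qed
  define S where "S \<xi> x = x + ((s - 1) * (x \<bullet> \<xi>)) *\<^sub>R \<xi>" for \<xi> x :: "complex ^ 'n"
  have mS [measurable]: "S \<xi> \<in> borel_measurable borel" for \<xi>
    unfolding S_def by (intro borel_measurable_continuous_onI continuous_intros)
  have fr: "s *\<^sub>R S \<zeta> (S \<eta> u) = frame_map a u" for u
  proof -
    have "s *\<^sub>R S \<zeta> (S \<eta> u) = s *\<^sub>R (u + (s - 1) *\<^sub>R line_proj a u)"
      by (simp add: S_def P inner_simps orth algebra_simps)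
    also have "\<dots> = s\<^sup>2 *\<^sub>R line_proj a u + s *\<^sub>R (u - line_proj a u)"
      by (simp add: algebra_simps power2_eq_square)
    also have "\<dots> = frame_map a u"
      unfolding frame_map_def s(2) by (simp add: s_def)
    finally show ?thesis .
  qed
  have "(\<integral>\<^sup>+y. F y \<partial>lborel) = (\<integral>\<^sup>+y. F (a + y) \<partial>lborel)"
    by (rule nn_integral_lborel_shift[symmetric]) measurable
  also have "\<dots> = ennreal (s ^ (2 * CARD('n))) * (\<integral>\<^sup>+y. F (a + s *\<^sub>R y) \<partial>lborel)"
    using nn_integral_lborel_scale[of "\<lambda>y. F (a + y)" s] s(1) by (simp add: mult.commute)
  also have "(\<integral>\<^sup>+y. F (a + s *\<^sub>R y) \<partial>lborel) = ennreal s * (\<integral>\<^sup>+y. F (a + s *\<^sub>R S \<zeta> y) \<partial>lborel)"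
    using nn_integral_stretch_unit_vector[OF n\<zeta> s(1), of "\<lambda>y. F (a + s *\<^sub>R y)"] by (simp add: S_def)
  also have "(\<integral>\<^sup>+y. F (a + s *\<^sub>R S \<zeta> y) \<partial>lborel) = ennreal s * (\<integral>\<^sup>+y. F (a + s *\<^sub>R S \<zeta> (S \<eta> y)) \<partial>lborel)"
    using nn_integral_stretch_unit_vector[OF n\<eta> s(1), of "\<lambda>y. F (a + s *\<^sub>R S \<zeta> y)"] by (simp add: S_def)
  also have "(\<integral>\<^sup>+y. F (a + s *\<^sub>R S \<zeta> (S \<eta> y)) \<partial>lborel)
      = ennreal (c ^ (2 * CARD('n))) * (\<integral>\<^sup>+y. F (a + s *\<^sub>R S \<zeta> (S \<eta> (c *\<^sub>R y))) \<partial>lborel)"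
    using nn_integral_lborel_scale[of "\<lambda>y. F (a + s *\<^sub>R S \<zeta> (S \<eta> y))" c] c by (simp add: mult.commute)
  also have "(\<integral>\<^sup>+y. F (a + s *\<^sub>R S \<zeta> (S \<eta> (c *\<^sub>R y))) \<partial>lborel) = (\<integral>\<^sup>+u. F (a + frame_map a (c *\<^sub>R u)) \<partial>lborel)"
    by (simp add: fr)
  finally have "(\<integral>\<^sup>+y. F y \<partial>lborel) = ennreal (s ^ (2 * CARD('n)) * (s * (s * c ^ (2 * CARD('n)))))
      * (\<integral>\<^sup>+u. F (a + frame_map a (c *\<^sub>R u)) \<partial>lborel)"
    using s(1) c by (simp add: ennreal_mult mult.assoc)
  also have "s ^ (2 * CARD('n)) * (s * (s * c ^ (2 * CARD('n)))) = c ^ (2 * CARD('n)) * defect a ^ (CARD('n) + 1)"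
    by (simp add: power_mult s(2)[symmetric] power2_eq_square)
  finally show ?thesis .
qed

section \<open>The Bergman metric\<close>

lemma one_minus_herm_nonzero:
  assumes "norm a < 1" "norm z < 1"
  shows "0 < cmod (1 - herm z a)"
proof -
  have "cmod (herm z a) \<le> norm z * norm a" by (rule herm_Cauchy_Schwarz)
  also have "\<dots> < 1" using assms by (metis mult_less_cancel_right2 mult_strict_mono' norm_ge_zero mult.right_neutral)
  finally have "herm z a \<noteq> 1" by auto
  then show ?thesis by simp
qed

text \<open>
  The numerator of the involution collapses to \<open>- (1 - |a|^2) v\<close> and its denominator to
  \<open>(1 - |a|^2) (1 - <v,a>)\<close>.
\<close>

lemma ball_aut_frame_map:
  assumes "norm a < 1"
  shows "ball_aut a (a + frame_map a v) = - (1 / (1 - herm v a)) *s v"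
proof -
  define d where "d = defect a"
  have d: "0 < d" using assms by (simp add: d_def defect_pos)
  have P: "line_proj a (frame_map a v) = d *\<^sub>R line_proj a v"
    using herm_frame_map_self[of a v] by (simp add: line_proj_def d_def vec_eq_iff scaleR_conv_of_real[where 'a = complex])
  have Q: "sqrt d *\<^sub>R (frame_map a v - line_proj a (frame_map a v)) = d *\<^sub>R (v - line_proj a v)"
    unfolding P using d by (simp add: frame_map_def d_def[symmetric] algebra_simps flip: scaleR_scaleR)
      (simp add: d_def)
  have "1 - herm (a + frame_map a v) a = of_real d * (1 - herm v a)"
    using one_minus_herm_frame_map[OF assms, of v 0] by (simp add: frame_map_def line_proj_def d_def)
  then have "ball_aut a (a + frame_map a v)
     = (1 / (of_real d * (1 - herm v a))) *s (a - (a + d *\<^sub>R line_proj a v) - d *\<^sub>R (v - line_proj a v))"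
    unfolding ball_aut_def using Q by (simp add: line_proj_add P d_def[symmetric] defect_def[symmetric])
  also have "\<dots> = (1 / (of_real d * (1 - herm v a))) *s (- (of_real d *s v))"
    by (simp add: algebra_simps scaleR_eq_vector_scalar_mult[symmetric])
  also have "\<dots> = - (1 / (1 - herm v a)) *s v"
    using d by (simp add: vec_eq_iff)
  finally show ?thesis .
qed

lemma one_minus_norm_ball_aut:
  assumes "norm a < 1" "norm z < 1"
  shows "1 - (norm (ball_aut a z))\<^sup>2 = defect a * defect z / (cmod (1 - herm z a))\<^sup>2"
proof -
  obtain v where z: "z = a + frame_map a v" using frame_map_surj[OF assms(1)] .
  have h: "1 - herm z a = of_real (defect a) * (1 - herm v a)"
    using one_minus_herm_frame_map[OF assms(1), of v 0] by (simp add: frame_map_def line_proj_def z)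
  have d: "0 < defect a" using assms by (simp add: defect_pos)
  have nz: "cmod (1 - herm v a) \<noteq> 0"
    using one_minus_herm_nonzero[OF assms] unfolding h by auto
  have n: "norm (ball_aut a z) = norm v / cmod (1 - herm v a)"
    unfolding z ball_aut_frame_map[OF assms(1)] by (simp add: norm_vector_scalar_mult norm_divide)
  have dz: "defect z = defect a * ((cmod (1 - herm v a))\<^sup>2 - (norm v)\<^sup>2)"
    unfolding z by (rule defect_frame_map[OF assms(1)])
  show ?thesis
    unfolding n dz h norm_mult using nz d by (simp add: field_simps power2_eq_square)
qed

lemma norm_ball_aut_less_1:
  assumes "norm a < 1" "norm z < 1"
  shows "norm (ball_aut a z) < 1"
proof -
  have "0 < 1 - (norm (ball_aut a z))\<^sup>2"
    unfolding one_minus_norm_ball_aut[OF assms]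
    using assms by (intro divide_pos_pos mult_pos_pos zero_less_power one_minus_herm_nonzero defect_pos)
  then show ?thesis by (simp add: abs_square_less_1)
qed

lemma berg_dist_eq_artanh: "berg_dist a z = artanh (norm (ball_aut a z))"
  by (simp add: berg_dist_def artanh_def)

lemma tanh_artanh_real:
  assumes "0 \<le> x" "x < (1::real)"
  shows "tanh (artanh x) = x"
proof -
  have "exp (- 2 * artanh x) = (1 - x) / (1 + x)"
    using assms by (simp add: artanh_def exp_minus)
  then show ?thesis
    using assms unfolding tanh_real_altdef by (simp only:) (simp add: field_simps)
qed

lemma tanh_berg_dist:
  assumes "norm a < 1" "norm z < 1"
  shows "tanh (berg_dist a z) = norm (ball_aut a z)"
  unfolding berg_dist_eq_artanh using norm_ball_aut_less_1[OF assms]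
  by (intro tanh_artanh_real) simp_all

lemma berg_dist_nonneg:
  assumes "norm a < 1" "norm z < 1"
  shows "0 \<le> berg_dist a z"
  using tanh_berg_dist[OF assms] by (metis norm_ge_zero tanh_real_nonneg_iff)

text \<open>
  This form of the metric makes its symmetry evident and turns the triangle inequality into the
  addition theorem of \<open>cosh\<close>.
\<close>

lemma cosh_berg_dist_square:
  assumes "norm a < 1" "norm z < 1"
  shows "(cosh (berg_dist a z))\<^sup>2 = (cmod (1 - herm z a))\<^sup>2 / (defect a * defect z)"
proof -
  have "1 - (tanh (berg_dist a z))\<^sup>2 = 1 / (cosh (berg_dist a z))\<^sup>2"
    by (simp add: tanh_def power_divide sinh_square_eq diff_divide_distrib)
  then have "(cosh (berg_dist a z))\<^sup>2 = 1 / (1 - (norm (ball_aut a z))\<^sup>2)"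
    by (simp add: tanh_berg_dist[OF assms])
  then show ?thesis unfolding one_minus_norm_ball_aut[OF assms] by simp
qed

lemma berg_dist_commute:
  assumes "norm a < 1" "norm z < 1"
  shows "berg_dist a z = berg_dist z a"
proof -
  have "cmod (1 - herm z a) = cmod (1 - herm a z)"
    by (metis cnj_herm complex_cnj_diff complex_cnj_one complex_mod_cnj)
  then have "(cosh (berg_dist a z))\<^sup>2 = (cosh (berg_dist z a))\<^sup>2"
    using assms by (simp add: cosh_berg_dist_square mult.commute)
  then have "cosh (berg_dist a z) = cosh (berg_dist z a)"
    by (simp add: power2_eq_iff_nonneg)
  then show ?thesis
    using berg_dist_nonneg[OF assms] berg_dist_nonneg[OF assms(2,1)]
    by (metis cosh_real_strict_mono less_irrefl linorder_neqE)
qed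

text \<open>
  In the coordinate centred at \<open>w\<close>, Cauchy-Schwarz bounds \<open>cosh (berg_dist x z)\<close> by
  \<open>cosh s * cosh t * (1 + tanh s * tanh t) = cosh (s + t)\<close>, where \<open>s\<close> and \<open>t\<close> are the distances of \<open>x\<close> and
  \<open>z\<close> from \<open>w\<close>.
\<close>

lemma berg_dist_triangle:
  assumes "norm x < 1" "norm w < 1" "norm z < 1"
  shows "berg_dist x z \<le> berg_dist x w + berg_dist w z"
proof -
  define s t where "s = berg_dist w x" and "t = berg_dist w z"
  have st: "0 \<le> s" "0 \<le> t" using assms by (simp_all add: s_def t_def berg_dist_nonneg)
  obtain v where x: "x = w + frame_map w v" using frame_map_surj[OF assms(2)] .
  obtain u where z: "z = w + frame_map w u" using frame_map_surj[OF assms(2)] .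
  define A where "A = cmod (1 - herm v w)"
  define B where "B = cmod (1 - herm u w)"
  have d: "0 < defect w" using assms by (simp add: defect_pos)
  have dx: "0 < defect x" and dz: "0 < defect z" using assms by (simp_all add: defect_pos)
  have hx: "1 - herm x w = of_real (defect w) * (1 - herm v w)"
    using one_minus_herm_frame_map[OF assms(2), of v 0] by (simp add: frame_map_def line_proj_def x)
  have hz: "1 - herm z w = of_real (defect w) * (1 - herm u w)"
    using one_minus_herm_frame_map[OF assms(2), of u 0] by (simp add: frame_map_def line_proj_def z)
  have A: "0 < A" using one_minus_herm_nonzero[OF assms(2,1)] unfolding hx by (auto simp: A_def)
  have B: "0 < B" using one_minus_herm_nonzero[OF assms(2,3)] unfolding hz by (auto simp: B_def)
  have tv: "norm v = A * tanh s"
    unfolding s_def tanh_berg_dist[OF assms(2,1)] unfolding x ball_aut_frame_map[OF assms(2)]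
    using A by (simp add: norm_vector_scalar_mult norm_divide A_def)
  have tu: "norm u = B * tanh t"
    unfolding t_def tanh_berg_dist[OF assms(2,3)] unfolding z ball_aut_frame_map[OF assms(2)]
    using B by (simp add: norm_vector_scalar_mult norm_divide B_def)
  have cs: "(cosh s)\<^sup>2 = defect w * A\<^sup>2 / defect x"
    using d unfolding s_def cosh_berg_dist_square[OF assms(2,1)] hx
    by (simp add: norm_mult A_def power2_eq_square)
  have ct: "(cosh t)\<^sup>2 = defect w * B\<^sup>2 / defect z"
    using d unfolding t_def cosh_berg_dist_square[OF assms(2,3)] hz
    by (simp add: norm_mult B_def power2_eq_square)
  have "cmod (1 - herm z x) = defect w * cmod ((1 - herm u w) * (1 - herm w v) - herm u v)"
    unfolding x z one_minus_herm_frame_map[OF assms(2)] using d by (simp add: norm_mult)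
  also have "\<dots> \<le> defect w * (B * A + norm u * norm v)"
  proof (intro mult_left_mono)
    have "cmod (1 - herm w v) = A"
      unfolding A_def by (metis cnj_herm complex_cnj_diff complex_cnj_one complex_mod_cnj)
    then show "cmod ((1 - herm u w) * (1 - herm w v) - herm u v) \<le> B * A + norm u * norm v"
      using norm_triangle_ineq4[of "(1 - herm u w) * (1 - herm w v)" "herm u v"]
        herm_Cauchy_Schwarz[of u v] by (simp add: norm_mult B_def)
  qed (use d in simp)
  also have "\<dots> = defect w * A * B * (1 + tanh s * tanh t)"
    by (simp add: tu tv algebra_simps)
  finally have main: "cmod (1 - herm z x) \<le> defect w * A * B * (1 + tanh s * tanh t)" .
  have "(cosh (berg_dist x z))\<^sup>2 \<le> (defect w * A * B * (1 + tanh s * tanh t))\<^sup>2 / (defect x * defect z)"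
    unfolding cosh_berg_dist_square[OF assms(1,3)] using main dx dz
    by (intro divide_right_mono power_mono) auto
  also have "\<dots> = (cosh s)\<^sup>2 * (cosh t)\<^sup>2 * (1 + tanh s * tanh t)\<^sup>2"
    unfolding cs ct by (simp add: power_mult_distrib) (simp add: power2_eq_square)
  also have "\<dots> = (cosh (s + t))\<^sup>2"
  proof -
    have "cosh s * cosh t * (1 + tanh s * tanh t) = cosh (s + t)"
      by (simp add: cosh_add tanh_def distrib_left)
    then show ?thesis by (simp only: power_mult_distrib[symmetric])
  qed
  finally have "cosh (berg_dist x z) \<le> cosh (s + t)"
    by (rule power2_le_imp_le) simp
  then have "berg_dist x z \<le> s + t"
    using st berg_dist_nonneg[OF assms(1,3)] by (simp add: cosh_real_nonneg_le_iff)
  then show ?thesis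
    by (simp add: s_def t_def berg_dist_commute assms)
qed

lemma berg_ball_subset_unit_ball: "berg_ball a \<gamma> \<subseteq> unit_ball"
  by (auto simp: berg_ball_def)

lemma berg_ball_commute:
  assumes "norm a < 1" "norm z < 1"
  shows "z \<in> berg_ball a \<gamma> \<longleftrightarrow> a \<in> berg_ball z \<gamma>"
  using assms by (simp add: berg_ball_def berg_dist_commute)

lemma berg_ball_trans:
  assumes "norm a < 1" "w \<in> berg_ball a \<gamma>" "z \<in> berg_ball w \<delta>"
  shows "z \<in> berg_ball a (\<gamma> + \<delta>)"
  using assms berg_dist_triangle[of a w z] by (simp add: berg_ball_def)

lemma mem_berg_ball_iff:
  assumes "0 < \<gamma>" "norm a < 1" "norm z < 1"
  shows "z \<in> berg_ball a \<gamma> \<longleftrightarrow> (cmod (1 - herm z a))\<^sup>2 < (cosh \<gamma>)\<^sup>2 * (defect a * defect z)"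
proof -
  have "z \<in> berg_ball a \<gamma> \<longleftrightarrow> (cosh (berg_dist a z))\<^sup>2 < (cosh \<gamma>)\<^sup>2"
    using assms berg_dist_nonneg[OF assms(2,3)]
    using cosh_real_nonneg_le_iff[of \<gamma> "berg_dist a z"]
    by (simp add: berg_ball_def flip: abs_le_square_iff not_le)
  then show ?thesis
    unfolding cosh_berg_dist_square[OF assms(2,3)] using defect_pos[OF assms(2)] defect_pos[OF assms(3)]
    by (simp add: divide_less_eq)
qed

text \<open>
  Membership in the Bergman ball reads \<open>|v| < tanh \<gamma> * |1 - <v,a>|\<close>, and \<open>1 - |v| \<le> |1 - <v,a>|\<close>.  The
  upper bound \<open>|1 - <v,a>| \<le> 1 + |v|\<close> gives the opposite inclusion in the next lemma.
\<close>

lemma frame_map_in_berg_ball: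
  assumes "0 < \<gamma>" "norm a < 1" "norm v < tanh \<gamma> / (1 + tanh \<gamma>)"
  shows "a + frame_map a v \<in> berg_ball a \<gamma>"
proof -
  define \<rho> where "\<rho> = tanh \<gamma>"
  have \<rho>: "0 < \<rho>" "\<rho> < 1" using assms(1) by (simp_all add: \<rho>_def tanh_real_lt_1)
  have "norm v < \<rho> * (1 - norm v)"
    using assms(3) \<rho> unfolding \<rho>_def[symmetric] by (simp add: field_simps)
  also have "\<dots> \<le> \<rho> * cmod (1 - herm v a)"
  proof (intro mult_left_mono)
    have "cmod (herm v a) \<le> norm v * norm a" by (rule herm_Cauchy_Schwarz)
    also have "\<dots> \<le> norm v" using assms(2) by (intro mult_left_le) auto
    finally show "1 - norm v \<le> cmod (1 - herm v a)"
      using norm_triangle_ineq2[of 1 "herm v a"] by simp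
  qed (use \<rho> in simp)
  finally have v: "norm v < \<rho> * cmod (1 - herm v a)" .
  then have "norm v < 1 * cmod (1 - herm v a)"
    using \<rho> mult_right_mono[of \<rho> 1 "cmod (1 - herm v a)"] norm_ge_zero[of "1 - herm v a"] by linarith
  then have "(norm v)\<^sup>2 < (cmod (1 - herm v a))\<^sup>2"
    by (intro power_strict_mono) auto
  then have "0 < defect (a + frame_map a v)"
    unfolding defect_frame_map[OF assms(2)] using defect_pos[OF assms(2)] by simp
  then have z: "norm (a + frame_map a v) < 1" by (simp add: norm_less_1_iff_defect)
  have "tanh (berg_dist a (a + frame_map a v)) < \<rho>"
    unfolding tanh_berg_dist[OF assms(2) z] ball_aut_frame_map[OF assms(2)]
    using v by (cases "cmod (1 - herm v a) = 0") (simp_all add: norm_vector_scalar_mult norm_divide divide_less_eq \<rho>(1))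
  then have "berg_dist a (a + frame_map a v) < \<gamma>"
    by (simp add: \<rho>_def)
  then show ?thesis using z by (simp add: berg_ball_def)
qed

lemma berg_ball_in_frame_ball:
  assumes "norm a < 1" "z \<in> berg_ball a \<gamma>"
  obtains v where "z = a + frame_map a v" "norm v \<le> tanh \<gamma> / (1 - tanh \<gamma>)"
proof -
  obtain v where z: "z = a + frame_map a v" using frame_map_surj[OF assms(1)] .
  have n: "norm z < 1" using assms by (simp add: berg_ball_def)
  have \<rho>: "tanh \<gamma> < 1" "0 \<le> tanh \<gamma>"
    using assms berg_dist_nonneg[OF assms(1) n] by (simp_all add: berg_ball_def tanh_real_lt_1)
  have "1 - herm z a = of_real (defect a) * (1 - herm v a)"
    using one_minus_herm_frame_map[OF assms(1), of v 0] by (simp add: frame_map_def line_proj_def z)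
  then have nz: "0 < cmod (1 - herm v a)"
    using one_minus_herm_nonzero[OF assms(1) n] by auto
  have "norm v / cmod (1 - herm v a) < tanh \<gamma>"
  proof -
    have "tanh (berg_dist a z) < tanh \<gamma>" using assms by (simp add: berg_ball_def)
    then show ?thesis unfolding tanh_berg_dist[OF assms(1) n] unfolding z ball_aut_frame_map[OF assms(1)]
      by (simp add: norm_vector_scalar_mult norm_divide)
  qed
  then have "norm v \<le> tanh \<gamma> * cmod (1 - herm v a)"
    using nz by (simp add: field_simps)
  also have "\<dots> \<le> tanh \<gamma> * (1 + norm v)"
  proof (intro mult_left_mono \<rho>)
    have "cmod (herm v a) \<le> norm v * norm a" by (rule herm_Cauchy_Schwarz)
    also have "\<dots> \<le> norm v" using assms(1) by (intro mult_left_le) auto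
    finally show "cmod (1 - herm v a) \<le> 1 + norm v"
      using norm_triangle_ineq4[of 1 "herm v a"] by simp
  qed
  finally have "norm v \<le> tanh \<gamma> / (1 - tanh \<gamma>)" using \<rho> by (simp add: field_simps)
  with z that show thesis by blast
qed

text \<open>
  From \<open>(1 - |z|^2) / 2 \<le> 1 - |z| \<le> |1 - <z,a>|\<close> and the formula for \<open>cosh\<close> of the distance.
\<close>

lemma defect_le_on_berg_ball:
  assumes "norm a < 1" "z \<in> berg_ball a \<gamma>"
  shows "defect z \<le> 4 * (cosh \<gamma>)\<^sup>2 * defect a"
proof -
  have n: "norm z < 1" using assms by (simp add: berg_ball_def)
  have \<gamma>: "0 < \<gamma>" using assms berg_dist_nonneg[OF assms(1) n] by (simp add: berg_ball_def)
  have d: "0 < defect z" using n by (rule defect_pos)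
  have "cmod (herm z a) \<le> norm z * norm a" by (rule herm_Cauchy_Schwarz)
  also have "\<dots> \<le> norm z" using assms(1) by (intro mult_left_le) auto
  finally have "1 - norm z \<le> cmod (1 - herm z a)"
    using norm_triangle_ineq2[of 1 "herm z a"] by simp
  moreover have "defect z \<le> 2 * (1 - norm z)"
  proof -
    have "defect z = (1 + norm z) * (1 - norm z)" by (simp add: defect_def power2_eq_square algebra_simps)
    also have "\<dots> \<le> 2 * (1 - norm z)" using n by (intro mult_right_mono) auto
    finally show ?thesis .
  qed
  ultimately have "(defect z)\<^sup>2 \<le> (2 * cmod (1 - herm z a))\<^sup>2"
    using d by (intro power_mono) auto
  also have "\<dots> < 4 * ((cosh \<gamma>)\<^sup>2 * (defect a * defect z))"
    using assms(2) unfolding mem_berg_ball_iff[OF \<gamma> assms(1) n] by (simp add: power_mult_distrib)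
  finally have "defect z * defect z \<le> (4 * (cosh \<gamma>)\<^sup>2 * defect a) * defect z"
    by (simp add: power2_eq_square algebra_simps)
  then show ?thesis using d by simp
qed

lemma defect_ge_on_berg_ball:
  assumes "norm a < 1" "z \<in> berg_ball a \<gamma>"
  shows "defect a \<le> 4 * (cosh \<gamma>)\<^sup>2 * defect z"
  using assms berg_ball_commute[of a z \<gamma>] by (intro defect_le_on_berg_ball) (auto simp: berg_ball_def)

text \<open>
  On a ray \<open>(1 - r t)^2 = (1 - r^2) (1 - t^2) + (r - t)^2\<close>, so the hypothesis bounds the square of
  \<open>sinh\<close> of the distance.
\<close>

lemma berg_dist_same_ray_le:
  assumes "norm \<zeta> = 1" "0 \<le> r" "r < 1" "0 \<le> t" "t < 1" "0 \<le> \<eta>"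
    and rt: "(r - t)\<^sup>2 \<le> (sinh \<eta>)\<^sup>2 * ((1 - r\<^sup>2) * (1 - t\<^sup>2))"
  shows "berg_dist (r *\<^sub>R \<zeta>) (t *\<^sub>R \<zeta>) \<le> \<eta>"
proof -
  have n: "norm (r *\<^sub>R \<zeta>) < 1" "norm (t *\<^sub>R \<zeta>) < 1" using assms by simp_all
  have d: "defect (r *\<^sub>R \<zeta>) = 1 - r\<^sup>2" "defect (t *\<^sub>R \<zeta>) = 1 - t\<^sup>2"
    using assms by (simp_all add: defect_def)
  have d0: "0 < 1 - r\<^sup>2" "0 < 1 - t\<^sup>2" using assms by (simp_all add: abs_square_less_1)
  have "1 - herm (t *\<^sub>R \<zeta>) (r *\<^sub>R \<zeta>) = of_real (1 - r * t)"
    using assms by (simp add: herm_simps herm_self)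
  then have h: "(cmod (1 - herm (t *\<^sub>R \<zeta>) (r *\<^sub>R \<zeta>)))\<^sup>2 = (1 - r * t)\<^sup>2"
    by (simp only: norm_of_real power2_abs)
  have "(1 - r * t)\<^sup>2 = (1 - r\<^sup>2) * (1 - t\<^sup>2) + (r - t)\<^sup>2"
    by (simp add: power2_eq_square algebra_simps)
  also have "\<dots> \<le> (1 + (sinh \<eta>)\<^sup>2) * ((1 - r\<^sup>2) * (1 - t\<^sup>2))"
    using rt by (simp add: algebra_simps)
  finally have "(cosh (berg_dist (r *\<^sub>R \<zeta>) (t *\<^sub>R \<zeta>)))\<^sup>2 \<le> (cosh \<eta>)\<^sup>2"
    unfolding cosh_berg_dist_square[OF n] h d using d0
    by (simp add: pos_divide_le_eq cosh_square_eq add.commute)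
  then have "cosh (berg_dist (r *\<^sub>R \<zeta>) (t *\<^sub>R \<zeta>)) \<le> cosh \<eta>"
    by (rule power2_le_imp_le) simp
  then show ?thesis using berg_dist_nonneg[OF n] assms(6) by (simp add: cosh_real_nonneg_le_iff)
qed

section \<open>Functions that are holomorphic on complex lines\<close>

text \<open>
  The mean-value inequality is needed for functions in \<open>hol_ball\<close> and for their radial derivatives.
  Holomorphy on complex lines together with continuity suffices for it, and this property passes to
  locally uniform limits of difference quotients by one-variable theorems.
\<close>

definition line_hol :: "(complex ^ 'n) set \<Rightarrow> (complex ^ 'n \<Rightarrow> complex) \<Rightarrow> bool" where
  "line_hol S h \<longleftrightarrow> continuous_on S h \<and> (\<forall>x v. (\<lambda>t. h (x + t *s v)) holomorphic_on {t. x + t *s v \<in> S})"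

lemma line_holD:
  assumes "line_hol S h"
  shows "continuous_on S h" "(\<lambda>t. h (x + t *s v)) holomorphic_on {t. x + t *s v \<in> S}"
  using assms by (auto simp: line_hol_def)

lemma bounded_linear_scalar_mult_left: "bounded_linear (\<lambda>t. t *s (v :: complex ^ 'n))"
  by (rule bounded_linear_intro[where K = "norm v"])
     (simp_all add: norm_vector_scalar_mult vec_eq_iff algebra_simps)

lemma bounded_linear_scalar_mult_right: "bounded_linear (\<lambda>x. t *s (x :: complex ^ 'n))"
  by (rule bounded_linear_intro[where K = "cmod t"])
     (simp_all add: norm_vector_scalar_mult vec_eq_iff algebra_simps)

lemma continuous_on_scalar_mult [continuous_intros]:
  fixes v :: "'a::topological_space \<Rightarrow> complex ^ 'n"
  assumes "continuous_on S g" "continuous_on S v"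
  shows "continuous_on S (\<lambda>x. g x *s v x)"
  unfolding vector_scalar_mult_def using assms
  by (intro continuous_on_vec_lambda continuous_intros) (auto intro: continuous_on_component)

lemma open_slice:
  fixes S :: "(complex ^ 'n) set"
  assumes "open S"
  shows "open {t. x + t *s v \<in> S}"
proof -
  have "continuous_on UNIV (\<lambda>t. x + t *s v)"
    by (intro continuous_intros)
  then show ?thesis
    using open_vimage[OF assms, of "\<lambda>t. x + t *s v"] by (simp add: vimage_def)
qed

lemma line_hol_subset:
  assumes "line_hol S h" "T \<subseteq> S"
  shows "line_hol T h"
  unfolding line_hol_def
proof (intro conjI allI)
  show "continuous_on T h" using line_holD(1)[OF assms(1)] assms(2) by (rule continuous_on_subset)
  show "(\<lambda>t. h (x + t *s v)) holomorphic_on {t. x + t *s v \<in> T}" for x v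
    by (rule holomorphic_on_subset[OF line_holD(2)[OF assms(1)]]) (use assms(2) in blast)
qed

lemma line_hol_locally:
  assumes "\<And>x. x \<in> S \<Longrightarrow> \<exists>U. open U \<and> x \<in> U \<and> line_hol U h"
  shows "line_hol S h"
  unfolding line_hol_def
proof (intro conjI allI)
  show "continuous_on S h"
    unfolding continuous_on_eq_continuous_within
  proof
    fix x assume "x \<in> S"
    then obtain U where "open U" "x \<in> U" "line_hol U h" using assms by blast
    then show "continuous (at x within S) h"
      by (metis line_holD(1) continuous_at_imp_continuous_at_within continuous_on_eq_continuous_at)
  qed
  show "(\<lambda>t. h (x + t *s v)) holomorphic_on {t. x + t *s v \<in> S}" for x v
    unfolding holomorphic_on_def
  proof
    fix t assume "t \<in> {t. x + t *s v \<in> S}"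
    then obtain U where U: "open U" "x + t *s v \<in> U" "line_hol U h" using assms by blast
    then have "(\<lambda>t. h (x + t *s v)) field_differentiable at t"
      using line_holD(2)[OF U(3), of x v] open_slice[OF U(1), of x v]
      by (simp add: holomorphic_on_imp_differentiable_at)
    then show "(\<lambda>t. h (x + t *s v)) field_differentiable at t within {t. x + t *s v \<in> S}"
      by (rule field_differentiable_at_within)
  qed
qed

lemma line_hol_const: "line_hol S (\<lambda>_. c)"
  by (simp add: line_hol_def)

lemma line_hol_diff: "line_hol S f \<Longrightarrow> line_hol S g \<Longrightarrow> line_hol S (\<lambda>x. f x - g x)"
  unfolding line_hol_def by (auto intro!: continuous_intros holomorphic_intros)

lemma line_hol_mult: "line_hol S f \<Longrightarrow> line_hol S g \<Longrightarrow> line_hol S (\<lambda>x. f x * g x)"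
  unfolding line_hol_def by (auto intro!: continuous_intros holomorphic_intros)

lemma line_hol_power: "line_hol S f \<Longrightarrow> line_hol S (\<lambda>x. f x ^ m)"
  unfolding line_hol_def by (auto intro!: continuous_intros holomorphic_intros)

lemma line_hol_sum: "(\<And>i. i \<in> I \<Longrightarrow> line_hol S (f i)) \<Longrightarrow> line_hol S (\<lambda>x. \<Sum>i\<in>I. f i x)"
  unfolding line_hol_def by (auto intro!: continuous_intros holomorphic_intros)

lemma line_hol_component: "line_hol S (\<lambda>x. x $ k)"
  unfolding line_hol_def by (auto intro!: continuous_intros holomorphic_intros)

lemma line_hol_affine:
  assumes "line_hol S h" and L: "linear L" "\<And>t v. L (t *s v) = t *s L v"
    and sub: "\<And>x. x \<in> T \<Longrightarrow> a + L x \<in> S"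
  shows "line_hol T (\<lambda>x. h (a + L x))"
  unfolding line_hol_def
proof (intro conjI allI)
  have "continuous_on T L"
    using L(1) by (intro linear_continuous_on) (simp add: linear_conv_bounded_linear)
  then show "continuous_on T (\<lambda>x. h (a + L x))"
    by (intro continuous_on_compose2[OF line_holD(1)[OF assms(1)]] continuous_intros) (use sub in auto)
  show "(\<lambda>t. h (a + L (x + t *s v))) holomorphic_on {t. x + t *s v \<in> T}" for x v
  proof -
    have "(\<lambda>t. h ((a + L x) + t *s L v)) holomorphic_on {t. x + t *s v \<in> T}"
      by (rule holomorphic_on_subset[OF line_holD(2)[OF assms(1)]])
         (use sub[of "x + _ *s v"] in \<open>auto simp: add.assoc linear_add[OF L(1)] L(2)\<close>)
    then show ?thesis by (simp add: linear_add[OF L(1)] L(2) add.assoc)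
  qed
qed

section \<open>Derivatives of holomorphic functions on the ball\<close>

abbreviation fderiv :: "(complex ^ 'n \<Rightarrow> complex) \<Rightarrow> complex ^ 'n \<Rightarrow> complex ^ 'n \<Rightarrow> complex" where
  "fderiv f z \<equiv> frechet_derivative f (at z)"

lemma hol_ball_fderiv:
  assumes "f \<in> hol_ball" "norm z < 1"
  shows "(f has_derivative fderiv f z) (at z)" "fderiv f z (c *s v) = c * fderiv f z v"
proof -
  obtain D where D: "(f has_derivative D) (at z)" "\<And>c v. D (c *s v) = c * D v"
    using assms(1) assms(2)[folded mem_ball_0] unfolding hol_ball_def by blast
  then have "D = fderiv f z" by (intro frechet_derivative_at)
  with D show "(f has_derivative fderiv f z) (at z)" "fderiv f z (c *s v) = c * fderiv f z v" by auto
qed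

lemma linear_fderiv: "f \<in> hol_ball \<Longrightarrow> norm z < 1 \<Longrightarrow> linear (fderiv f z)"
  using hol_ball_fderiv(1) has_derivative_linear by blast

lemma hol_ball_slice_derivative:
  assumes "f \<in> hol_ball" "norm (x + t *s v) < 1"
  shows "((\<lambda>t. f (x + t *s v)) has_field_derivative fderiv f (x + t *s v) v) (at t)"
proof -
  have "((\<lambda>t. x + t *s v) has_derivative (\<lambda>h. h *s v)) (at t)"
    using has_derivative_add[OF has_derivative_const[of x] bounded_linear_imp_has_derivative[OF bounded_linear_scalar_mult_left[of v]]]
    by simp
  from diff_chain_at[OF this hol_ball_fderiv(1)[OF assms]]
  have "((\<lambda>t. f (x + t *s v)) has_derivative (\<lambda>h. fderiv f (x + t *s v) (h *s v))) (at t)"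
    by (simp add: o_def)
  then show ?thesis
    by (simp add: has_field_derivative_def hol_ball_fderiv(2)[OF assms] mult_commute_abs)
qed

lemma hol_ball_line_hol:
  assumes "f \<in> hol_ball"
  shows "line_hol unit_ball f"
  unfolding line_hol_def
proof (intro conjI allI)
  show "continuous_on unit_ball f"
    using hol_ball_fderiv(1)[OF assms] has_derivative_continuous
    by (metis continuous_at_imp_continuous_on mem_ball_0)
  show "(\<lambda>t. f (x + t *s v)) holomorphic_on {t. x + t *s v \<in> unit_ball}" for x v
    using hol_ball_slice_derivative[OF assms, of x _ v]
    by (auto simp: holomorphic_on_def field_differentiable_def intro: has_field_derivative_at_within)
qed

lemma cpartial_eq_fderiv:
  assumes "f \<in> hol_ball" "norm z < 1"
  shows "cpartial k f z = fderiv f z (axis k 1)"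
proof -
  have "(\<lambda>t. f (z + axis k t)) = (\<lambda>t. f (z + t *s axis k 1))"
    by (intro ext arg_cong[of _ _ f]) (simp add: vec_eq_iff axis_def)
  then show ?thesis
    unfolding cpartial_def
    using hol_ball_slice_derivative[OF assms(1), of z 0 "axis k 1"] assms(2) by (simp add: DERIV_imp_deriv)
qed

lemma fderiv_expand:
  assumes "f \<in> hol_ball" "norm z < 1"
  shows "fderiv f z v = (\<Sum>k\<in>UNIV. v $ k * cpartial k f z)"
proof -
  have "fderiv f z v = fderiv f z (\<Sum>k\<in>UNIV. v $ k *s axis k 1)"
    by (simp only: basis_expansion)
  also have "\<dots> = (\<Sum>k\<in>UNIV. v $ k * cpartial k f z)"
    by (simp add: linear_sum[OF linear_fderiv[OF assms]] hol_ball_fderiv(2)[OF assms] cpartial_eq_fderiv[OF assms])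
  finally show ?thesis .
qed

lemma radial_deriv_eq_fderiv:
  "f \<in> hol_ball \<Longrightarrow> norm z < 1 \<Longrightarrow> radial_deriv f z = fderiv f z z"
  by (simp add: radial_deriv_def fderiv_expand)

text \<open>
  Taylor's formula of order one, with the second derivative bounded by Cauchy's inequality on discs of
  radius \<open>\<epsilon> / 2\<close>.  What matters is that the bound depends only on \<open>M\<close>, \<open>\<epsilon>\<close> and \<open>t\<close>: it makes difference
  quotients of \<open>f\<close> converge uniformly on smaller balls.
\<close>

lemma difference_quotient_error:
  assumes hol: "\<phi> holomorphic_on ball 0 R" and "0 < \<epsilon>" "\<epsilon> < R"
    and M: "\<And>t. t \<in> cball 0 \<epsilon> \<Longrightarrow> cmod (\<phi> t) \<le> M"
    and t: "t \<noteq> 0" "cmod t \<le> \<epsilon> / 2"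
  shows "cmod ((\<phi> t - \<phi> 0) / t - deriv \<phi> 0) \<le> 8 * M / \<epsilon>\<^sup>2 * cmod t"
proof -
  define F where "F i = (deriv ^^ i) \<phi>" for i :: nat
  have F: "(F i has_field_derivative F (Suc i) x) (at x within cball 0 (\<epsilon> / 2))" if "x \<in> cball 0 (\<epsilon> / 2)" for i x
  proof -
    have "F i holomorphic_on ball 0 R"
      unfolding F_def using hol by (intro holomorphic_higher_deriv) auto
    moreover have "x \<in> ball 0 R" using that assms(2,3) by auto
    ultimately show ?thesis
      unfolding F_def funpow.simps(2) o_apply
      by (rule holomorphic_derivI[OF _ open_ball])
  qed
  have B: "cmod (F 2 x) \<le> 8 * M / \<epsilon>\<^sup>2" if x: "x \<in> cball 0 (\<epsilon> / 2)" for x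
  proof -
    have sub: "cball x (\<epsilon> / 2) \<subseteq> cball 0 \<epsilon>"
    proof
      fix y assume "y \<in> cball x (\<epsilon> / 2)"
      then have "cmod (y - x) \<le> \<epsilon> / 2" by (simp add: dist_norm norm_minus_commute)
      then show "y \<in> cball 0 \<epsilon>" using x norm_triangle_sub[of y x] by simp
    qed
    have "cmod ((deriv ^^ 2) \<phi> x) \<le> fact 2 * M / (\<epsilon> / 2) ^ 2"
    proof (rule Cauchy_inequality)
      have "cball x (\<epsilon> / 2) \<subseteq> ball 0 R" using sub assms(3) by auto
      with hol have "\<phi> holomorphic_on cball x (\<epsilon> / 2)" by (rule holomorphic_on_subset)
      then show "\<phi> holomorphic_on ball x (\<epsilon> / 2)" "continuous_on (cball x (\<epsilon> / 2)) \<phi>"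
        by (auto intro: holomorphic_on_subset[OF _ ball_subset_cball] holomorphic_on_imp_continuous_on)
      show "0 < \<epsilon> / 2" using assms by simp
      fix y assume "cmod (x - y) = \<epsilon> / 2"
      then have "y \<in> cball x (\<epsilon> / 2)" by (simp add: dist_norm)
      then show "cmod (\<phi> y) \<le> M" using sub M by blast
    qed
    then show ?thesis by (simp add: F_def power_divide)
  qed
  have "cmod (F 0 t - (\<Sum>i\<le>1. F i 0 * (t - 0) ^ i / fact i)) \<le> 8 * M / \<epsilon>\<^sup>2 * cmod (t - 0) ^ Suc 1 / fact 1"
    by (rule complex_Taylor[of "cball 0 (\<epsilon> / 2)"]) (use F B assms in \<open>auto simp: numeral_2_eq_2\<close>)
  then have *: "cmod (\<phi> t - \<phi> 0 - deriv \<phi> 0 * t) \<le> 8 * M / \<epsilon>\<^sup>2 * (cmod t)\<^sup>2"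
    by (simp add: F_def diff_diff_eq power2_eq_square)
  have "cmod ((\<phi> t - \<phi> 0) / t - deriv \<phi> 0) = cmod (\<phi> t - \<phi> 0 - deriv \<phi> 0 * t) / cmod t"
    using t by (simp add: norm_divide[symmetric] diff_divide_distrib)
  also have "\<dots> \<le> 8 * M / \<epsilon>\<^sup>2 * (cmod t)\<^sup>2 / cmod t"
    using * by (intro divide_right_mono) auto
  also have "\<dots> = 8 * M / \<epsilon>\<^sup>2 * cmod t"
    using t by (simp add: power2_eq_square)
  finally show ?thesis .
qed

text \<open>
  On the smaller ball the partial derivative is the uniform limit of difference quotients, each of
  which is continuous and holomorphic on complex lines.
\<close>

lemma cpartial_line_hol_smaller_ball:
  fixes f :: "complex ^ 'n \<Rightarrow> complex"
  assumes f: "f \<in> hol_ball" and r: "0 < r" "r < 1"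
  shows "line_hol (ball 0 r) (cpartial k f)"
proof -
  define \<epsilon> where "\<epsilon> = (1 - r) / 2"
  have \<epsilon>: "0 < \<epsilon>" "\<epsilon> < 1 - r" "r + \<epsilon> < 1" using r by (simp_all add: \<epsilon>_def field_simps)
  define e :: "complex ^ 'n" where "e = axis k 1"
  have ne: "norm (t *s e) = cmod t" for t by (simp add: norm_vector_scalar_mult e_def)
  have "compact (f ` cball 0 (r + \<epsilon>))"
    using line_holD(1)[OF hol_ball_line_hol[OF f]] \<epsilon>(3)
    by (intro compact_continuous_image) (auto intro: continuous_on_subset)
  then obtain M where M: "\<And>z. z \<in> cball 0 (r + \<epsilon>) \<Longrightarrow> cmod (f z) \<le> M"
    by (meson bounded_iff compact_imp_bounded imageI)
  define \<tau> :: "nat \<Rightarrow> complex" where "\<tau> n = of_real (\<epsilon> / 2 / real (Suc n))" for n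
  have \<tau>: "\<tau> n \<noteq> 0" "cmod (\<tau> n) \<le> \<epsilon> / 2" for n
  proof -
    show "\<tau> n \<noteq> 0" using \<epsilon> unfolding \<tau>_def of_real_eq_0_iff by simp
    have "\<epsilon> / 2 / real (Suc n) \<le> \<epsilon> / 2 / 1" using \<epsilon> by (intro divide_left_mono) auto
    then show "cmod (\<tau> n) \<le> \<epsilon> / 2" using \<epsilon> unfolding \<tau>_def norm_of_real by simp
  qed
  have \<tau>0: "(\<lambda>n. cmod (\<tau> n)) \<longlonglongrightarrow> 0"
  proof -
    have "(\<lambda>n. \<epsilon> / 2 * inverse (real (Suc n))) \<longlonglongrightarrow> \<epsilon> / 2 * 0"
      by (intro tendsto_intros LIMSEQ_inverse_real_of_nat)
    moreover have "cmod (\<tau> n) = \<epsilon> / 2 * inverse (real (Suc n))" for n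
    proof -
      have "0 < \<epsilon> / 2 / real (Suc n)" using \<epsilon>(1) by (intro divide_pos_pos) auto
      then show ?thesis unfolding \<tau>_def norm_of_real by (simp only: abs_of_pos divide_inverse)
    qed
    ultimately show ?thesis by (simp only: mult_zero_right)
  qed
  define g where "g n y = (f (y + \<tau> n *s e) - f y) / \<tau> n" for n y
  have err: "cmod (g n y - cpartial k f y) \<le> 8 * M / \<epsilon>\<^sup>2 * cmod (\<tau> n)" if y: "norm y \<le> r" for n y
  proof -
    have "(\<lambda>t. f (y + t *s e)) holomorphic_on ball 0 (1 - r)"
    proof (rule holomorphic_on_subset[OF line_holD(2)[OF hol_ball_line_hol[OF f]]], safe)
      fix t :: complex assume "t \<in> ball 0 (1 - r)"
      then show "y + t *s e \<in> unit_ball"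
        using norm_triangle_ineq[of y "t *s e"] y by (simp add: ne)
    qed
    then have "cmod ((f (y + \<tau> n *s e) - f (y + 0 *s e)) / \<tau> n - deriv (\<lambda>t. f (y + t *s e)) 0) \<le> 8 * M / \<epsilon>\<^sup>2 * cmod (\<tau> n)"
    proof (rule difference_quotient_error)
      fix t :: complex assume "t \<in> cball 0 \<epsilon>"
      then show "cmod (f (y + t *s e)) \<le> M"
        using norm_triangle_ineq[of y "t *s e"] y by (intro M) (simp add: ne)
    qed (use \<epsilon> \<tau> in auto)
    moreover have "deriv (\<lambda>t. f (y + t *s e)) 0 = cpartial k f y"
      using hol_ball_slice_derivative[OF f, of y 0 e] y r
      by (simp add: cpartial_eq_fderiv[OF f] e_def DERIV_imp_deriv)
    ultimately show ?thesis by (simp add: g_def)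
  qed
  have unif: "uniform_limit (cball 0 r) g (cpartial k f) sequentially"
  proof (rule uniform_limitI)
    fix \<delta> :: real assume "0 < \<delta>"
    have "(\<lambda>n. 8 * M / \<epsilon>\<^sup>2 * cmod (\<tau> n)) \<longlonglongrightarrow> 8 * M / \<epsilon>\<^sup>2 * 0"
      by (intro tendsto_intros \<tau>0)
    then have "\<forall>\<^sub>F n in sequentially. 8 * M / \<epsilon>\<^sup>2 * cmod (\<tau> n) < \<delta>"
      using \<open>0 < \<delta>\<close> by (intro order_tendstoD) auto
    then show "\<forall>\<^sub>F n in sequentially. \<forall>y\<in>cball 0 r. dist (g n y) (cpartial k f y) < \<delta>"
      by eventually_elim (auto simp: dist_norm intro!: le_less_trans[OF err])
  qed
  have gl: "line_hol (cball 0 r) (g n)" for n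
  proof -
    have "line_hol (cball 0 r) (\<lambda>y. f (\<tau> n *s e + y))"
    proof (rule line_hol_affine[OF hol_ball_line_hol[OF f], of "\<lambda>y. y"])
      fix y :: "complex ^ 'n" assume "y \<in> cball 0 r"
      then show "\<tau> n *s e + y \<in> unit_ball"
        using norm_triangle_ineq[of "\<tau> n *s e" y] \<tau>(2)[of n] \<epsilon> by (simp add: ne)
    qed (simp_all add: linear_id[unfolded id_def])
    moreover have "line_hol (cball 0 r) f"
      using r by (intro line_hol_subset[OF hol_ball_line_hol[OF f]]) auto
    ultimately have "line_hol (cball 0 r) (\<lambda>y. inverse (\<tau> n) * (f (\<tau> n *s e + y) - f y))"
      by (intro line_hol_mult line_hol_const line_hol_diff)
    then show ?thesis by (simp add: g_def[abs_def] divide_inverse add.commute mult.commute)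
  qed
  show ?thesis
    unfolding line_hol_def
  proof (intro conjI allI)
    have "continuous_on (cball 0 r) (cpartial k f)"
      by (rule uniform_limit_theorem[OF _ unif]) (use line_holD(1)[OF gl] in \<open>auto intro: always_eventually\<close>)
    then show "continuous_on (ball 0 r) (cpartial k f)"
      by (rule continuous_on_subset) auto
    fix x v :: "complex ^ 'n"
    let ?S = "{t. x + t *s v \<in> ball 0 r}"
    have S: "open ?S" by (rule open_slice) simp
    show "(\<lambda>t. cpartial k f (x + t *s v)) holomorphic_on ?S"
    proof (rule holomorphic_uniform_sequence[OF S])
      show "(\<lambda>t. g n (x + t *s v)) holomorphic_on ?S" for n
        using line_holD(2)[OF gl, of n x v] by (rule holomorphic_on_subset) auto
      fix t assume "t \<in> ?S"
      then obtain d where d: "0 < d" "cball t d \<subseteq> ?S"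
        using S open_contains_cball by blast
      have "uniform_limit (cball t d) (\<lambda>n t. g n (x + t *s v)) (\<lambda>t. cpartial k f (x + t *s v)) sequentially"
        unfolding uniform_limit_iff
      proof (intro allI impI)
        fix \<delta> :: real assume "0 < \<delta>"
        then have "\<forall>\<^sub>F n in sequentially. \<forall>y\<in>cball 0 r. dist (g n y) (cpartial k f y) < \<delta>"
          using unif by (simp add: uniform_limit_iff)
        then show "\<forall>\<^sub>F n in sequentially. \<forall>s\<in>cball t d. dist (g n (x + s *s v)) (cpartial k f (x + s *s v)) < \<delta>"
          by eventually_elim (use d(2) in force)
      qed
      then show "\<exists>d>0. cball t d \<subseteq> ?S \<and>
          uniform_limit (cball t d) (\<lambda>n t. g n (x + t *s v)) (\<lambda>t. cpartial k f (x + t *s v)) sequentially"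
        using d by blast
    qed
  qed
qed

lemma cpartial_line_hol:
  fixes f :: "complex ^ 'n \<Rightarrow> complex"
  assumes "f \<in> hol_ball"
  shows "line_hol unit_ball (cpartial k f)"
proof (rule line_hol_locally)
  fix x :: "complex ^ 'n" assume x: "x \<in> unit_ball"
  then obtain r where "norm x < r" "r < 1" using dense by auto
  then show "\<exists>U. open U \<and> x \<in> U \<and> line_hol U (cpartial k f)"
    using cpartial_line_hol_smaller_ball[OF assms, of r k] norm_ge_zero[of x]
    by (intro exI[of _ "ball 0 r"]) auto
qed

lemma radial_deriv_line_hol:
  assumes "f \<in> hol_ball"
  shows "line_hol unit_ball (radial_deriv f)"
  unfolding radial_deriv_def[abs_def]
  by (intro line_hol_sum line_hol_mult line_hol_component cpartial_line_hol assms)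

section \<open>Sub-mean-value inequalities\<close>

text \<open>
  Cauchy's integral formula at the centre of the unit circle, with absolute values inside the integral.
\<close>

lemma circle_mean_value_le:
  assumes "\<phi> holomorphic_on cball 0 1"
  shows "ennreal (cmod (\<phi> 0)) \<le> (\<integral>\<^sup>+x\<in>{0..1}. ennreal (cmod (\<phi> (exp (2 * of_real pi * \<i> * of_real x)))) \<partial>lborel)"
proof -
  let ?e = "\<lambda>x. exp (2 * of_real pi * \<i> * of_real x)"
  have "((\<lambda>u. \<phi> u / (u - 0)) has_contour_integral (2 * of_real pi * \<i> * \<phi> 0)) (circlepath 0 1)"
    using assms by (intro Cauchy_integral_circlepath_simple) auto
  then have "((\<lambda>x. \<phi> (?e x) * (2 * of_real pi * \<i>)) has_integral (2 * of_real pi * \<i> * \<phi> 0)) {0..1}"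
    unfolding has_contour_integral vector_derivative_circlepath unfolding circlepath
    by (simp add: mult_ac)
  from has_integral_mult_right[OF this, of "1 / (2 * of_real pi * \<i>)"]
  have int: "((\<lambda>x. \<phi> (?e x)) has_integral \<phi> 0) {0..1}"
    by (simp add: field_simps)
  have "continuous_on {0..1} (\<lambda>x. \<phi> (?e x))"
    by (rule continuous_on_compose2[OF holomorphic_on_imp_continuous_on[OF assms]])
       (auto intro!: continuous_intros simp: norm_exp_eq_Re)
  then have si: "set_integrable lborel {0..1} (\<lambda>x. \<phi> (?e x))"
    by (rule borel_integrable_atLeastAtMost')
  have "\<phi> 0 = (LINT x:{0..1}|lborel. \<phi> (?e x))"
    using set_borel_integral_eq_integral(2)[OF si] int by (simp add: integral_unique)
  also have "ennreal (cmod \<dots>) \<le> (\<integral>\<^sup>+x. ennreal (cmod (indicator {0..1} x *\<^sub>R \<phi> (?e x))) \<partial>lborel)"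
    unfolding set_lebesgue_integral_def
    by (rule integral_norm_bound_ennreal) (use si in \<open>simp add: set_integrable_def\<close>)
  also have "\<dots> = (\<integral>\<^sup>+x\<in>{0..1}. ennreal (cmod (\<phi> (?e x))) \<partial>lborel)"
    by (intro nn_integral_cong) (auto simp: indicator_def)
  finally show ?thesis .
qed

lemma measurable_on_open:
  fixes h :: "'a::topological_space \<Rightarrow> 'b::real_normed_vector"
  assumes "open S" "continuous_on S h"
  shows "(\<lambda>v. ennreal (norm (h v)) * indicator S v) \<in> borel_measurable borel"
proof -
  have "(\<lambda>v. indicator S v *\<^sub>R h v) \<in> borel_measurable borel"
    using assms by (intro borel_measurable_continuous_on_indicator) auto
  then have "(\<lambda>v. ennreal (norm (indicator S v *\<^sub>R h v))) \<in> borel_measurable borel"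
    by measurable
  then show ?thesis
    by (rule measurable_cong[THEN iffD1, rotated]) (auto simp: indicator_def)
qed

text \<open>
  The circle inequality holds on each complex line through 0.  Integrated over \<open>v\<close> and with the order
  of integration exchanged, every angle contributes the same amount because multiplication by a
  unimodular scalar is an isometry.
\<close>

lemma line_hol_mean_value_le:
  fixes h :: "complex ^ 'n \<Rightarrow> complex"
  assumes h: "line_hol (ball 0 R) h" and r: "0 < r" "r < R"
  shows "ennreal (cmod (h 0)) * emeasure lborel (ball (0 :: complex ^ 'n) r)
       \<le> (\<integral>\<^sup>+v\<in>ball 0 r. ennreal (cmod (h v)) \<partial>lborel)"
proof -
  let ?e = "\<lambda>x::real. exp (2 * of_real pi * \<i> * of_real x)"
  have ne: "norm (?e x *s v) = norm v" for x and v :: "complex ^ 'n"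
    by (simp add: norm_vector_scalar_mult norm_exp_eq_Re)
  define k where "k v = ennreal (cmod (h v)) * indicator (ball 0 r) v" for v
  have [measurable]: "k \<in> borel_measurable borel"
    unfolding k_def
    by (rule measurable_on_open) (use r in \<open>auto intro!: continuous_on_subset[OF line_holD(1)[OF h]]\<close>)
  have cont: "continuous_on UNIV (\<lambda>z::real \<times> (complex ^ 'n). ?e (fst z) *s snd z)"
    by (intro continuous_intros)
  then have [measurable]: "(\<lambda>z::real \<times> (complex ^ 'n). ?e (fst z) *s snd z) \<in> borel_measurable (borel \<Otimes>\<^sub>M borel)"
    unfolding borel_prod by (rule borel_measurable_continuous_onI)
  have m2 [measurable]: "(\<lambda>z. k (?e (fst z) *s snd z) * indicator {0..1} (fst z)) \<in> borel_measurable (lborel \<Otimes>\<^sub>M lborel)"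
    by measurable
  have slice: "ennreal (cmod (h 0)) * indicator (ball 0 r) v \<le> (\<integral>\<^sup>+x. k (?e x *s v) * indicator {0..1} x \<partial>lborel)" for v
  proof (cases "v \<in> ball 0 r")
    case True
    have "(\<lambda>t. h (0 + t *s v)) holomorphic_on cball 0 1"
    proof (rule holomorphic_on_subset[OF line_holD(2)[OF h]], safe)
      fix t :: complex assume "t \<in> cball 0 1"
      then have "norm (t *s v) \<le> norm v"
        by (simp add: norm_vector_scalar_mult mult_left_le_one_le)
      then show "0 + t *s v \<in> ball 0 R" using True r by simp
    qed
    from circle_mean_value_le[OF this] True ne[of _ v] show ?thesis
      by (simp add: k_def)
  qed simp
  have "ennreal (cmod (h 0)) * emeasure lborel (ball (0 :: complex ^ 'n) r)
      = (\<integral>\<^sup>+v\<in>ball (0 :: complex ^ 'n) r. ennreal (cmod (h 0)) \<partial>lborel)"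
    by (subst nn_integral_cmult_indicator) auto
  also have "\<dots> \<le> (\<integral>\<^sup>+v. \<integral>\<^sup>+x. k (?e x *s v) * indicator {0..1} x \<partial>lborel \<partial>lborel)"
    by (intro nn_integral_mono slice)
  also have "\<dots> = (\<integral>\<^sup>+x. \<integral>\<^sup>+v. k (?e x *s v) * indicator {0..1} x \<partial>lborel \<partial>lborel)"
    by (rule lborel_pair.Fubini'[of "\<lambda>x v. k (?e x *s v) * indicator {0..1} x"]) (use m2 in \<open>simp add: split_beta\<close>)
  also have "\<dots> = (\<integral>\<^sup>+x. (\<integral>\<^sup>+v. k v \<partial>lborel) * indicator {0..1::real} x \<partial>lborel)"
  proof (rule nn_integral_cong)
    fix x :: real
    have lin: "linear (\<lambda>v::complex ^ 'n. ?e x *s v)"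
      using bounded_linear_scalar_mult_right by (rule bounded_linear.linear)
    have [measurable]: "(\<lambda>v::complex ^ 'n. k (?e x *s v)) \<in> borel_measurable borel"
      using measurable_compose[OF borel_measurable_continuous_onI[of "\<lambda>v::complex ^ 'n. ?e x *s v"], of k]
      by (simp add: linear_continuous_on bounded_linear_scalar_mult_right)
    have "(\<integral>\<^sup>+v. k (?e x *s v) \<partial>lborel) = (\<integral>\<^sup>+v. k v \<partial>lborel)"
      by (rule nn_integral_linear_isometry[OF lin ne]) measurable
    then show "(\<integral>\<^sup>+v. k (?e x *s v) * indicator {0..1} x \<partial>lborel) = (\<integral>\<^sup>+v. k v \<partial>lborel) * indicator {0..1} x"
      by (simp add: nn_integral_multc)
  qed
  also have "\<dots> = (\<integral>\<^sup>+v. k v \<partial>lborel)"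
    by (subst nn_integral_cmult_indicator) simp_all
  finally show ?thesis by (simp add: k_def)
qed

lemma line_hol_mean_value_le_at:
  fixes h :: "complex ^ 'n \<Rightarrow> complex"
  assumes h: "line_hol (ball 0 R) h" and r: "0 < r" "norm x + r < R"
  shows "ennreal (cmod (h x)) * emeasure lborel (ball (0 :: complex ^ 'n) r)
       \<le> (\<integral>\<^sup>+y\<in>ball x r. ennreal (cmod (h y)) \<partial>lborel)"
proof -
  have l: "line_hol (ball 0 (R - norm x)) (\<lambda>v. h (x + v))"
  proof (rule line_hol_affine[OF h, of "\<lambda>v. v"])
    fix v :: "complex ^ 'n" assume "v \<in> ball 0 (R - norm x)"
    then show "x + v \<in> ball 0 R" using norm_triangle_ineq[of x v] by simp
  qed (simp_all add: linear_id[unfolded id_def])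
  have "continuous_on (ball x r) h"
  proof (rule continuous_on_subset[OF line_holD(1)[OF h]], rule)
    fix y assume "y \<in> ball x r"
    then show "y \<in> ball 0 R" using norm_triangle_sub[of y x] r by (simp add: dist_norm norm_minus_commute)
  qed
  then have m: "(\<lambda>y. ennreal (cmod (h y)) * indicator (ball x r) y) \<in> borel_measurable borel"
    by (intro measurable_on_open) auto
  have "ennreal (cmod (h (x + 0))) * emeasure lborel (ball (0 :: complex ^ 'n) r)
      \<le> (\<integral>\<^sup>+v\<in>ball 0 r. ennreal (cmod (h (x + v))) \<partial>lborel)"
    using line_hol_mean_value_le[OF l r(1)] r(2) by simp
  also have "\<dots> = (\<integral>\<^sup>+v. ennreal (cmod (h (x + v))) * indicator (ball x r) (x + v) \<partial>lborel)"
    by (intro nn_integral_cong) (simp add: indicator_def dist_norm)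
  also have "\<dots> = (\<integral>\<^sup>+y\<in>ball x r. ennreal (cmod (h y)) \<partial>lborel)"
    by (rule nn_integral_lborel_shift[OF m])
  finally show ?thesis by simp
qed

text \<open>
  An argument of Hardy and Littlewood.  Maximise \<open>u x = (1 - |x|)^(N/p) |h x|\<close>, with \<open>N\<close> the real
  dimension, at \<open>x0\<close>.  On the ball around \<open>x0\<close> of half the distance to the sphere, maximality bounds
  \<open>|h|^(1-p)\<close> by a power of \<open>u x0\<close>, so the mean-value inequality for \<open>|h|\<close> there turns into one for
  \<open>|h|^p\<close>; the exponent \<open>N/p\<close> makes the powers of the radius cancel.
\<close>

lemma sub_mean_value_small_exponent:
  fixes h :: "complex ^ 'n \<Rightarrow> complex"
  assumes h: "line_hol (ball 0 R) h" and R: "1 < R" and p: "0 < p" "p \<le> 1"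
  shows "ennreal (cmod (h 0) powr p) * emeasure lborel (ball (0 :: complex ^ 'n) 1)
       \<le> ennreal (2 powr (2 * real CARD('n) / p)) * (\<integral>\<^sup>+y\<in>ball 0 1. ennreal (cmod (h y) powr p) \<partial>lborel)"
proof -
  define N where "N = 2 * real CARD('n)"
  have N: "0 < N" by (simp add: N_def)
  define V where "V = unit_ball_vol (real DIM(complex ^ 'n))"
  have V: "0 < V" by (simp add: V_def)
  have Vb: "emeasure lborel (ball (x :: complex ^ 'n) r) = ennreal (V * r powr N)" if "0 < r" for x r
    using that by (simp add: emeasure_ball V_def N_def powr_realpow[symmetric] mult.commute)
  define J where "J = (\<integral>\<^sup>+y\<in>ball 0 1. ennreal (cmod (h y) powr p) \<partial>lborel)"
  define u where "u x = (1 - norm x) powr (N / p) * cmod (h x)" for x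
  have cont: "continuous_on (cball 0 1) h"
    using R by (intro continuous_on_subset[OF line_holD(1)[OF h]]) auto
  have "continuous_on (cball 0 1) u"
    unfolding u_def using N p by (intro continuous_intros continuous_on_powr' cont) auto
  then obtain x0 where x0: "x0 \<in> cball 0 1" "\<And>x. x \<in> cball 0 1 \<Longrightarrow> u x \<le> u x0"
    using continuous_attains_sup[of "cball 0 1" u] by fastforce
  have h0: "cmod (h 0) \<le> u x0"
    using x0(2)[of 0] by (simp add: u_def)
  have "ennreal (u x0 powr p * V) \<le> ennreal (2 powr (N / p)) * J"
  proof (cases "u x0 = 0 \<or> J = top")
    case True
    then show ?thesis
    proof
      assume "J = top" then show ?thesis by (simp add: ennreal_mult_top)
    qed (use p in simp)
  next
    case False
    then obtain I where I: "J = ennreal I" "0 \<le> I" by (cases J) auto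
    have u0: "0 < u x0" using False by (simp add: u_def less_le)
    have n0: "norm x0 < 1"
    proof (rule ccontr)
      assume "\<not> norm x0 < 1"
      then have "u x0 = 0" using x0(1) N p by (simp add: u_def)
      then show False using u0 by simp
    qed
    define \<rho> where "\<rho> = (1 - norm x0) / 2"
    have \<rho>: "0 < \<rho>" "1 - norm x0 = 2 * \<rho>" using n0 by (simp_all add: \<rho>_def)
    define s where "s = \<rho> powr (N / p)"
    have s: "0 < s" using \<rho> by (simp add: s_def)
    have sp: "s powr p = \<rho> powr N" using p by (simp add: s_def powr_powr)
    have ux0: "u x0 = 2 powr (N / p) * s * cmod (h x0)"
      using \<rho> by (simp add: u_def s_def powr_mult)
    have bound: "cmod (h y) \<le> cmod (h y) powr p * (u x0 / s) powr (1 - p)" if y: "y \<in> ball x0 \<rho>" for y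
    proof -
      have ny: "norm y \<le> norm x0 + \<rho>"
        using y norm_triangle_sub[of y x0] by (simp add: dist_norm norm_minus_commute)
      then have "\<rho> \<le> 1 - norm y" using \<rho> by linarith
      then have "s \<le> (1 - norm y) powr (N / p)"
        unfolding s_def using \<rho> N p by (intro powr_mono2) auto
      then have "s * cmod (h y) \<le> u y" unfolding u_def by (intro mult_right_mono) auto
      also have "\<dots> \<le> u x0" using ny \<rho> by (intro x0) simp
      finally have "cmod (h y) \<le> u x0 / s" using s by (simp add: field_simps)
      then have "cmod (h y) powr (1 - p) \<le> (u x0 / s) powr (1 - p)"
        using p by (intro powr_mono2) auto
      then have "cmod (h y) powr p * cmod (h y) powr (1 - p) \<le> cmod (h y) powr p * (u x0 / s) powr (1 - p)"
        by (intro mult_left_mono) auto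
      then show ?thesis by (cases "h y = 0") (simp_all add: powr_add[symmetric])
    qed
    have "ennreal (cmod (h x0) * (V * \<rho> powr N)) = ennreal (cmod (h x0)) * emeasure lborel (ball (0 :: complex ^ 'n) \<rho>)"
      using V \<rho> by (simp add: Vb ennreal_mult)
    also have "\<dots> \<le> (\<integral>\<^sup>+y\<in>ball x0 \<rho>. ennreal (cmod (h y)) \<partial>lborel)"
      using \<rho> R by (intro line_hol_mean_value_le_at[OF h]) auto
    also have "\<dots> \<le> (\<integral>\<^sup>+y. ennreal ((u x0 / s) powr (1 - p)) * (ennreal (cmod (h y) powr p) * indicator (ball 0 1) y) \<partial>lborel)"
    proof (rule nn_integral_mono)
      fix y
      show "ennreal (cmod (h y)) * indicator (ball x0 \<rho>) y
         \<le> ennreal ((u x0 / s) powr (1 - p)) * (ennreal (cmod (h y) powr p) * indicator (ball 0 1) y)"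
      proof (cases "y \<in> ball x0 \<rho>")
        case True
        then have "norm y < 1"
          using norm_triangle_sub[of y x0] \<rho> by (simp add: dist_norm norm_minus_commute)
        then show ?thesis using bound[OF True] True
          by (simp add: ennreal_mult[symmetric] mult.commute ennreal_leI)
      qed simp
    qed
    also have "\<dots> = ennreal ((u x0 / s) powr (1 - p)) * J"
    proof -
      have "(\<lambda>y. indicator (ball 0 1) y *\<^sub>R h y) \<in> borel_measurable borel"
        by (intro borel_measurable_continuous_on_indicator continuous_on_subset[OF cont]) auto
      then have "(\<lambda>y. ennreal (cmod (indicator (ball 0 1) y *\<^sub>R h y) powr p)) \<in> borel_measurable borel"
        by measurable
      then have "(\<lambda>y. ennreal (cmod (h y) powr p) * indicator (ball 0 1) y) \<in> borel_measurable borel"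
        by (rule measurable_cong[THEN iffD1, rotated]) (auto simp: indicator_def)
      then show ?thesis unfolding J_def by (subst nn_integral_cmult) auto
    qed
    also have "\<dots> = ennreal ((u x0 / s) powr (1 - p) * I)"
      using I by (simp add: ennreal_mult)
    finally have "cmod (h x0) * (V * \<rho> powr N) \<le> (u x0 / s) powr (1 - p) * I"
      using I by (simp add: ennreal_le_iff)
    also have "(u x0 / s) powr (1 - p) = (u x0 / s) / (u x0 powr p / \<rho> powr N)"
      using u0 s by (simp add: powr_diff powr_divide sp)
    finally have "cmod (h x0) * (V * \<rho> powr N) \<le> (u x0 / s) / (u x0 powr p / \<rho> powr N) * I" .
    then have "(cmod (h x0) * V) * \<rho> powr N \<le> ((u x0 / s) / (u x0 powr p) * I) * \<rho> powr N"
      by (simp add: mult_ac)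
    then have "cmod (h x0) * V \<le> (u x0 / s) / (u x0 powr p) * I"
      using \<rho> by (simp only: mult_le_cancel_right) auto
    moreover have "u x0 / s = 2 powr (N / p) * cmod (h x0)" using s by (simp add: ux0)
    moreover obtain w where "w = u x0 powr p" "0 < w" using u0 by simp
    ultimately have "cmod (h x0) * (u x0 powr p * V) \<le> cmod (h x0) * (2 powr (N / p) * I)"
      by (simp add: field_simps)
    moreover have "0 < cmod (h x0)"
      using u0 unfolding ux0 by (metis mult_zero_right norm_zero zero_less_norm_iff less_irrefl)
    ultimately have "u x0 powr p * V \<le> 2 powr (N / p) * I" by simp
    then show ?thesis using I by (simp add: ennreal_mult[symmetric] ennreal_leI)
  qed
  moreover have "ennreal (cmod (h 0) powr p * V) \<le> ennreal (u x0 powr p * V)"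
    using h0 V p by (intro ennreal_leI mult_right_mono powr_mono2) auto
  ultimately have "ennreal (cmod (h 0) powr p * V) \<le> ennreal (2 powr (N / p)) * J"
    by order
  moreover have "ennreal (cmod (h 0) powr p * V) = ennreal (cmod (h 0) powr p) * emeasure lborel (ball (0 :: complex ^ 'n) 1)"
    using V by (simp add: Vb ennreal_mult)
  ultimately show ?thesis by (simp add: J_def N_def)
qed

text \<open>
  For large \<open>p\<close> apply the case of small exponents to \<open>h^m\<close> with exponent \<open>p/m \<le> 1\<close>.
\<close>

lemma sub_mean_value:
  fixes p :: real
  assumes "0 < p"
  obtains C where "0 < C"
    "\<And>(h :: complex ^ 'n \<Rightarrow> complex) R. line_hol (ball 0 R) h \<Longrightarrow> 1 < R \<Longrightarrow>
       ennreal (cmod (h 0) powr p) \<le> ennreal C * (\<integral>\<^sup>+y\<in>ball 0 1. ennreal (cmod (h y) powr p) \<partial>lborel)"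
proof -
  obtain m :: nat where m: "p \<le> real m" using real_arch_simple by blast
  with assms have m0: "0 < m" by (cases m) auto
  define p' where "p' = p / real m"
  have p': "0 < p'" "p' \<le> 1" using assms m m0 by (simp_all add: p'_def)
  define V where "V = unit_ball_vol (real DIM(complex ^ 'n))"
  have V: "0 < V" by (simp add: V_def)
  define K where "K = 2 powr (2 * real CARD('n) / p')"
  show thesis
  proof (rule that[of "K / V"])
    show "0 < K / V" using V by (simp add: K_def)
    fix h :: "complex ^ 'n \<Rightarrow> complex" and R :: real
    assume h: "line_hol (ball 0 R) h" "1 < R"
    have pw: "cmod (h y ^ m) powr p' = cmod (h y) powr p" for y
    proof (cases "h y = 0")
      case False
      then show ?thesis using m0
        by (simp add: norm_power powr_realpow[symmetric] powr_powr p'_def)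
    qed (use m0 in simp)
    let ?J = "\<integral>\<^sup>+y\<in>ball 0 1. ennreal (cmod (h y) powr p) \<partial>lborel"
    have "ennreal (cmod (h 0) powr p) * ennreal V \<le> ennreal K * ?J"
      using sub_mean_value_small_exponent[OF line_hol_power[OF h(1), of m] h(2) p']
      by (simp add: pw K_def emeasure_ball V_def)
    then have "ennreal (1 / V) * (ennreal (cmod (h 0) powr p) * ennreal V) \<le> ennreal (1 / V) * (ennreal K * ?J)"
      by (intro mult_left_mono) auto
    moreover have "ennreal (1 / V) * (ennreal (cmod (h 0) powr p) * ennreal V) = ennreal (cmod (h 0) powr p)"
      using V by (simp add: ennreal_mult[symmetric])
    moreover have "ennreal (1 / V) * (ennreal K * ?J) = ennreal (K / V) * ?J"
      using V by (simp add: mult.assoc[symmetric] ennreal_mult[symmetric] K_def)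
    ultimately show "ennreal (cmod (h 0) powr p) \<le> ennreal (K / V) * ?J" by simp
  qed
qed

section \<open>Powers of extended nonnegative reals\<close>

lemma epowr_ennreal: "0 \<le> x \<Longrightarrow> epowr (ennreal x) r = ennreal (x powr r)"
  by (simp add: epowr_def)

lemma epowr_top [simp]: "epowr top r = top"
  by (simp add: epowr_def)

lemma epowr_eq_top_iff [simp]: "epowr x r = top \<longleftrightarrow> x = top"
  by (simp add: epowr_def)

lemma epowr_mono: "0 \<le> r \<Longrightarrow> x \<le> y \<Longrightarrow> epowr x r \<le> epowr y r"
  by (cases x; cases y) (auto simp: epowr_ennreal powr_mono2 ennreal_leI top_unique)

lemma epowr_cmult:
  assumes "0 < c"
  shows "epowr (ennreal c * x) r = ennreal (c powr r) * epowr x r"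
proof (cases x)
  case (real x')
  then show ?thesis using assms
    by (simp add: epowr_ennreal ennreal_mult[symmetric] powr_mult)
next
  case top
  then show ?thesis using assms by (simp add: ennreal_mult_top)
qed

lemma measurable_epowr [measurable (raw)]:
  assumes [measurable]: "f \<in> borel_measurable M"
  shows "(\<lambda>x. epowr (f x) r) \<in> borel_measurable M"
  unfolding epowr_def by measurable

section \<open>The weighted measures in terms of Lebesgue measure\<close>

abbreviation inv_weight :: "complex ^ 'n \<Rightarrow> ennreal" where
  "inv_weight z \<equiv> ennreal (1 / defect z ^ (CARD('n) + 1))"

abbreviation ball_borel :: "(complex ^ 'n) measure" where
  "ball_borel \<equiv> restrict_space borel unit_ball"

lemma ball_borel_iff:
  fixes F :: "complex ^ 'n \<Rightarrow> ennreal"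
  shows "F \<in> borel_measurable ball_borel \<longleftrightarrow> (\<lambda>z. F z * indicator unit_ball z) \<in> borel_measurable borel"
  by (rule borel_measurable_restrict_space_iff_ennreal) simp

lemma measurable_on_subset_of_ball:
  fixes F :: "complex ^ 'n \<Rightarrow> ennreal"
  assumes F: "F \<in> borel_measurable ball_borel" and D: "D \<in> sets borel" "D \<subseteq> unit_ball"
  shows "(\<lambda>z. F z * indicator D z) \<in> borel_measurable borel"
proof -
  have "(\<lambda>z. (F z * indicator unit_ball z) * indicator D z) \<in> borel_measurable borel"
    using F[unfolded ball_borel_iff] D(1) by measurable
  then show ?thesis
    by (rule measurable_cong[THEN iffD1, rotated]) (use D(2) in \<open>auto simp: indicator_def\<close>)
qed

lemma sets_vol: "sets (vol :: (complex ^ 'n) measure) = sets ball_borel"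
  by (simp add: vol_def sets_restrict_space)

lemma measurable_vol_w: "borel_measurable (vol_w \<alpha> :: (complex ^ 'n) measure) = borel_measurable ball_borel"
  by (rule measurable_cong_sets) (simp_all add: vol_w_def sets_vol)

lemma measurable_defect [measurable]: "defect \<in> borel_measurable borel"
  unfolding defect_def[abs_def] by measurable

lemma measurable_defect_ball [measurable]: "defect \<in> borel_measurable ball_borel"
  using measurable_defect by (rule measurable_restrict_space1)

abbreviation ball_volume :: "('n::finite) itself \<Rightarrow> real" where
  "ball_volume _ \<equiv> unit_ball_vol (real DIM(complex ^ 'n))"

lemma nn_integral_vol:
  fixes F :: "complex ^ 'n \<Rightarrow> ennreal"
  assumes F: "F \<in> borel_measurable ball_borel"
  shows "(\<integral>\<^sup>+z. F z \<partial>vol) = ennreal (1 / ball_volume TYPE('n)) * (\<integral>\<^sup>+z\<in>unit_ball. F z \<partial>lborel)"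
proof -
  let ?R = "restrict_space lborel (unit_ball :: (complex ^ 'n) set)"
  have V: "0 < ball_volume TYPE('n)" by simp
  have e: "emeasure ?R unit_ball = ennreal (ball_volume TYPE('n))"
    by (subst emeasure_restrict_space) (simp_all add: emeasure_ball)
  have sR: "sets ?R = sets ball_borel" by (simp add: sets_restrict_space)
  have mF: "F \<in> borel_measurable ?R"
    using F measurable_cong_sets[OF sR refl, of borel] by simp
  have "(\<integral>\<^sup>+z. F z \<partial>vol) = (\<integral>\<^sup>+z. indicator unit_ball z / ennreal (ball_volume TYPE('n)) * F z \<partial>?R)"
    unfolding vol_def uniform_measure_def e
    using borel_open[OF open_ball, of "0 :: complex ^ 'n" 1]
    by (intro nn_integral_density mF measurable_restrict_space1 borel_measurable_divide_ennreal
        borel_measurable_indicator borel_measurable_const) simp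
  also have "\<dots> = (\<integral>\<^sup>+z. ennreal (1 / ball_volume TYPE('n)) * F z \<partial>?R)"
    using V by (intro nn_integral_cong)
      (simp add: space_restrict_space divide_ennreal[symmetric] del: unit_ball_vol_pos)
  also have "\<dots> = ennreal (1 / ball_volume TYPE('n)) * (\<integral>\<^sup>+z. F z \<partial>?R)"
    by (rule nn_integral_cmult[OF mF])
  also have "(\<integral>\<^sup>+z. F z \<partial>?R) = (\<integral>\<^sup>+z\<in>unit_ball. F z \<partial>lborel)"
    by (rule nn_integral_restrict_space) simp
  finally show ?thesis .
qed

lemma nn_integral_vol_w:
  fixes F :: "complex ^ 'n \<Rightarrow> ennreal"
  assumes [measurable]: "F \<in> borel_measurable ball_borel"
  shows "(\<integral>\<^sup>+z. F z \<partial>vol_w \<alpha>) = ennreal (1 / ball_volume TYPE('n))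
     * (\<integral>\<^sup>+z\<in>unit_ball. ennreal (c_const TYPE('n) \<alpha> * defect z powr \<alpha>) * F z \<partial>lborel)"
proof -
  have "(\<integral>\<^sup>+z. F z \<partial>vol_w \<alpha>) = (\<integral>\<^sup>+z. ennreal (c_const TYPE('n) \<alpha> * defect z powr \<alpha>) * F z \<partial>vol)"
    unfolding vol_w_def defect_def[symmetric]
    by (rule nn_integral_density) (simp_all add: measurable_cong_sets[OF sets_vol refl])
  also have "\<dots> = ennreal (1 / ball_volume TYPE('n))
     * (\<integral>\<^sup>+z\<in>unit_ball. ennreal (c_const TYPE('n) \<alpha> * defect z powr \<alpha>) * F z \<partial>lborel)"
    by (rule nn_integral_vol) measurable
  finally show ?thesis .
qed

lemma c_const_pos: "-1 < \<alpha> \<Longrightarrow> 0 < c_const TYPE('n::finite) \<alpha>"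
  by (simp add: c_const_def Gamma_real_pos)

lemma nn_integral_vol_w_constant:
  assumes "-1 < \<alpha>"
  obtains c where "0 < c" "\<And>F :: complex ^ 'n \<Rightarrow> ennreal. F \<in> borel_measurable ball_borel \<Longrightarrow>
     (\<integral>\<^sup>+z. F z \<partial>vol_w \<alpha>) = ennreal c * (\<integral>\<^sup>+z\<in>unit_ball. F z * ennreal (defect z powr \<alpha>) \<partial>lborel)"
proof (rule that[of "c_const TYPE('n) \<alpha> / ball_volume TYPE('n)"])
  have V: "0 < ball_volume TYPE('n)" by simp
  have c: "0 < c_const TYPE('n) \<alpha>" using assms by (rule c_const_pos)
  show "0 < c_const TYPE('n) \<alpha> / ball_volume TYPE('n)" using V c by (rule divide_pos_pos[rotated])
  fix F :: "complex ^ 'n \<Rightarrow> ennreal" assume F [measurable]: "F \<in> borel_measurable ball_borel"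
  have m: "(\<lambda>z. (F z * ennreal (defect z powr \<alpha>)) * indicator unit_ball z) \<in> borel_measurable borel"
    unfolding ball_borel_iff[symmetric] by measurable
  have "(\<integral>\<^sup>+z\<in>unit_ball. ennreal (c_const TYPE('n) \<alpha> * defect z powr \<alpha>) * F z \<partial>lborel)
      = (\<integral>\<^sup>+z. ennreal (c_const TYPE('n) \<alpha>) * ((F z * ennreal (defect z powr \<alpha>)) * indicator unit_ball z) \<partial>lborel)"
    using c by (intro nn_integral_cong) (simp add: ennreal_mult mult_ac)
  also have "\<dots> = ennreal (c_const TYPE('n) \<alpha>) * (\<integral>\<^sup>+z\<in>unit_ball. F z * ennreal (defect z powr \<alpha>) \<partial>lborel)"
    using m by (subst nn_integral_cmult) auto
  finally show "(\<integral>\<^sup>+z. F z \<partial>vol_w \<alpha>) = ennreal (c_const TYPE('n) \<alpha> / ball_volume TYPE('n))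
      * (\<integral>\<^sup>+z\<in>unit_ball. F z * ennreal (defect z powr \<alpha>) \<partial>lborel)"
    unfolding nn_integral_vol_w[OF F] using V c
    by (simp add: mult.assoc[symmetric] ennreal_mult[symmetric] del: unit_ball_vol_pos)
qed

lemma nn_integral_inv_meas:
  fixes F :: "complex ^ 'n \<Rightarrow> ennreal"
  assumes F [measurable]: "F \<in> borel_measurable ball_borel" and D: "D \<in> sets borel" "D \<subseteq> unit_ball"
  shows "(\<integral>\<^sup>+w\<in>D. F w \<partial>inv_meas) = ennreal (1 / ball_volume TYPE('n)) * (\<integral>\<^sup>+w\<in>D. F w * inv_weight w \<partial>lborel)"
proof -
  have [measurable]: "indicator D \<in> borel_measurable (ball_borel :: (complex ^ 'n) measure)"
    using D(1) by (intro measurable_restrict_space1 borel_measurable_indicator) simp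
  have "(\<integral>\<^sup>+w\<in>D. F w \<partial>inv_meas) = (\<integral>\<^sup>+w. inv_weight w * (F w * indicator D w) \<partial>vol)"
    unfolding inv_meas_def defect_def[symmetric]
    by (rule nn_integral_density) (simp_all add: measurable_cong_sets[OF sets_vol refl])
  also have "\<dots> = ennreal (1 / ball_volume TYPE('n)) * (\<integral>\<^sup>+w\<in>unit_ball. inv_weight w * (F w * indicator D w) \<partial>lborel)"
    by (rule nn_integral_vol) measurable
  also have "(\<integral>\<^sup>+w\<in>unit_ball. inv_weight w * (F w * indicator D w) \<partial>lborel) = (\<integral>\<^sup>+w\<in>D. F w * inv_weight w \<partial>lborel)"
    using D(2) by (intro nn_integral_cong) (auto simp: indicator_def mult_ac)
  finally show ?thesis .
qed

section \<open>Averages over Bergman balls\<close>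

abbreviation weighted_integral :: "real \<Rightarrow> (complex ^ 'n \<Rightarrow> ennreal) \<Rightarrow> ennreal" where
  "weighted_integral \<alpha> F \<equiv> (\<integral>\<^sup>+z\<in>unit_ball. F z * ennreal (defect z powr \<alpha>) \<partial>lborel)"

abbreviation inv_integral :: "(complex ^ 'n) set \<Rightarrow> (complex ^ 'n \<Rightarrow> ennreal) \<Rightarrow> ennreal" where
  "inv_integral D F \<equiv> (\<integral>\<^sup>+w\<in>D. F w * inv_weight w \<partial>lborel)"

lemma open_berg_pairs:
  assumes "0 < \<gamma>"
  shows "open {(z :: complex ^ 'n, w). norm z < 1 \<and> w \<in> berg_ball z \<gamma>}"
proof -
  have "{(z :: complex ^ 'n, w). norm z < 1 \<and> w \<in> berg_ball z \<gamma>}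
      = {x. norm (fst x) < 1} \<inter> {x. norm (snd x) < 1}
        \<inter> {x. (cmod (1 - herm (snd x) (fst x)))\<^sup>2 < (cosh \<gamma>)\<^sup>2 * (defect (fst x) * defect (snd x))}"
    using mem_berg_ball_iff[OF assms] berg_ball_subset_unit_ball by fastforce
  also have "open \<dots>"
    unfolding herm_def defect_def
    by (intro open_Int open_Collect_less continuous_intros)
  finally show ?thesis .
qed

lemma measurable_berg_pairs:
  assumes "0 < \<gamma>"
  shows "{(z :: complex ^ 'n, w). norm z < 1 \<and> w \<in> berg_ball z \<gamma>} \<in> sets (borel \<Otimes>\<^sub>M borel)"
  using open_berg_pairs[OF assms] unfolding borel_prod by (rule borel_open)

lemma open_berg_ball:
  assumes "0 < \<gamma>" "norm z < 1"
  shows "open (berg_ball z \<gamma>)"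
proof -
  have "berg_ball z \<gamma> = (\<lambda>w. (z, w)) -` {(z, w). norm z < 1 \<and> w \<in> berg_ball z \<gamma>}"
    using assms(2) by auto
  also have "open \<dots>"
    by (intro open_vimage open_berg_pairs assms continuous_intros)
  finally show ?thesis .
qed

lemma sets_berg_ball:
  assumes "0 < \<gamma>" "norm z < 1"
  shows "berg_ball z \<gamma> \<in> sets borel"
  using open_berg_ball[OF assms] by (rule borel_open)

lemma powr_ratio_le:
  fixes x y M :: real
  assumes "0 < x" "0 < y" "1 \<le> M" "x \<le> M * y" "y \<le> M * x"
  shows "x powr \<beta> \<le> M powr \<bar>\<beta>\<bar> * y powr \<beta>"
proof (cases "0 \<le> \<beta>")
  case True
  then have "x powr \<beta> \<le> (M * y) powr \<beta>" using assms by (intro powr_mono2) auto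
  then show ?thesis using True assms by (simp add: powr_mult)
next
  case False
  then have "y powr - \<beta> \<le> (M * x) powr - \<beta>" using assms by (intro powr_mono2) auto
  then have "y powr - \<beta> \<le> M powr - \<beta> * x powr - \<beta>" using assms by (simp add: powr_mult)
  then have "y powr - \<beta> * (x powr \<beta> * y powr \<beta>) \<le> M powr - \<beta> * x powr - \<beta> * (x powr \<beta> * y powr \<beta>)"
    by (intro mult_right_mono) auto
  then show ?thesis using False assms by (simp add: powr_minus field_simps)
qed

lemma defect_powr_on_berg_ball:
  assumes "norm a < 1" "w \<in> berg_ball a \<gamma>"
  shows "defect w powr \<beta> \<le> (4 * (cosh \<gamma>)\<^sup>2) powr \<bar>\<beta>\<bar> * defect a powr \<beta>"
proof (rule powr_ratio_le)
  have "norm w < 1" using assms by (simp add: berg_ball_def)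
  then show "0 < defect w" "0 < defect a" using assms by (simp_all add: defect_pos)
  have "1 \<le> (cosh \<gamma>)\<^sup>2" by (simp add: cosh_real_ge_1 one_le_power)
  then show "1 \<le> 4 * (cosh \<gamma>)\<^sup>2" by linarith
qed (use assms in \<open>auto intro: defect_le_on_berg_ball defect_ge_on_berg_ball\<close>)

text \<open>
  Apply the Euclidean inequality in the coordinate \<open>v\<close>.  The determinant of the dilation is the density
  of the invariant measure at \<open>a\<close>, and this is comparable to the density at every point of the Bergman
  ball.
\<close>

lemma sub_mean_value_berg_ball:
  fixes p \<gamma> :: real
  assumes p: "0 < p" and \<gamma>: "0 < \<gamma>"
  obtains C where "0 < C"
    "\<And>(h :: complex ^ 'n \<Rightarrow> complex) a. line_hol unit_ball h \<Longrightarrow> norm a < 1 \<Longrightarrow>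
       ennreal (cmod (h a) powr p)
       \<le> ennreal C * inv_integral (berg_ball a \<gamma>) (\<lambda>w. ennreal (cmod (h w) powr p))"
proof -
  obtain C0 where C0: "0 < C0"
    "\<And>(h :: complex ^ 'n \<Rightarrow> complex) R. line_hol (ball 0 R) h \<Longrightarrow> 1 < R \<Longrightarrow>
       ennreal (cmod (h 0) powr p) \<le> ennreal C0 * (\<integral>\<^sup>+y\<in>ball 0 1. ennreal (cmod (h y) powr p) \<partial>lborel)"
    using sub_mean_value[where 'n = 'n, OF p] by blast
  define r where "r = tanh \<gamma> / (1 + tanh \<gamma>)"
  have r: "0 < r" using \<gamma> by (simp add: r_def add_pos_pos)
  \<comment> \<open>half the inscribed radius, so that the rescaled function lives on a ball of radius 2\<close>
  define c where "c = r / 2"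
  have c: "0 < c" using r by (simp add: c_def)
  define M where "M = (4 * (cosh \<gamma>)\<^sup>2) ^ (CARD('n) + 1)"
  have M: "0 < M" by (simp add: M_def)
  define N where "N = c ^ (2 * CARD('n))"
  have N: "0 < N" using c by (simp add: N_def)
  show thesis
  proof (rule that[of "C0 * M / N"])
    show "0 < C0 * M / N" using C0 M N by simp
    fix h :: "complex ^ 'n \<Rightarrow> complex" and a :: "complex ^ 'n"
    assume h: "line_hol unit_ball h" and a: "norm a < 1"
    define d where "d = defect a ^ (CARD('n) + 1)"
    have d: "0 < d" using defect_pos[OF a] by (simp add: d_def)
    define H where "H u = h (a + frame_map a (c *\<^sub>R u))" for u
    have inb: "a + frame_map a (c *\<^sub>R u) \<in> berg_ball a \<gamma>" if "norm u < 2" for u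
      using that c by (intro frame_map_in_berg_ball \<gamma> a) (simp add: c_def r_def[symmetric] abs_of_pos[OF r] r)
    have "line_hol (ball 0 2) H"
      unfolding H_def
    proof (rule line_hol_affine[OF h])
      show "linear (\<lambda>u. frame_map a (c *\<^sub>R u))"
        by (rule linearI) (simp_all add: frame_map_add frame_map_scaleR scaleR_add_right)
      show "frame_map a (c *\<^sub>R (t *s v)) = t *s frame_map a (c *\<^sub>R v)" for t v
        by (simp add: frame_map_scaleR frame_map_scale scaleR_eq_vector_scalar_mult vec_eq_iff)
      show "a + frame_map a (c *\<^sub>R u) \<in> unit_ball" if "u \<in> ball 0 2" for u
        using inb[of u] that by (simp add: berg_ball_def)
    qed
    from C0(2)[OF this]
    have 1: "ennreal (cmod (h a) powr p) \<le> ennreal C0 * (\<integral>\<^sup>+u\<in>ball 0 1. ennreal (cmod (H u) powr p) \<partial>lborel)"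
      by (simp add: H_def linear_0[OF linear_frame_map])
    define G where "G w = (ennreal (cmod (h w) powr p) * inv_weight w) * indicator (berg_ball a \<gamma>) w" for w
    have mG [measurable]: "G \<in> borel_measurable borel"
    proof -
      have [measurable]: "h \<in> borel_measurable ball_borel"
        using line_holD(1)[OF h] by (rule borel_measurable_continuous_on_restrict)
      show ?thesis
        unfolding G_def[abs_def]
        by (rule measurable_on_subset_of_ball[OF _ sets_berg_ball[OF \<gamma> a] berg_ball_subset_unit_ball]) measurable
    qed
    have "ennreal (cmod (H u) powr p) * indicator (ball 0 1) u \<le> ennreal (M * d) * G (a + frame_map a (c *\<^sub>R u))" for u
    proof (cases "norm u < 1")
      case True
      let ?w = "a + frame_map a (c *\<^sub>R u)"
      have w: "?w \<in> berg_ball a \<gamma>" using inb True by simp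
      have nw: "norm ?w < 1" using w by (simp add: berg_ball_def)
      have "defect ?w ^ (CARD('n) + 1) \<le> (4 * (cosh \<gamma>)\<^sup>2 * defect a) ^ (CARD('n) + 1)"
        using defect_le_on_berg_ball[OF a w] defect_pos[OF nw] by (intro power_mono) auto
      also have "\<dots> = M * d" by (simp only: power_mult_distrib M_def d_def)
      finally have "1 \<le> (M * d) * (1 / defect ?w ^ (CARD('n) + 1))"
        using defect_pos[OF nw] by (simp add: field_simps)
      then have "1 * cmod (H u) powr p \<le> (M * d) * (1 / defect ?w ^ (CARD('n) + 1)) * cmod (H u) powr p"
        by (intro mult_right_mono) auto
      then have "ennreal (cmod (H u) powr p) \<le> ennreal ((M * d) * (1 / defect ?w ^ (CARD('n) + 1)) * cmod (H u) powr p)"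
        by (intro ennreal_leI) simp
      also have "\<dots> = ennreal (M * d) * G ?w"
      proof -
        obtain k where k: "k = 1 / defect ?w ^ (CARD('n) + 1)" "0 \<le> k" using defect_pos[OF nw] by simp
        have "ennreal (M * d * k * cmod (h ?w) powr p) = ennreal (M * d) * (ennreal (cmod (h ?w) powr p) * ennreal k)"
          using M d k(2) by (simp add: ennreal_mult mult_ac)
        then show ?thesis using w by (simp add: G_def H_def k(1))
      qed
      finally show ?thesis using True by simp
    qed simp
    then have "(\<integral>\<^sup>+u\<in>ball 0 1. ennreal (cmod (H u) powr p) \<partial>lborel)
        \<le> (\<integral>\<^sup>+u. ennreal (M * d) * G (a + frame_map a (c *\<^sub>R u)) \<partial>lborel)"
      by (intro nn_integral_mono)
    also have "\<dots> = ennreal (M * d) * (\<integral>\<^sup>+u. G (a + frame_map a (c *\<^sub>R u)) \<partial>lborel)"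
    proof (rule nn_integral_cmult)
      have "(\<lambda>u. a + frame_map a (c *\<^sub>R u)) \<in> borel_measurable borel"
        by (intro borel_measurable_continuous_onI continuous_intros linear_continuous_on_compose[OF _ linear_frame_map])
      then show "(\<lambda>u. G (a + frame_map a (c *\<^sub>R u))) \<in> borel_measurable lborel"
        by (simp add: measurable_compose[OF _ mG])
    qed
    finally have 2: "(\<integral>\<^sup>+u\<in>ball 0 1. ennreal (cmod (H u) powr p) \<partial>lborel)
        \<le> ennreal (M * d) * (\<integral>\<^sup>+u. G (a + frame_map a (c *\<^sub>R u)) \<partial>lborel)" .
    have "ennreal (M * d) * (\<integral>\<^sup>+u. G (a + frame_map a (c *\<^sub>R u)) \<partial>lborel)
        = ennreal (M / N) * (ennreal (N * d) * (\<integral>\<^sup>+u. G (a + frame_map a (c *\<^sub>R u)) \<partial>lborel))"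
      using M N d by (simp add: mult.assoc[symmetric] ennreal_mult[symmetric])
    also have "\<dots> = ennreal (M / N) * (\<integral>\<^sup>+w. G w \<partial>lborel)"
      unfolding nn_integral_frame_map[OF a c mG] N_def d_def ..
    finally have 3: "ennreal (M * d) * (\<integral>\<^sup>+u. G (a + frame_map a (c *\<^sub>R u)) \<partial>lborel) = ennreal (M / N) * (\<integral>\<^sup>+w. G w \<partial>lborel)" .
    have "ennreal (cmod (h a) powr p) \<le> ennreal C0 * (ennreal (M / N) * (\<integral>\<^sup>+w. G w \<partial>lborel))"
      by (rule order_trans[OF 1 mult_left_mono[OF 2[unfolded 3]]]) simp
    also have "\<dots> = ennreal (C0 * M / N) * (\<integral>\<^sup>+w. G w \<partial>lborel)"
      using C0(1) M N by (simp add: mult.assoc[symmetric] ennreal_mult[symmetric])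
    finally show "ennreal (cmod (h a) powr p)
       \<le> ennreal (C0 * M / N) * inv_integral (berg_ball a \<gamma>) (\<lambda>w. ennreal (cmod (h w) powr p))"
      by (simp add: G_def)
  qed
qed

text \<open>
  On the Bergman ball the weight is comparable to its value at \<open>a\<close>, and the ball lies in an ellipsoid
  \<open>a + L B\<close>, with \<open>L\<close> the dilation at \<open>a\<close>, whose volume is the determinant of \<open>L\<close> times a constant.
\<close>

lemma weighted_volume_berg_ball:
  fixes \<beta> \<gamma> :: real
  assumes \<gamma>: "0 < \<gamma>"
  obtains C where "0 < C" "\<And>a :: complex ^ 'n. norm a < 1 \<Longrightarrow>
     (\<integral>\<^sup>+w\<in>berg_ball a \<gamma>. ennreal (defect w powr \<beta>) \<partial>lborel) \<le> ennreal (C * defect a powr (\<beta> + real (CARD('n) + 1)))"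
proof -
  define r where "r = tanh \<gamma> / (1 - tanh \<gamma>) + 1"
  have r: "0 < r" using \<gamma> tanh_real_lt_1[of \<gamma>] by (simp add: r_def add_pos_pos)
  define V where "V = ball_volume TYPE('n) * r ^ DIM(complex ^ 'n)"
  have V: "0 < V" using r unfolding V_def by (intro mult_pos_pos) simp_all
  define M where "M = (4 * (cosh \<gamma>)\<^sup>2) powr \<bar>\<beta>\<bar>"
  have M: "0 < M" by (simp add: M_def)
  show thesis
  proof (rule that[of "M * V"])
    show "0 < M * V" using M V by simp
    fix a :: "complex ^ 'n" assume a: "norm a < 1"
    have d: "0 < defect a" using a by (rule defect_pos)
    have mD: "berg_ball a \<gamma> \<in> sets borel" using \<gamma> a by (rule sets_berg_ball)
    have "(\<integral>\<^sup>+w\<in>berg_ball a \<gamma>. ennreal (defect w powr \<beta>) \<partial>lborel)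
        \<le> (\<integral>\<^sup>+w. ennreal (M * defect a powr \<beta>) * indicator (berg_ball a \<gamma>) w \<partial>lborel)"
      using defect_powr_on_berg_ball[OF a, of _ \<gamma> \<beta>]
      by (intro nn_integral_mono) (auto simp: indicator_def M_def intro!: ennreal_leI)
    also have "\<dots> = ennreal (M * defect a powr \<beta>) * emeasure lborel (berg_ball a \<gamma>)"
      using mD by (simp add: nn_integral_cmult_indicator)
    also have "emeasure lborel (berg_ball a \<gamma>) \<le> ennreal (defect a ^ (CARD('n) + 1) * V)"
    proof -
      have "emeasure lborel (berg_ball a \<gamma>) = (\<integral>\<^sup>+w. indicator (berg_ball a \<gamma>) w \<partial>lborel)"
        using mD by simp
      also have "\<dots> = ennreal (defect a ^ (CARD('n) + 1)) * (\<integral>\<^sup>+u. indicator (berg_ball a \<gamma>) (a + frame_map a u) \<partial>lborel)"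
        using nn_integral_frame_map[OF a zero_less_one, of "indicator (berg_ball a \<gamma>)"] mD
        by (simp add: borel_measurable_indicator)
      also have "(\<integral>\<^sup>+u. indicator (berg_ball a \<gamma>) (a + frame_map a u) \<partial>lborel)
          \<le> (\<integral>\<^sup>+u. indicator (ball 0 r) (u :: complex ^ 'n) \<partial>lborel)"
      proof (intro nn_integral_mono)
        fix u :: "complex ^ 'n"
        have "norm u < r" if u: "a + frame_map a u \<in> berg_ball a \<gamma>"
        proof -
          obtain v where v: "a + frame_map a u = a + frame_map a v" "norm v \<le> tanh \<gamma> / (1 - tanh \<gamma>)"
            using berg_ball_in_frame_ball[OF a u] .
          then have "frame_map a (u - v) = 0"
            by (simp add: linear_diff[OF linear_frame_map])
          then have "defect a * norm (u - v) \<le> 0" using norm_frame_map_ge[OF a, of "u - v"] by simp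
          then have "u = v" using d by (simp add: mult_le_0_iff)
          then show ?thesis using v(2) by (simp add: r_def)
        qed
        then show "indicator (berg_ball a \<gamma>) (a + frame_map a u) \<le> (indicator (ball 0 r) u :: ennreal)"
          by (auto simp: indicator_def)
      qed
      also have "(\<integral>\<^sup>+u. indicator (ball 0 r) (u :: complex ^ 'n) \<partial>lborel) = ennreal V"
        using r by (simp add: emeasure_ball V_def)
      finally show ?thesis using d V by (simp add: ennreal_mult mult_left_mono)
    qed
    also have "ennreal (M * defect a powr \<beta>) * ennreal (defect a ^ (CARD('n) + 1) * V)
        = ennreal (M * V * defect a powr (\<beta> + real (CARD('n) + 1)))"
    proof -
      have "M * defect a powr \<beta> * (defect a ^ (CARD('n) + 1) * V) = M * V * defect a powr (\<beta> + real (CARD('n) + 1))"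
        using d by (simp only: powr_add powr_realpow mult_ac)
      then show ?thesis
        using M V d by (subst ennreal_mult[symmetric]) (simp_all only: mult_nonneg_nonneg less_imp_le powr_ge_zero zero_le_power)
    qed
    finally show "(\<integral>\<^sup>+w\<in>berg_ball a \<gamma>. ennreal (defect w powr \<beta>) \<partial>lborel)
        \<le> ennreal (M * V * defect a powr (\<beta> + real (CARD('n) + 1)))"
      by (simp add: mult_left_mono)
  qed
qed

text \<open>
  By Tonelli and the symmetry of the relation \<open>w \<in> berg_ball z \<gamma>\<close>, each \<open>w\<close> is counted with the
  weighted volume of its own Bergman ball; the factor \<open>(1 - |w|^2)^(n+1)\<close> in that volume cancels the
  invariant density.
\<close>

lemma nn_integral_berg_average_le:
  fixes \<alpha> \<gamma> :: real
  assumes \<gamma>: "0 < \<gamma>"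
  obtains C where "0 < C" "\<And>G :: complex ^ 'n \<Rightarrow> ennreal. G \<in> borel_measurable ball_borel \<Longrightarrow>
     weighted_integral \<alpha> (\<lambda>z. inv_integral (berg_ball z \<gamma>) (\<lambda>w. G w))
     \<le> ennreal C * weighted_integral \<alpha> (\<lambda>w. G w)"
proof -
  obtain C where C: "0 < C" "\<And>a :: complex ^ 'n. norm a < 1 \<Longrightarrow>
     (\<integral>\<^sup>+w\<in>berg_ball a \<gamma>. ennreal (defect w powr \<alpha>) \<partial>lborel) \<le> ennreal (C * defect a powr (\<alpha> + real (CARD('n) + 1)))"
    using weighted_volume_berg_ball[where 'n = 'n and \<beta> = \<alpha>, OF \<gamma>] by blast
  show thesis
  proof (rule that[OF C(1)])
    fix G :: "complex ^ 'n \<Rightarrow> ennreal" assume "G \<in> borel_measurable ball_borel"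
    then have mG [measurable]: "(\<lambda>w. G w * indicator unit_ball w) \<in> borel_measurable borel"
      by (simp add: ball_borel_iff)
    define K where "K x = (indicator {(z :: complex ^ 'n, w). norm z < 1 \<and> w \<in> berg_ball z \<gamma>} x :: ennreal)" for x
    have mK [measurable]: "K \<in> borel_measurable (borel \<Otimes>\<^sub>M borel)"
      unfolding K_def by (rule borel_measurable_indicator[OF measurable_berg_pairs[OF \<gamma>]])
    define k where "k z w = K (z, w) * ((G w * indicator unit_ball w) * inv_weight w) * ennreal (defect z powr \<alpha>)" for z w
    have mk: "(\<lambda>(z, w). k z w) \<in> borel_measurable (lborel \<Otimes>\<^sub>M lborel)"
      unfolding k_def split_beta by measurable
    have "weighted_integral \<alpha> (\<lambda>z. inv_integral (berg_ball z \<gamma>) (\<lambda>w. G w))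
        = (\<integral>\<^sup>+z. \<integral>\<^sup>+w. k z w \<partial>lborel \<partial>lborel)"
    proof (rule nn_integral_cong)
      fix z :: "complex ^ 'n"
      show "inv_integral (berg_ball z \<gamma>) (\<lambda>w. G w) * ennreal (defect z powr \<alpha>) * indicator unit_ball z
          = (\<integral>\<^sup>+w. k z w \<partial>lborel)"
      proof (cases "norm z < 1")
        case True
        have [measurable]: "(\<lambda>w. indicator (berg_ball z \<gamma>) w :: ennreal) \<in> borel_measurable borel"
          using sets_berg_ball[OF \<gamma> True] by simp
        have eq: "(G w * inv_weight w) * indicator (berg_ball z \<gamma>) w
            = ((G w * indicator unit_ball w) * inv_weight w) * indicator (berg_ball z \<gamma>) w" for w
          using berg_ball_subset_unit_ball[of z \<gamma>] by (auto simp: indicator_def)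
        have "(\<integral>\<^sup>+w. k z w \<partial>lborel)
            = (\<integral>\<^sup>+w. (((G w * indicator unit_ball w) * inv_weight w) * indicator (berg_ball z \<gamma>) w) * ennreal (defect z powr \<alpha>) \<partial>lborel)"
          using True by (intro nn_integral_cong) (simp add: k_def K_def indicator_def)
        also have "\<dots> = inv_integral (berg_ball z \<gamma>) (\<lambda>w. G w) * ennreal (defect z powr \<alpha>)"
          unfolding eq by (rule nn_integral_multc) measurable
        finally show ?thesis using True by simp
      qed (simp add: k_def K_def)
    qed
    also have "\<dots> = (\<integral>\<^sup>+w. \<integral>\<^sup>+z. k z w \<partial>lborel \<partial>lborel)"
      by (rule lborel_pair.Fubini'[symmetric, OF mk])
    also have "\<dots> \<le> (\<integral>\<^sup>+w. ennreal C * ((G w * ennreal (defect w powr \<alpha>)) * indicator unit_ball w) \<partial>lborel)"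
    proof (rule nn_integral_mono)
      fix w :: "complex ^ 'n"
      show "(\<integral>\<^sup>+z. k z w \<partial>lborel) \<le> ennreal C * ((G w * ennreal (defect w powr \<alpha>)) * indicator unit_ball w)"
      proof (cases "norm w < 1")
        case True
        have d: "0 < defect w" using True by (rule defect_pos)
        have "(\<integral>\<^sup>+z. k z w \<partial>lborel) = (\<integral>\<^sup>+z. (G w * inv_weight w) * (ennreal (defect z powr \<alpha>) * indicator (berg_ball w \<gamma>) z) \<partial>lborel)"
        proof (rule nn_integral_cong)
          fix z :: "complex ^ 'n"
          have "norm z < 1 \<and> w \<in> berg_ball z \<gamma> \<longleftrightarrow> z \<in> berg_ball w \<gamma>"
            using berg_ball_commute[OF True, of z \<gamma>] berg_ball_subset_unit_ball[of w \<gamma>] by auto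
          then have "K (z, w) = indicator (berg_ball w \<gamma>) z" by (simp add: K_def indicator_def)
          then show "k z w = (G w * inv_weight w) * (ennreal (defect z powr \<alpha>) * indicator (berg_ball w \<gamma>) z)"
            using True by (simp add: k_def mult_ac)
        qed
        also have "\<dots> = (G w * inv_weight w) * (\<integral>\<^sup>+z\<in>berg_ball w \<gamma>. ennreal (defect z powr \<alpha>) \<partial>lborel)"
        proof (rule nn_integral_cmult)
          have [measurable]: "berg_ball w \<gamma> \<in> sets borel" using \<gamma> True by (rule sets_berg_ball)
          show "(\<lambda>z. ennreal (defect z powr \<alpha>) * indicator (berg_ball w \<gamma>) z) \<in> borel_measurable lborel"
            by measurable
        qed
        also have "\<dots> \<le> (G w * inv_weight w) * ennreal (C * defect w powr (\<alpha> + real (CARD('n) + 1)))"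
          by (intro mult_left_mono C True) simp
        also have "\<dots> = ennreal C * (G w * ennreal (defect w powr \<alpha>))"
        proof -
          have "(1 / defect w ^ (CARD('n) + 1)) * (C * defect w powr (\<alpha> + real (CARD('n) + 1))) = C * defect w powr \<alpha>"
            using d by (simp only: powr_add powr_realpow) simp
          then have "inv_weight w * ennreal (C * defect w powr (\<alpha> + real (CARD('n) + 1))) = ennreal (C * defect w powr \<alpha>)"
            using d C(1) by (simp only: ennreal_mult[symmetric] zero_le_divide_1_iff zero_le_power less_imp_le mult_nonneg_nonneg powr_ge_zero)
          moreover have "ennreal (C * defect w powr \<alpha>) = ennreal C * ennreal (defect w powr \<alpha>)"
            using C(1) by (simp add: ennreal_mult)
          ultimately show ?thesis by (simp only: mult.assoc mult.left_commute[of "G w" "ennreal C"])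
        qed
        finally show ?thesis using True by simp
      next
        case False
        then have "k z w = 0" for z by (simp add: k_def)
        then show ?thesis by simp
      qed
    qed
    also have "\<dots> = ennreal C * weighted_integral \<alpha> (\<lambda>w. G w)"
    proof (rule nn_integral_cmult)
      have "(\<lambda>w. (G w * indicator unit_ball w) * ennreal (defect w powr \<alpha>)) \<in> borel_measurable borel"
        by measurable
      then show "(\<lambda>w. (G w * ennreal (defect w powr \<alpha>)) * indicator unit_ball w) \<in> borel_measurable lborel"
        by (simp add: mult_ac)
    qed
    finally show "weighted_integral \<alpha> (\<lambda>z. inv_integral (berg_ball z \<gamma>) (\<lambda>w. G w))
     \<le> ennreal C * weighted_integral \<alpha> (\<lambda>w. G w)" .
  qed
qed

section \<open>Area integral functions\<close>

lemma area_int_eq: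
  fixes h :: "complex ^ 'n \<Rightarrow> real"
  assumes [measurable]: "h \<in> borel_measurable ball_borel" and "0 < \<gamma>" "norm z < 1"
  shows "area_int \<gamma> q h z = epowr (ennreal (1 / ball_volume TYPE('n))
      * inv_integral (berg_ball z \<gamma>) (\<lambda>w. ennreal (h w powr q))) (1 / q)"
  unfolding area_int_def
  by (subst nn_integral_inv_meas)
     (use sets_berg_ball[OF assms(2,3)] berg_ball_subset_unit_ball in \<open>simp_all\<close>)

lemma measurable_berg_average:
  fixes G :: "complex ^ 'n \<Rightarrow> ennreal"
  assumes G: "G \<in> borel_measurable ball_borel" and \<gamma>: "0 < \<gamma>"
  shows "(\<lambda>z. \<integral>\<^sup>+w\<in>berg_ball z \<gamma>. G w * inv_weight w \<partial>lborel) \<in> borel_measurable ball_borel"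
proof -
  define K where "K x = (indicator {(z :: complex ^ 'n, w). norm z < 1 \<and> w \<in> berg_ball z \<gamma>} x :: ennreal)" for x
  have mK [measurable]: "K \<in> borel_measurable (borel \<Otimes>\<^sub>M borel)"
    unfolding K_def by (rule borel_measurable_indicator[OF measurable_berg_pairs[OF \<gamma>]])
  have mG [measurable]: "(\<lambda>w. G w * indicator unit_ball w) \<in> borel_measurable borel"
    using G by (simp add: ball_borel_iff)
  define J where "J z = (\<integral>\<^sup>+w. K (z, w) * ((G w * indicator unit_ball w) * inv_weight w) \<partial>lborel)" for z
  have "J \<in> borel_measurable borel"
    unfolding J_def by measurable
  then have J: "J \<in> borel_measurable ball_borel"
    by (rule measurable_restrict_space1)
  have "inv_integral (berg_ball z \<gamma>) (\<lambda>w. G w) = J z" if "z \<in> space ball_borel" for z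
    unfolding J_def using that berg_ball_subset_unit_ball[of z \<gamma>]
    by (intro nn_integral_cong) (auto simp: K_def indicator_def space_restrict_space)
  with J show ?thesis
    by (rule measurable_cong[THEN iffD2, rotated])
qed

lemma measurable_area_int:
  fixes h :: "complex ^ 'n \<Rightarrow> real"
  assumes h [measurable]: "h \<in> borel_measurable ball_borel" and \<gamma>: "0 < \<gamma>"
  shows "area_int \<gamma> q h \<in> borel_measurable ball_borel"
proof -
  have [measurable]: "(\<lambda>z. \<integral>\<^sup>+w\<in>berg_ball z \<gamma>. ennreal (h w powr q) * inv_weight w \<partial>lborel) \<in> borel_measurable ball_borel"
    by (rule measurable_berg_average[OF _ \<gamma>]) measurable
  have "(\<lambda>z. epowr (ennreal (1 / ball_volume TYPE('n))
      * inv_integral (berg_ball z \<gamma>) (\<lambda>w. ennreal (h w powr q))) (1 / q)) \<in> borel_measurable ball_borel"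
    by measurable
  then show ?thesis
    by (rule measurable_cong[THEN iffD1, rotated]) (simp add: area_int_eq[OF h \<gamma>] space_restrict_space)
qed

lemma area_int_mono:
  fixes g h :: "complex ^ 'n \<Rightarrow> real"
  assumes "0 < q" "\<And>w. norm w < 1 \<Longrightarrow> 0 \<le> g w" "\<And>w. norm w < 1 \<Longrightarrow> g w \<le> h w"
  shows "area_int \<gamma> q g z \<le> area_int \<gamma> q h z"
  unfolding area_int_def using assms berg_ball_subset_unit_ball[of z \<gamma>]
  by (intro epowr_mono nn_integral_mono)
     (auto simp: indicator_def intro!: ennreal_leI powr_mono2)

section \<open>The three gradients\<close>

text \<open>
  The involution maps the complex line through 0 in direction \<open>e\<close> into one complex line through \<open>z\<close>, by
  a Moebius reparametrisation that is tangent to the identity at \<open>t = 0\<close>.  Its derivative at 0 is thus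
  visible without differentiating a vector-valued function.
\<close>

lemma frame_map_eq_ball_aut_slice:
  fixes z :: "complex ^ 'n"
  assumes "norm z < 1" "1 - t * herm e z \<noteq> 0"
  shows "ball_aut z (t *s e) = z + (t / (1 - t * herm e z)) *s (- frame_map z e)"
proof -
  define h where "h = herm e z"
  define w where "w = line_proj z e + sqrt (defect z) *\<^sub>R (e - line_proj z e)"
  have "h *s z = (norm z)\<^sup>2 *\<^sub>R line_proj z e"
    by (cases "z = 0") (simp_all add: line_proj_def h_def herm_self vec_eq_iff scaleR_conv_of_real[where 'a = complex])
  also have "\<dots> = w - frame_map z e"
    by (simp add: w_def frame_map_def defect_def algebra_simps)
  finally have hz: "h *s z = w - frame_map z e" .
  have "ball_aut z (t *s e) = (1 / (1 - t * h)) *s (z - t *s w)"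
    unfolding ball_aut_def w_def
    by (simp add: herm_scale_left line_proj_scale h_def defect_def vec_eq_iff algebra_simps)
  also have "z - t *s w = (1 - t * h) *s z - t *s frame_map z e"
  proof -
    have "(1 - t * h) *s z = z - t *s (h *s z)" by (simp add: vec_eq_iff algebra_simps)
    then show ?thesis unfolding hz by (simp add: vec_eq_iff algebra_simps)
  qed
  also have "(1 / (1 - t * h)) *s \<dots> = z + (t / (1 - t * h)) *s (- frame_map z e)"
  proof -
    have "(1 / k) *s (k *s z - t *s y) = z + (t / k) *s (- y)" if "k \<noteq> 0" for k and y :: "complex ^ 'n"
      using that by (simp add: vec_eq_iff diff_divide_distrib right_diff_distrib)
    then show ?thesis using assms(2) unfolding h_def by blast
  qed
  finally show ?thesis by (simp add: h_def)
qed

lemma inv_grad_component: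
  fixes f :: "complex ^ 'n \<Rightarrow> complex"
  assumes f: "f \<in> hol_ball" and z: "norm z < 1"
  shows "inv_grad f z $ k = - fderiv f z (frame_map z (axis k 1))"
proof -
  define e :: "complex ^ 'n" where "e = axis k 1"
  define h where "h = herm e z"
  let ?L = "- frame_map z e"
  have ax: "axis k t = t *s e" for t by (simp add: vec_eq_iff axis_def e_def)
  have D1: "((\<lambda>t. f (z + t *s ?L)) has_field_derivative fderiv f z ?L) (at (0 / (1 - 0 * h)))"
    using hol_ball_slice_derivative[OF f, of z 0 ?L] z by simp
  have D2: "((\<lambda>t. t / (1 - t * h)) has_field_derivative 1) (at 0)"
    by (auto intro!: derivative_eq_intros)
  have D: "((\<lambda>t. f (z + (t / (1 - t * h)) *s ?L)) has_field_derivative fderiv f z ?L) (at 0)"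
    using DERIV_chain2[OF D1 D2] by simp
  have "((\<lambda>t. (f \<circ> ball_aut z) (0 + axis k t)) has_field_derivative fderiv f z ?L) (at 0)"
  proof (rule has_field_derivative_transform_within_open[OF D])
    show "open {t. 1 - t * h \<noteq> 0}" by (intro open_Collect_neq continuous_intros)
    show "(0::complex) \<in> {t. 1 - t * h \<noteq> 0}" by simp
    show "f (z + (t / (1 - t * h)) *s ?L) = (f \<circ> ball_aut z) (0 + axis k t)" if "t \<in> {t. 1 - t * h \<noteq> 0}" for t
      using that by (simp add: ax frame_map_eq_ball_aut_slice[OF z] h_def)
  qed
  then show ?thesis
    by (simp add: inv_grad_def cgrad_def cpartial_def DERIV_imp_deriv linear_neg[OF linear_fderiv[OF f z]] e_def)
qed

text \<open>
  Cauchy-Schwarz, since the derivative is the pairing with the conjugate gradient.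
\<close>

lemma cmod_fderiv_le_cgrad:
  fixes f :: "complex ^ 'n \<Rightarrow> complex"
  assumes f: "f \<in> hol_ball" and z: "norm z < 1"
  shows "cmod (fderiv f z v) \<le> norm v * norm (cgrad f z)"
proof -
  define g :: "complex ^ 'n" where "g = (\<chi> k. cnj (cpartial k f z))"
  have "(norm g)\<^sup>2 = (norm (cgrad f z))\<^sup>2"
    by (simp add: g_def cgrad_def norm_vec_def L2_set_def)
  then have g: "norm g = norm (cgrad f z)" by (simp add: power2_eq_iff_nonneg)
  have "fderiv f z v = herm v g"
    by (simp add: fderiv_expand[OF f z] herm_def g_def)
  then show ?thesis using herm_Cauchy_Schwarz[of v g] g by simp
qed

text \<open>
  The derivative in the direction of the conjugate gradient is the squared length of the gradient.
\<close>

lemma norm_cgrad_le: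
  fixes f :: "complex ^ 'n \<Rightarrow> complex"
  assumes f: "f \<in> hol_ball" and z: "norm z < 1"
    and M: "\<And>v. cmod (fderiv f z v) \<le> M * norm v"
  shows "norm (cgrad f z) \<le> M"
proof -
  define g :: "complex ^ 'n" where "g = (\<chi> k. cnj (cpartial k f z))"
  have "(norm g)\<^sup>2 = (norm (cgrad f z))\<^sup>2"
    by (simp add: g_def cgrad_def norm_vec_def L2_set_def)
  then have g: "norm g = norm (cgrad f z)" by (simp add: power2_eq_iff_nonneg)
  have "fderiv f z g = herm g g"
    by (simp add: fderiv_expand[OF f z] herm_def g_def)
  then have "norm g * norm g \<le> M * norm g"
    using M[of g] by (simp add: herm_self power2_eq_square norm_mult)
  then have "norm g \<le> M \<or> norm g = 0" using mult_right_le_imp_le[of "norm g" "norm g" M] by auto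
  moreover have "0 \<le> M" using order_trans[OF norm_ge_zero M[of "axis undefined 1"]] by simp
  ultimately show ?thesis using g by auto
qed

lemma radial_deriv_le_cgrad:
  assumes "f \<in> hol_ball" "norm z < 1"
  shows "cmod (radial_deriv f z) \<le> norm (cgrad f z)"
proof -
  have "cmod (radial_deriv f z) \<le> norm z * norm (cgrad f z)"
    using cmod_fderiv_le_cgrad[OF assms] by (simp add: radial_deriv_eq_fderiv[OF assms])
  also have "\<dots> \<le> norm (cgrad f z)" using assms(2) by (intro mult_left_le_one_le) auto
  finally show ?thesis .
qed

text \<open>
  The invariant gradient represents the derivative composed with the dilation at \<open>z\<close>, and that dilation
  shrinks no vector by more than the factor \<open>1 - |z|^2\<close>.
\<close>

lemma cgrad_le_inv_grad:
  fixes f :: "complex ^ 'n \<Rightarrow> complex"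
  assumes f: "f \<in> hol_ball" and z: "norm z < 1"
  shows "defect z * norm (cgrad f z) \<le> norm (inv_grad f z)"
proof -
  have d: "0 < defect z" using z by (rule defect_pos)
  have L: "cmod (fderiv f z (frame_map z v)) \<le> norm v * norm (inv_grad f z)" for v
  proof -
    define g :: "complex ^ 'n" where "g = (\<chi> k. cnj (- inv_grad f z $ k))"
    have "(norm g)\<^sup>2 = (norm (inv_grad f z))\<^sup>2"
      by (simp add: g_def norm_vec_def L2_set_def)
    then have g: "norm g = norm (inv_grad f z)" by (simp add: power2_eq_iff_nonneg)
    have "frame_map z v = frame_map z (\<Sum>k\<in>UNIV. v $ k *s axis k 1)"
      by (simp only: basis_expansion)
    also have "\<dots> = (\<Sum>k\<in>UNIV. v $ k *s frame_map z (axis k 1))"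
      by (simp add: linear_sum[OF linear_frame_map] frame_map_scale)
    finally have "fderiv f z (frame_map z v) = (\<Sum>k\<in>UNIV. v $ k * fderiv f z (frame_map z (axis k 1)))"
      by (simp add: linear_sum[OF linear_fderiv[OF f z]] hol_ball_fderiv(2)[OF f z])
    also have "\<dots> = herm v g"
      by (simp add: herm_def g_def inv_grad_component[OF f z])
    finally show ?thesis using herm_Cauchy_Schwarz[of v g] g by simp
  qed
  have "norm (cgrad f z) \<le> norm (inv_grad f z) / defect z"
  proof (rule norm_cgrad_le[OF f z])
    fix v
    obtain u where "0 + v = frame_map z u"
      using frame_map_surj[OF z, of "z + v"] by (metis add_0 add_left_cancel)
    then have u: "v = frame_map z u" by simp
    have "norm u \<le> norm v / defect z"
      using norm_frame_map_ge[OF z, of u] d by (simp add: u field_simps)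
    then have "norm u * norm (inv_grad f z) \<le> norm v / defect z * norm (inv_grad f z)"
      by (intro mult_right_mono) auto
    then show "cmod (fderiv f z v) \<le> norm (inv_grad f z) / defect z * norm v"
      using L[of u] by (simp add: u mult.commute)
  qed
  then show ?thesis using d by (simp add: field_simps)
qed

text \<open>
  Cauchy's estimate on the discs \<open>z + t L e\<close>, with \<open>L\<close> the dilation at \<open>z\<close> and \<open>e\<close> a coordinate vector; for
  \<open>|t| < tanh \<gamma> / (1 + tanh \<gamma>)\<close> they stay in the Bergman ball, and half that radius is used.
\<close>

lemma norm_inv_grad_le:
  fixes f :: "complex ^ 'n \<Rightarrow> complex"
  assumes f: "f \<in> hol_ball" and z: "norm z < 1" and \<gamma>: "0 < \<gamma>"
    and M: "\<And>y. y \<in> berg_ball z \<gamma> \<Longrightarrow> cmod (f y - a) \<le> M"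
  shows "norm (inv_grad f z) \<le> real CARD('n) * (M / (tanh \<gamma> / (1 + tanh \<gamma>) / 2))"
proof -
  define r where "r = tanh \<gamma> / (1 + tanh \<gamma>)"
  have r: "0 < r" using \<gamma> by (simp add: r_def add_pos_pos)
  have "cmod (inv_grad f z $ k) \<le> M / (r / 2)" for k
  proof -
    define e :: "complex ^ 'n" where "e = axis k 1"
    define \<phi> where "\<phi> t = f (z + t *s frame_map z e) - a" for t
    have mem: "z + t *s frame_map z e \<in> berg_ball z \<gamma>" if "cmod t < r" for t
      using frame_map_in_berg_ball[OF \<gamma> z, of "t *s e"] that
      by (simp add: frame_map_scale r_def norm_vector_scalar_mult e_def)
    have hol: "\<phi> holomorphic_on ball 0 r"
    proof -
      have "(\<lambda>t. f (z + t *s frame_map z e)) holomorphic_on ball 0 r"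
        by (rule holomorphic_on_subset[OF line_holD(2)[OF hol_ball_line_hol[OF f]]])
           (use mem in \<open>auto simp: berg_ball_def\<close>)
      then show ?thesis unfolding \<phi>_def by (intro holomorphic_intros)
    qed
    have sub: "cball 0 (r / 2) \<subseteq> ball (0::complex) r" using r by auto
    have "cmod ((deriv ^^ 1) \<phi> 0) \<le> fact 1 * M / (r / 2) ^ 1"
    proof (rule Cauchy_inequality)
      show "\<phi> holomorphic_on ball 0 (r / 2)" "continuous_on (cball 0 (r / 2)) \<phi>"
        using holomorphic_on_subset[OF hol sub]
        by (auto intro: holomorphic_on_subset[OF _ ball_subset_cball] holomorphic_on_imp_continuous_on)
      show "0 < r / 2" using r by simp
      show "cmod (\<phi> t) \<le> M" if "cmod (0 - t) = r / 2" for t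
        unfolding \<phi>_def using that r by (intro M mem) simp
    qed
    moreover have "deriv \<phi> 0 = fderiv f z (frame_map z e)"
    proof -
      have "(\<phi> has_field_derivative fderiv f z (frame_map z e) - 0) (at 0)"
        unfolding \<phi>_def using hol_ball_slice_derivative[OF f, of z 0 "frame_map z e"] z
        by (intro DERIV_diff) auto
      then show ?thesis by (simp add: DERIV_imp_deriv)
    qed
    ultimately show ?thesis by (simp add: inv_grad_component[OF f z] e_def)
  qed
  then have "(\<Sum>k\<in>UNIV. norm (inv_grad f z $ k)) \<le> (\<Sum>k\<in>(UNIV :: 'n set). M / (r / 2))"
    by (intro sum_mono) auto
  moreover have "norm (inv_grad f z) \<le> (\<Sum>k\<in>UNIV. norm (inv_grad f z $ k))"
    unfolding norm_vec_def by (rule L2_set_le_sum) auto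
  ultimately show ?thesis by (simp add: r_def)
qed

section \<open>Measurability of the area integral functions\<close>

lemma line_hol_measurable: "line_hol unit_ball h \<Longrightarrow> h \<in> borel_measurable ball_borel"
  using line_holD(1) borel_measurable_continuous_on_restrict by blast

lemma measurable_component [measurable]: "(\<lambda>z :: complex ^ 'n. z $ k) \<in> borel_measurable borel"
  by (intro borel_measurable_continuous_onI continuous_intros)

lemma measurable_cnj_component [measurable]: "(\<lambda>z :: complex ^ 'n. cnj (z $ k)) \<in> borel_measurable borel"
  by (intro borel_measurable_continuous_onI continuous_intros)

lemma measurable_norm_vec:
  fixes g :: "'b \<Rightarrow> complex ^ 'n"
  assumes "\<And>k. (\<lambda>x. g x $ k) \<in> borel_measurable M"
  shows "(\<lambda>x. norm (g x)) \<in> borel_measurable M"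
  unfolding norm_vec_def L2_set_def using assms by measurable

lemma measurable_radial:
  assumes "f \<in> hol_ball"
  shows "(\<lambda>z. norm ((1 - (norm z)\<^sup>2) *\<^sub>R radial_deriv f z)) \<in> borel_measurable ball_borel"
proof -
  have [measurable]: "radial_deriv f \<in> borel_measurable ball_borel"
    using assms by (intro line_hol_measurable radial_deriv_line_hol)
  show ?thesis unfolding defect_def[symmetric] by measurable
qed

lemma measurable_cgrad:
  assumes "f \<in> hol_ball"
  shows "(\<lambda>z. norm ((1 - (norm z)\<^sup>2) *\<^sub>R cgrad f z)) \<in> borel_measurable ball_borel"
proof (rule measurable_norm_vec)
  fix k
  have [measurable]: "cpartial k f \<in> borel_measurable ball_borel"
    using assms by (intro line_hol_measurable cpartial_line_hol)
  show "(\<lambda>z. ((1 - (norm z)\<^sup>2) *\<^sub>R cgrad f z) $ k) \<in> borel_measurable ball_borel"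
    unfolding defect_def[symmetric] by (simp add: cgrad_def)
qed

lemma measurable_inv_grad:
  fixes f :: "complex ^ 'n \<Rightarrow> complex"
  assumes f: "f \<in> hol_ball"
  shows "(\<lambda>z. norm (inv_grad f z)) \<in> borel_measurable ball_borel"
proof (rule measurable_norm_vec)
  fix k :: 'n
  have cp [measurable]: "cpartial j f \<in> borel_measurable ball_borel" for j
    using f by (intro line_hol_measurable cpartial_line_hol)
  have fm [measurable]: "(\<lambda>z. frame_map z (axis k 1) $ j) \<in> borel_measurable ball_borel" for j
    by (rule measurable_restrict_space1) (simp add: frame_map_def line_proj_def herm_def, measurable)
  have "(\<lambda>z. - (\<Sum>j\<in>UNIV. frame_map z (axis k 1) $ j * cpartial j f z)) \<in> borel_measurable ball_borel"
    by measurable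
  then show "(\<lambda>z. inv_grad f z $ k) \<in> borel_measurable ball_borel"
    by (rule measurable_cong[THEN iffD1, rotated])
       (simp add: space_restrict_space inv_grad_component[OF f] fderiv_expand[OF f])
qed

section \<open>The invariant area integral is dominated by the function\<close>

text \<open>
  The invariant gradient on \<open>D(z,\<gamma>)\<close> is controlled by the values of \<open>f - f 0\<close> at distance less than 1
  from there, and these by averages over balls of radius 1; hence the radius \<open>\<gamma> + 1 + 1\<close>.  The bound is
  uniform on \<open>D(z,\<gamma>)\<close>, whose invariant measure is bounded, so the integral exponent \<open>q\<close> disappears.
\<close>

lemma area_inv_grad_le_average:
  fixes p q \<gamma> :: real
  assumes p: "0 < p" and q: "0 < q" and \<gamma>: "0 < \<gamma>"
  obtains C where "0 < C"
    "\<And>(f :: complex ^ 'n \<Rightarrow> complex) z. f \<in> hol_ball \<Longrightarrow> norm z < 1 \<Longrightarrow>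
       epowr (area_inv_grad \<gamma> q f z) p
       \<le> ennreal C * inv_integral (berg_ball z (\<gamma> + 1 + 1)) (\<lambda>w. ennreal (cmod (f w - f 0) powr p))"
proof -
  obtain C1 where C1: "0 < C1"
    "\<And>(h :: complex ^ 'n \<Rightarrow> complex) a. line_hol unit_ball h \<Longrightarrow> norm a < 1 \<Longrightarrow>
       ennreal (cmod (h a) powr p)
       \<le> ennreal C1 * inv_integral (berg_ball a 1) (\<lambda>w. ennreal (cmod (h w) powr p))"
    using sub_mean_value_berg_ball[where 'n = 'n, OF p zero_less_one] by blast
  obtain C2 where C2: "0 < C2" "\<And>a :: complex ^ 'n. norm a < 1 \<Longrightarrow>
     (\<integral>\<^sup>+w\<in>berg_ball a \<gamma>. ennreal (defect w powr (- real (CARD('n) + 1))) \<partial>lborel)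
       \<le> ennreal (C2 * defect a powr (- real (CARD('n) + 1) + real (CARD('n) + 1)))"
    using weighted_volume_berg_ball[where 'n = 'n and \<beta> = "- real (CARD('n) + 1)", OF \<gamma>] by blast
  define c where "c = tanh 1 / (1 + tanh 1) / (2 :: real)"
  have c: "0 < c" by (simp add: c_def add_pos_pos)
  define n where "n = real CARD('n)"
  have n: "0 < n" by (simp add: n_def)
  define \<kappa> where "\<kappa> = 1 / ball_volume TYPE('n)"
  have \<kappa>: "0 < \<kappa>" by (simp add: \<kappa>_def)
  define C where "C = ((\<kappa> * C2) powr (1 / q) * (n / c)) powr p * C1"
  show thesis
  proof (rule that)
    show "0 < C" using \<kappa> C2(1) C1(1) n c by (simp add: C_def)
    fix f :: "complex ^ 'n \<Rightarrow> complex" and z :: "complex ^ 'n"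
    assume f: "f \<in> hol_ball" and z: "norm z < 1"
    define H where "H = inv_integral (berg_ball z (\<gamma> + 1 + 1)) (\<lambda>w. ennreal (cmod (f w - f 0) powr p))"
    have "epowr (area_inv_grad \<gamma> q f z) p \<le> ennreal C * H"
    proof (cases "H = top")
      case True
      then show ?thesis using \<open>0 < C\<close> by (simp add: ennreal_mult_top)
    next
      case False
      then obtain Hr where Hr: "H = ennreal Hr" "0 \<le> Hr" by (cases H) auto
      have lh: "line_hol unit_ball (\<lambda>w. f w - f 0)"
        by (intro line_hol_diff line_hol_const hol_ball_line_hol f)
      define M where "M = (C1 * Hr) powr (1 / p)"
      have M0: "0 \<le> M" by (simp add: M_def)
      have M: "cmod (f y - f 0) \<le> M" if y: "y \<in> berg_ball z (\<gamma> + 1)" for y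
      proof -
        have ny: "norm y < 1" using y by (simp add: berg_ball_def)
        have sub: "berg_ball y 1 \<subseteq> berg_ball z (\<gamma> + 1 + 1)" using berg_ball_trans[OF z y] by blast
        have "ennreal (cmod (f y - f 0) powr p)
            \<le> ennreal C1 * inv_integral (berg_ball y 1) (\<lambda>w. ennreal (cmod (f w - f 0) powr p))"
          by (rule C1(2)[OF lh ny])
        also have "\<dots> \<le> ennreal C1 * H"
          unfolding H_def using sub
          by (intro mult_left_mono nn_integral_mono) (auto simp: indicator_def)
        also have "\<dots> = ennreal (C1 * Hr)" using C1(1) Hr by (simp add: ennreal_mult)
        finally have "cmod (f y - f 0) powr p \<le> C1 * Hr"
          using C1(1) Hr by (simp add: ennreal_le_iff)
        then have "(cmod (f y - f 0) powr p) powr (1 / p) \<le> M"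
          unfolding M_def using p by (intro powr_mono2) auto
        then show ?thesis using p by (simp add: powr_powr)
      qed
      define B where "B = n * (M / c)"
      have B0: "0 \<le> B" using n c M0 by (simp add: B_def)
      have B: "norm (inv_grad f w) \<le> B" if w: "w \<in> berg_ball z \<gamma>" for w
      proof -
        have nw: "norm w < 1" using w by (simp add: berg_ball_def)
        have "cmod (f y - f 0) \<le> M" if "y \<in> berg_ball w 1" for y
          using M berg_ball_trans[OF z w that] by blast
        from norm_inv_grad_le[OF f nw zero_less_one this]
        show ?thesis by (simp add: B_def n_def c_def)
      qed
      have "inv_integral (berg_ball z \<gamma>) (\<lambda>w. ennreal (norm (inv_grad f w) powr q))
          \<le> (\<integral>\<^sup>+w. ennreal (B powr q) * (ennreal (defect w powr (- real (CARD('n) + 1))) * indicator (berg_ball z \<gamma>) w) \<partial>lborel)"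
      proof (rule nn_integral_mono)
        fix w :: "complex ^ 'n"
        show "ennreal (norm (inv_grad f w) powr q) * inv_weight w * indicator (berg_ball z \<gamma>) w
            \<le> ennreal (B powr q) * (ennreal (defect w powr (- real (CARD('n) + 1))) * indicator (berg_ball z \<gamma>) w)"
        proof (cases "w \<in> berg_ball z \<gamma>")
          case True
          then have "0 < defect w" by (simp add: berg_ball_def defect_pos)
          then have "inv_weight w = ennreal (defect w powr (- real (CARD('n) + 1)))"
            by (simp only: powr_minus_divide powr_realpow)
          then show ?thesis using True B[OF True] q
            by (simp only: indicator_simps mult_1_right) (intro mult_right_mono ennreal_leI powr_mono2, auto)
        qed simp
      qed
      also have "\<dots> = ennreal (B powr q) * (\<integral>\<^sup>+w\<in>berg_ball z \<gamma>. ennreal (defect w powr (- real (CARD('n) + 1))) \<partial>lborel)"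
      proof (rule nn_integral_cmult)
        have [measurable]: "berg_ball z \<gamma> \<in> sets borel" using \<gamma> z by (rule sets_berg_ball)
        show "(\<lambda>w. ennreal (defect w powr (- real (CARD('n) + 1))) * indicator (berg_ball z \<gamma>) w) \<in> borel_measurable lborel"
          by measurable
      qed
      also have "\<dots> \<le> ennreal (B powr q) * ennreal (C2 * defect z powr (- real (CARD('n) + 1) + real (CARD('n) + 1)))"
        by (intro mult_left_mono C2(2) z) simp
      also have "\<dots> = ennreal (B powr q * C2)"
        using C2(1) defect_pos[OF z] by (simp add: ennreal_mult)
      finally have I: "inv_integral (berg_ball z \<gamma>) (\<lambda>w. ennreal (norm (inv_grad f w) powr q)) \<le> ennreal (B powr q * C2)" .
      have "area_inv_grad \<gamma> q f z \<le> epowr (ennreal \<kappa> * ennreal (B powr q * C2)) (1 / q)"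
        unfolding area_inv_grad_def area_int_eq[OF measurable_inv_grad[OF f] \<gamma> z] \<kappa>_def[symmetric]
        using q I by (intro epowr_mono mult_left_mono) auto
      also have "\<dots> = ennreal ((\<kappa> * (B powr q * C2)) powr (1 / q))"
        using \<kappa> C2(1) by (simp add: ennreal_mult[symmetric] epowr_ennreal)
      also have "(\<kappa> * (B powr q * C2)) powr (1 / q) = (\<kappa> * C2) powr (1 / q) * B"
        using \<kappa> C2(1) q B0 by (simp add: powr_mult powr_powr)
      finally have "epowr (area_inv_grad \<gamma> q f z) p \<le> epowr (ennreal ((\<kappa> * C2) powr (1 / q) * B)) p"
        using p by (intro epowr_mono) auto
      also have "\<dots> = ennreal (((\<kappa> * C2) powr (1 / q) * B) powr p)"
        using B0 by (intro epowr_ennreal) auto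
      also have "((\<kappa> * C2) powr (1 / q) * B) powr p = ((\<kappa> * C2) powr (1 / q) * (n / c)) powr p * M powr p"
        using M0 n c by (simp add: B_def powr_mult[symmetric] mult.assoc)
      also have "M powr p = C1 * Hr"
        using p C1(1) Hr(2) by (simp add: M_def powr_powr)
      also have "((\<kappa> * C2) powr (1 / q) * (n / c)) powr p * (C1 * Hr) = C * Hr"
        by (simp add: C_def)
      also have "ennreal (C * Hr) = ennreal C * H" using \<open>0 < C\<close> Hr by (simp add: ennreal_mult)
      finally show ?thesis .
    qed
    then show "epowr (area_inv_grad \<gamma> q f z) p
       \<le> ennreal C * inv_integral (berg_ball z (\<gamma> + 1 + 1)) (\<lambda>w. ennreal (cmod (f w - f 0) powr p))"
      by (simp only: H_def)
  qed
qed

lemma nn_integral_area_inv_grad_le: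
  fixes p q \<gamma> \<alpha> :: real
  assumes p: "0 < p" and q: "0 < q" and \<gamma>: "0 < \<gamma>"
  obtains C where "0 < C"
    "\<And>f :: complex ^ 'n \<Rightarrow> complex. f \<in> hol_ball \<Longrightarrow>
       weighted_integral \<alpha> (\<lambda>z. epowr (area_inv_grad \<gamma> q f z) p)
       \<le> ennreal C * weighted_integral \<alpha> (\<lambda>z. ennreal (cmod (f z - f 0) powr p))"
proof -
  obtain C1 where C1: "0 < C1"
    "\<And>(f :: complex ^ 'n \<Rightarrow> complex) z. f \<in> hol_ball \<Longrightarrow> norm z < 1 \<Longrightarrow>
       epowr (area_inv_grad \<gamma> q f z) p
       \<le> ennreal C1 * inv_integral (berg_ball z (\<gamma> + 1 + 1)) (\<lambda>w. ennreal (cmod (f w - f 0) powr p))"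
    using area_inv_grad_le_average[where 'n = 'n, OF assms] by blast
  have \<gamma>': "0 < \<gamma> + 1 + 1" using \<gamma> by simp
  obtain C2 where C2: "0 < C2" "\<And>G :: complex ^ 'n \<Rightarrow> ennreal. G \<in> borel_measurable ball_borel \<Longrightarrow>
     weighted_integral \<alpha> (\<lambda>z. inv_integral (berg_ball z (\<gamma> + 1 + 1)) (\<lambda>w. G w))
     \<le> ennreal C2 * weighted_integral \<alpha> (\<lambda>w. G w)"
    using nn_integral_berg_average_le[where 'n = 'n and \<alpha> = \<alpha>, OF \<gamma>'] by blast
  show thesis
  proof (rule that)
    show "0 < C1 * C2" using C1(1) C2(1) by simp
    fix f :: "complex ^ 'n \<Rightarrow> complex" assume f: "f \<in> hol_ball"
    have [measurable]: "f \<in> borel_measurable ball_borel"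
      by (intro line_hol_measurable hol_ball_line_hol f)
    define G where "G w = ennreal (cmod (f w - f 0) powr p)" for w
    have mG: "G \<in> borel_measurable ball_borel" unfolding G_def by measurable
    define A where "A z = inv_integral (berg_ball z (\<gamma> + 1 + 1)) (\<lambda>w. G w)" for z
    have [measurable]: "A \<in> borel_measurable ball_borel"
      unfolding A_def using mG \<gamma>' by (rule measurable_berg_average)
    have m: "(\<lambda>z. A z * ennreal (defect z powr \<alpha>) * indicator unit_ball z) \<in> borel_measurable borel"
      unfolding ball_borel_iff[symmetric] by measurable
    have "weighted_integral \<alpha> (\<lambda>z. epowr (area_inv_grad \<gamma> q f z) p)
        \<le> (\<integral>\<^sup>+z. ennreal C1 * (A z * ennreal (defect z powr \<alpha>) * indicator unit_ball z) \<partial>lborel)"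
    proof (rule nn_integral_mono)
      fix z :: "complex ^ 'n"
      show "epowr (area_inv_grad \<gamma> q f z) p * ennreal (defect z powr \<alpha>) * indicator unit_ball z
          \<le> ennreal C1 * (A z * ennreal (defect z powr \<alpha>) * indicator unit_ball z)"
        using C1(2)[OF f, of z] unfolding A_def G_def
        by (cases "norm z < 1") (simp_all add: mult.assoc[symmetric] mult_right_mono)
    qed
    also have "\<dots> = ennreal C1 * weighted_integral \<alpha> (\<lambda>z. A z)"
      using m by (intro nn_integral_cmult) simp
    also have "\<dots> \<le> ennreal C1 * (ennreal C2 * weighted_integral \<alpha> (\<lambda>w. G w))"
      unfolding A_def by (intro mult_left_mono C2(2) mG) simp
    finally show "weighted_integral \<alpha> (\<lambda>z. epowr (area_inv_grad \<gamma> q f z) p)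
       \<le> ennreal (C1 * C2) * weighted_integral \<alpha> (\<lambda>z. ennreal (cmod (f z - f 0) powr p))"
      using C1(1) C2(1) by (simp add: G_def ennreal_mult mult.assoc)
  qed
qed

section \<open>Oscillation along rays\<close>

text \<open>
  The sub-mean-value inequality for the radial derivative with exponent \<open>q\<close>; a ball of radius \<open>\<gamma> / 2\<close>
  around \<open>w\<close> lies in \<open>D(z,\<gamma>)\<close>, and \<open>1 - |w|^2\<close> may be moved under the integral because it is
  comparable to \<open>1 - |y|^2\<close> for all \<open>y\<close> in that ball.
\<close>

lemma radial_deriv_le_area_R:
  fixes q \<gamma> :: real
  assumes q: "0 < q" and \<gamma>: "0 < \<gamma>"
  obtains C where "0 < C"
    "\<And>(f :: complex ^ 'n \<Rightarrow> complex) z w. f \<in> hol_ball \<Longrightarrow> norm z < 1 \<Longrightarrow> w \<in> berg_ball z (\<gamma> / 2) \<Longrightarrow>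
       ennreal (defect w * cmod (radial_deriv f w)) \<le> ennreal C * area_R \<gamma> q f z"
proof -
  obtain C0 where C0: "0 < C0"
    "\<And>(h :: complex ^ 'n \<Rightarrow> complex) a. line_hol unit_ball h \<Longrightarrow> norm a < 1 \<Longrightarrow>
       ennreal (cmod (h a) powr q)
       \<le> ennreal C0 * inv_integral (berg_ball a (\<gamma> / 2)) (\<lambda>w. ennreal (cmod (h w) powr q))"
    using sub_mean_value_berg_ball[where 'n = 'n, OF q half_gt_zero[OF \<gamma>]] by blast
  define M where "M = (4 * (cosh (\<gamma> / 2))\<^sup>2) powr q"
  have M: "0 < M" by (simp add: M_def)
  define V where "V = ball_volume TYPE('n)"
  have V: "0 < V" by (simp add: V_def)
  show thesis
  proof (rule that)
    show "0 < (C0 * M * V) powr (1 / q)" using C0(1) M V by simp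
    fix f :: "complex ^ 'n \<Rightarrow> complex" and z w :: "complex ^ 'n"
    assume f: "f \<in> hol_ball" and z: "norm z < 1" and w: "w \<in> berg_ball z (\<gamma> / 2)"
    have nw: "norm w < 1" using w by (simp add: berg_ball_def)
    have dw: "0 < defect w" using nw by (rule defect_pos)
    have sub: "berg_ball w (\<gamma> / 2) \<subseteq> berg_ball z \<gamma>"
      using berg_ball_trans[OF z w, of _ "\<gamma> / 2"] by auto
    define g where "g y = norm ((1 - (norm y)\<^sup>2) *\<^sub>R radial_deriv f y)" for y
    have g: "g y = defect y * cmod (radial_deriv f y)" if "norm y < 1" for y
      using defect_pos[OF that] by (simp add: g_def defect_def)
    define J where "J = inv_integral (berg_ball z \<gamma>) (\<lambda>y. ennreal (g y powr q))"
    have [measurable]: "g \<in> borel_measurable ball_borel" "radial_deriv f \<in> borel_measurable ball_borel"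
      unfolding g_def by (rule measurable_radial[OF f], rule line_hol_measurable[OF radial_deriv_line_hol[OF f]])
    have m: "(\<lambda>y. ennreal (g y powr q) * inv_weight y * indicator (berg_ball z \<gamma>) y) \<in> borel_measurable borel"
      by (rule measurable_on_subset_of_ball[OF _ sets_berg_ball[OF \<gamma> z] berg_ball_subset_unit_ball]) measurable
    have "ennreal (defect w powr q) * ennreal (cmod (radial_deriv f w) powr q)
        \<le> ennreal (defect w powr q) * (ennreal C0 * inv_integral (berg_ball w (\<gamma> / 2)) (\<lambda>y. ennreal (cmod (radial_deriv f y) powr q)))"
      by (intro mult_left_mono C0(2) radial_deriv_line_hol f nw) simp
    also have "\<dots> = ennreal C0 * (ennreal (defect w powr q) * inv_integral (berg_ball w (\<gamma> / 2)) (\<lambda>y. ennreal (cmod (radial_deriv f y) powr q)))"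
      by (simp add: mult_ac)
    also have "ennreal (defect w powr q) * inv_integral (berg_ball w (\<gamma> / 2)) (\<lambda>y. ennreal (cmod (radial_deriv f y) powr q))
        \<le> ennreal M * J"
    proof -
      have m2: "(\<lambda>y. ennreal (cmod (radial_deriv f y) powr q) * inv_weight y * indicator (berg_ball w (\<gamma> / 2)) y) \<in> borel_measurable borel"
        by (rule measurable_on_subset_of_ball[OF _ sets_berg_ball[OF half_gt_zero[OF \<gamma>] nw] berg_ball_subset_unit_ball]) measurable
      have "ennreal (defect w powr q) * inv_integral (berg_ball w (\<gamma> / 2)) (\<lambda>y. ennreal (cmod (radial_deriv f y) powr q))
          = (\<integral>\<^sup>+y. ennreal (defect w powr q) * (ennreal (cmod (radial_deriv f y) powr q) * inv_weight y * indicator (berg_ball w (\<gamma> / 2)) y) \<partial>lborel)"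
        using m2 by (intro nn_integral_cmult[symmetric]) simp
      also have "\<dots> \<le> (\<integral>\<^sup>+y. ennreal M * (ennreal (g y powr q) * inv_weight y * indicator (berg_ball z \<gamma>) y) \<partial>lborel)"
      proof (rule nn_integral_mono)
        fix y :: "complex ^ 'n"
        show "ennreal (defect w powr q) * (ennreal (cmod (radial_deriv f y) powr q) * inv_weight y * indicator (berg_ball w (\<gamma> / 2)) y)
           \<le> ennreal M * (ennreal (g y powr q) * inv_weight y * indicator (berg_ball z \<gamma>) y)"
        proof (cases "y \<in> berg_ball w (\<gamma> / 2)")
          case True
          then have ny: "norm y < 1" by (simp add: berg_ball_def)
          have "w \<in> berg_ball y (\<gamma> / 2)" using True berg_ball_commute[OF nw ny] by blast
          then have "defect w powr q \<le> M * defect y powr q"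
            using defect_powr_on_berg_ball[OF ny, of w "\<gamma> / 2" q] q by (simp add: M_def)
          then have "defect w powr q * cmod (radial_deriv f y) powr q \<le> M * defect y powr q * cmod (radial_deriv f y) powr q"
            by (intro mult_right_mono) auto
          also have "\<dots> = M * g y powr q"
            using defect_pos[OF ny] by (simp add: g[OF ny] powr_mult)
          finally have "ennreal (defect w powr q) * ennreal (cmod (radial_deriv f y) powr q) \<le> ennreal M * ennreal (g y powr q)"
            using M by (simp add: ennreal_mult[symmetric] ennreal_leI)
          then have "ennreal (defect w powr q) * ennreal (cmod (radial_deriv f y) powr q) * inv_weight y \<le> ennreal M * ennreal (g y powr q) * inv_weight y"
            by (rule mult_right_mono) simp
          moreover have "y \<in> berg_ball z \<gamma>" using sub True by blast
          ultimately show ?thesis using True by (simp only: indicator_simps mult_1_right mult.assoc)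
        qed simp
      qed
      also have "\<dots> = ennreal M * J"
        unfolding J_def using m by (intro nn_integral_cmult) simp
      finally show ?thesis .
    qed
    finally have "ennreal (defect w powr q) * ennreal (cmod (radial_deriv f w) powr q) \<le> ennreal C0 * (ennreal M * J)"
      by (simp add: mult_left_mono)
    also have "\<dots> = ennreal (C0 * M * V) * (ennreal (1 / V) * J)"
      using C0(1) M V by (simp add: mult.assoc[symmetric] ennreal_mult[symmetric])
    finally have "epowr (ennreal (defect w powr q) * ennreal (cmod (radial_deriv f w) powr q)) (1 / q)
        \<le> epowr (ennreal (C0 * M * V) * (ennreal (1 / V) * J)) (1 / q)"
      using q by (intro epowr_mono) auto
    also have "\<dots> = ennreal ((C0 * M * V) powr (1 / q)) * epowr (ennreal (1 / V) * J) (1 / q)"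
      using C0(1) M V by (intro epowr_cmult) simp
    also have "epowr (ennreal (1 / V) * J) (1 / q) = area_R \<gamma> q f z"
      unfolding area_R_def area_int_eq[OF measurable_radial[OF f] \<gamma> z] J_def g_def V_def ..
    also have "epowr (ennreal (defect w powr q) * ennreal (cmod (radial_deriv f w) powr q)) (1 / q)
        = ennreal (defect w * cmod (radial_deriv f w))"
    proof -
      have "((defect w * cmod (radial_deriv f w)) powr q) powr (1 / q) = defect w * cmod (radial_deriv f w)"
        using q dw by (simp add: powr_powr)
      moreover have "ennreal (defect w powr q) * ennreal (cmod (radial_deriv f w) powr q) = ennreal ((defect w * cmod (radial_deriv f w)) powr q)"
        using dw by (simp add: ennreal_mult[symmetric] powr_mult)
      ultimately show ?thesis by (simp add: epowr_ennreal)
    qed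
    finally show "ennreal (defect w * cmod (radial_deriv f w)) \<le> ennreal ((C0 * M * V) powr (1 / q)) * area_R \<gamma> q f z" .
  qed
qed

definition shell_radius :: "real \<Rightarrow> nat \<Rightarrow> real" where
  "shell_radius \<mu> k = 1 - \<mu> ^ k"

definition shell :: "real \<Rightarrow> nat \<Rightarrow> (complex ^ 'n) set" where
  "shell \<mu> k = {z. shell_radius \<mu> k \<le> norm z \<and> norm z < shell_radius \<mu> (Suc k)}"

lemma shell_radius_0 [simp]: "shell_radius \<mu> 0 = 0"
  by (simp add: shell_radius_def)

lemma shell_radius_mono:
  assumes "0 < \<mu>" "\<mu> < 1" "j \<le> k"
  shows "shell_radius \<mu> j \<le> shell_radius \<mu> k"
  using assms power_decreasing[of j k \<mu>] by (simp add: shell_radius_def)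

lemma shell_radius_bounds:
  assumes "0 < \<mu>" "\<mu> < 1"
  shows "0 \<le> shell_radius \<mu> k" "shell_radius \<mu> k < 1"
  using assms by (simp_all add: shell_radius_def power_le_one)

lemma fderiv_ray:
  assumes "f \<in> hol_ball" "norm \<zeta> = 1" "cmod s < 1"
  shows "s * fderiv f (s *s \<zeta>) \<zeta> = radial_deriv f (s *s \<zeta>)"
proof -
  have "norm (s *s \<zeta>) < 1" using assms by (simp add: norm_vector_scalar_mult)
  then show ?thesis
    using radial_deriv_eq_fderiv[OF assms(1)] hol_ball_fderiv(2)[OF assms(1)] by metis
qed

text \<open>
  On a ray the derivative of \<open>f\<close> is the radial derivative divided by \<open>u = |w|\<close>.  Within one shell the
  length of the ray is at most a constant times \<open>1 - |w|\<close>, so the increment of \<open>f\<close> is bounded by the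
  supremum of \<open>(1 - |w|^2) |Rf(w)|\<close>, and all points involved lie within distance \<open>\<gamma> / 2\<close> of \<open>r \<zeta>\<close>.
\<close>

lemma oscillation_le_area_R:
  fixes q \<gamma> :: real
  assumes q: "0 < q" and \<gamma>: "0 < \<gamma>"
  obtains \<mu> C where "0 < \<mu>" "\<mu> < 1" "0 < C"
    "\<And>(f :: complex ^ 'n \<Rightarrow> complex) k r s t \<zeta>. f \<in> hol_ball \<Longrightarrow> norm \<zeta> = 1 \<Longrightarrow>
       shell_radius \<mu> k \<le> r \<Longrightarrow> r \<le> shell_radius \<mu> (Suc k) \<Longrightarrow>
       shell_radius \<mu> k \<le> s \<Longrightarrow> s \<le> shell_radius \<mu> (Suc k) \<Longrightarrow>
       shell_radius \<mu> k \<le> t \<Longrightarrow> t \<le> shell_radius \<mu> (Suc k) \<Longrightarrow>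
       ennreal (cmod (f (s *\<^sub>R \<zeta>) - f (t *\<^sub>R \<zeta>))) \<le> ennreal C * area_R \<gamma> q f (r *\<^sub>R \<zeta>)"
proof -
  obtain C1 where C1: "0 < C1"
    "\<And>(f :: complex ^ 'n \<Rightarrow> complex) z w. f \<in> hol_ball \<Longrightarrow> norm z < 1 \<Longrightarrow> w \<in> berg_ball z (\<gamma> / 2) \<Longrightarrow>
       ennreal (defect w * cmod (radial_deriv f w)) \<le> ennreal C1 * area_R \<gamma> q f z"
    using radial_deriv_le_area_R[where 'n = 'n, OF assms] by blast
  \<comment> \<open>two steps of length eta must remain below gamma / 2\<close>
  define \<eta> where "\<eta> = \<gamma> / 5"
  have \<eta>: "0 < \<eta>" "\<eta> + \<eta> < \<gamma> / 2" using \<gamma> by (simp_all add: \<eta>_def)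
  \<comment> \<open>chosen so that two points of a ray in the same shell have distance at most eta\<close>
  define \<mu> where "\<mu> = 1 / (1 + sinh \<eta>)"
  have sh: "0 < sinh \<eta>" using \<eta> by simp
  have sh1: "1 < 1 + sinh \<eta>" using sh by linarith
  then have \<mu>: "0 < \<mu>" "\<mu> < 1" unfolding \<mu>_def
    by (simp_all add: divide_less_eq del: sinh_real_pos_iff less_add_same_cancel1)
  have \<mu>': "1 - \<mu> = sinh \<eta> * \<mu>" 
  proof -
    have "1 - 1 / x = (x - 1) * (1 / x)" if "1 < x" for x :: real using that by (simp add: field_simps)
    from this[OF sh1] show ?thesis by (simp add: \<mu>_def)
  qed
  note sr = shell_radius_bounds[OF \<mu>]
  have ray: "berg_dist (s *\<^sub>R \<zeta>) (t *\<^sub>R \<zeta>) \<le> \<eta>"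
    if \<zeta>: "norm \<zeta> = 1" and st: "shell_radius \<mu> k \<le> s" "s \<le> shell_radius \<mu> (Suc k)"
      "shell_radius \<mu> k \<le> t" "t \<le> shell_radius \<mu> (Suc k)" for \<zeta> :: "complex ^ 'n" and s t k
  proof (rule berg_dist_same_ray_le[OF \<zeta>])
    have s: "0 \<le> s" "s < 1" and t: "0 \<le> t" "t < 1" using sr[of k] sr[of "Suc k"] st by linarith+
    then show "0 \<le> s" "s < 1" "0 \<le> t" "t < 1" .
    show "0 \<le> \<eta>" using \<eta> by simp
    define m where "m = \<mu> ^ Suc k"
    have m: "0 < m" using \<mu> by (simp add: m_def)
    have "m \<le> 1 - s" "m \<le> 1 - t" using st by (simp_all add: shell_radius_def m_def)
    moreover have "1 - s \<le> 1 - s\<^sup>2" "1 - t \<le> 1 - t\<^sup>2"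
      using s t by (simp_all add: power2_eq_square mult_left_le)
    ultimately have mm: "m * m \<le> (1 - s\<^sup>2) * (1 - t\<^sup>2)" using m by (intro mult_mono) linarith+
    have "\<bar>s - t\<bar> \<le> shell_radius \<mu> (Suc k) - shell_radius \<mu> k" using st by linarith
    also have "\<dots> = \<mu> ^ k * (1 - \<mu>)" by (simp add: shell_radius_def algebra_simps)
    also have "\<dots> = sinh \<eta> * m" unfolding \<mu>' by (simp add: m_def)
    finally have "\<bar>s - t\<bar>\<^sup>2 \<le> (sinh \<eta> * m)\<^sup>2" by (intro power_mono) auto
    also have "\<dots> = (sinh \<eta>)\<^sup>2 * (m * m)" by (simp add: power2_eq_square)
    also have "\<dots> \<le> (sinh \<eta>)\<^sup>2 * ((1 - s\<^sup>2) * (1 - t\<^sup>2))" using mm by (intro mult_left_mono) auto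
    finally show "(s - t)\<^sup>2 \<le> (sinh \<eta>)\<^sup>2 * ((1 - s\<^sup>2) * (1 - t\<^sup>2))" by simp
  qed
  have r1: "shell_radius \<mu> (Suc 0) = 1 - \<mu>" by (simp add: shell_radius_def)
  have centre: "berg_dist 0 w \<le> \<eta>" if w: "norm w \<le> 1 - \<mu>" for w :: "complex ^ 'n"
  proof (cases "w = 0")
    case True
    then show ?thesis using \<eta> by (simp add: berg_dist_def ball_aut_def line_proj_def)
  next
    case False
    then have "berg_dist (0 *\<^sub>R ((1 / norm w) *\<^sub>R w)) (norm w *\<^sub>R ((1 / norm w) *\<^sub>R w)) \<le> \<eta>"
      using w \<mu> by (intro ray[of _ 0]) (auto simp: r1)
    then show ?thesis using False by simp
  qed
  show thesis
  proof (rule that[OF \<mu>])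
    show "0 < C1 / \<mu>" using C1(1) \<mu> by simp
    fix f :: "complex ^ 'n \<Rightarrow> complex" and k r s t and \<zeta> :: "complex ^ 'n"
    assume f: "f \<in> hol_ball" and \<zeta>: "norm \<zeta> = 1"
      and r: "shell_radius \<mu> k \<le> r" "r \<le> shell_radius \<mu> (Suc k)"
      and s: "shell_radius \<mu> k \<le> s" "s \<le> shell_radius \<mu> (Suc k)"
      and t: "shell_radius \<mu> k \<le> t" "t \<le> shell_radius \<mu> (Suc k)"
    have r01: "0 \<le> r" "r < 1" using sr[of k] sr[of "Suc k"] r by linarith+
    have nz: "norm (r *\<^sub>R \<zeta>) < 1" using r01 \<zeta> by simp
    show "ennreal (cmod (f (s *\<^sub>R \<zeta>) - f (t *\<^sub>R \<zeta>))) \<le> ennreal (C1 / \<mu>) * area_R \<gamma> q f (r *\<^sub>R \<zeta>)"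
    proof (cases "area_R \<gamma> q f (r *\<^sub>R \<zeta>) = top")
      case True
      then show ?thesis using C1(1) \<mu> by (simp add: ennreal_mult_top)
    next
      case False
      then obtain A where A: "area_R \<gamma> q f (r *\<^sub>R \<zeta>) = ennreal A" "0 \<le> A"
        by (cases "area_R \<gamma> q f (r *\<^sub>R \<zeta>)") auto
      have R: "defect w * cmod (radial_deriv f w) \<le> C1 * A" if "norm w < 1" "berg_dist (r *\<^sub>R \<zeta>) w \<le> \<eta> + \<eta>" for w
      proof -
        have "w \<in> berg_ball (r *\<^sub>R \<zeta>) (\<gamma> / 2)" using that \<eta> by (simp add: berg_ball_def)
        from C1(2)[OF f nz this] show ?thesis
          using C1(1) A defect_pos[OF that(1)] by (simp add: ennreal_mult[symmetric] ennreal_le_iff)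
      qed
      define B where "B = C1 * A / (\<mu> ^ Suc k * (1 - \<mu>))"
      have R': "cmod (fderiv f (u *s \<zeta>) \<zeta>) \<le> B"
        if u: "1 - \<mu> \<le> cmod u" "cmod u \<le> shell_radius \<mu> (Suc k)" "berg_dist (r *\<^sub>R \<zeta>) (u *s \<zeta>) \<le> \<eta> + \<eta>" for u
      proof -
        have u1: "cmod u < 1" using u(2) sr[of "Suc k"] by linarith
        have n: "norm (u *s \<zeta>) = cmod u" using \<zeta> by (simp add: norm_vector_scalar_mult)
        have "\<mu> ^ Suc k \<le> 1 - cmod u" using u(2) by (simp add: shell_radius_def)
        also have "\<dots> \<le> 1 - (cmod u)\<^sup>2" using u1 by (simp add: power2_eq_square mult_left_le)
        also have "\<dots> = defect (u *s \<zeta>)" by (simp add: defect_def n)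
        finally have d: "\<mu> ^ Suc k \<le> defect (u *s \<zeta>)" .
        have "\<mu> ^ Suc k * (1 - \<mu>) * cmod (fderiv f (u *s \<zeta>) \<zeta>) \<le> defect (u *s \<zeta>) * cmod u * cmod (fderiv f (u *s \<zeta>) \<zeta>)"
          using d u(1) \<mu> defect_pos[of "u *s \<zeta>"] n u1 by (intro mult_right_mono mult_mono) auto
        also have "\<dots> = defect (u *s \<zeta>) * cmod (radial_deriv f (u *s \<zeta>))"
          using fderiv_ray[OF f \<zeta> u1] by (metis mult.assoc norm_mult)
        also have "\<dots> \<le> C1 * A" using n u1 u(3) by (intro R) auto
        finally show ?thesis using \<mu> by (simp add: B_def field_simps)
      qed
      have der: "((\<lambda>u. f (u *s \<zeta>)) has_field_derivative fderiv f (u *s \<zeta>) \<zeta>) (at u)" if "cmod u < 1" for u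
        using hol_ball_slice_derivative[OF f, of 0 u \<zeta>] that \<zeta> by (simp add: norm_vector_scalar_mult)
      have bound: "cmod (fderiv f (of_real u *s \<zeta>) \<zeta>) \<le> B"
        if u: "shell_radius \<mu> k \<le> u" "u \<le> shell_radius \<mu> (Suc k)" for u
      proof (cases k)
        case (Suc k')
        have u0: "1 - \<mu> \<le> u"
          using shell_radius_mono[OF \<mu>, of "Suc 0" k] u(1) by (simp add: Suc r1)
        show ?thesis
        proof (rule R')
          have "berg_dist (r *\<^sub>R \<zeta>) (u *\<^sub>R \<zeta>) \<le> \<eta>" using ray[OF \<zeta> r u] .
          then show "berg_dist (r *\<^sub>R \<zeta>) (of_real u *s \<zeta>) \<le> \<eta> + \<eta>"
            using \<eta> by (simp add: scaleR_eq_vector_scalar_mult)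
          show "1 - \<mu> \<le> cmod (of_real u)" "cmod (of_real u) \<le> shell_radius \<mu> (Suc k)"
            using u0 u(2) \<mu> by simp_all
        qed
      next
        case 0
        \<comment> \<open>division by u is harmless on the circle of radius 1 - mu; the maximum principle moves the bound inside\<close>
        define \<psi> where "\<psi> = deriv (\<lambda>u. f (u *s \<zeta>))"
        have \<psi>: "\<psi> u = fderiv f (u *s \<zeta>) \<zeta>" if "cmod u < 1" for u
          unfolding \<psi>_def by (rule DERIV_imp_deriv[OF der[OF that]])
        have "(\<lambda>u. f (u *s \<zeta>)) holomorphic_on ball 0 1"
          unfolding holomorphic_on_open[OF open_ball]
        proof
          fix u :: complex assume "u \<in> ball 0 1"
          then have "cmod u < 1" by simp
          from der[OF this] show "\<exists>f'. ((\<lambda>u. f (u *s \<zeta>)) has_field_derivative f') (at u)" ..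
        qed
        then have hol: "\<psi> holomorphic_on ball 0 1"
          unfolding \<psi>_def by (intro holomorphic_deriv) auto
        have sub: "cball 0 (1 - \<mu>) \<subseteq> ball (0::complex) 1" using \<mu> by auto
        have "cmod (\<psi> (of_real u)) \<le> B"
        proof (rule maximum_modulus_frontier[of \<psi> "cball 0 (1 - \<mu>)"])
          show "\<psi> holomorphic_on interior (cball 0 (1 - \<mu>))"
            using hol by (rule holomorphic_on_subset) (use \<mu> in auto)
          show "continuous_on (closure (cball 0 (1 - \<mu>))) \<psi>"
            using holomorphic_on_imp_continuous_on[OF hol] sub by (auto intro: continuous_on_subset)
          show "complex_of_real u \<in> cball 0 (1 - \<mu>)" using u by (simp add: 0 r1)
          fix v :: complex assume "v \<in> frontier (cball 0 (1 - \<mu>))"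
          then have v: "cmod v = 1 - \<mu>" using \<mu> by (simp add: frontier_cball)
          have nv: "norm (v *s \<zeta>) = 1 - \<mu>" using \<zeta> by (simp add: norm_vector_scalar_mult v)
          have "berg_dist (r *\<^sub>R \<zeta>) (v *s \<zeta>) \<le> berg_dist (r *\<^sub>R \<zeta>) 0 + berg_dist 0 (v *s \<zeta>)"
            using nz nv \<mu> by (intro berg_dist_triangle) auto
          also have "berg_dist (r *\<^sub>R \<zeta>) 0 = berg_dist 0 (r *\<^sub>R \<zeta>)" using nz by (intro berg_dist_commute) auto
          also have "berg_dist 0 (r *\<^sub>R \<zeta>) + berg_dist 0 (v *s \<zeta>) \<le> \<eta> + \<eta>"
            using nv r01 r \<zeta> by (intro add_mono centre) (auto simp: 0 r1)
          finally have "cmod (fderiv f (v *s \<zeta>) \<zeta>) \<le> B"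
            using v by (intro R') (auto simp: 0 r1)
          then show "cmod (\<psi> v) \<le> B" using v \<mu> by (simp add: \<psi>)
        qed auto
        moreover have "cmod (of_real u) < 1" using u \<mu> by (simp add: 0 r1)
        ultimately show ?thesis by (simp add: \<psi>)
      qed
      have "cmod (f (of_real s *s \<zeta>) - f (of_real t *s \<zeta>)) \<le> B * cmod (complex_of_real s - complex_of_real t)"
      proof (rule field_differentiable_bound[of "of_real ` {shell_radius \<mu> k..shell_radius \<mu> (Suc k)}"])
        show "convex (complex_of_real ` {shell_radius \<mu> k..shell_radius \<mu> (Suc k)})"
          by (intro convex_linear_image) (auto simp: linear_of_real)
        fix u assume "u \<in> complex_of_real ` {shell_radius \<mu> k..shell_radius \<mu> (Suc k)}"
        then obtain u' where u': "u = of_real u'" "shell_radius \<mu> k \<le> u'" "u' \<le> shell_radius \<mu> (Suc k)"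
          unfolding image_iff Bex_def atLeastAtMost_iff by blast
        show "cmod (fderiv f (u *s \<zeta>) \<zeta>) \<le> B" unfolding u'(1) by (rule bound[OF u'(2,3)])
        have "0 \<le> u'" "u' < 1" using u' sr[of k] sr[of "Suc k"] by linarith+
        then have "cmod u < 1" unfolding u'(1) norm_of_real by simp
        then show "((\<lambda>u. f (u *s \<zeta>)) has_field_derivative fderiv f (u *s \<zeta>) \<zeta>) (at u within of_real ` {shell_radius \<mu> k..shell_radius \<mu> (Suc k)})"
          by (rule has_field_derivative_at_within[OF der])
      qed (use s t in auto)
      also have "cmod (complex_of_real s - complex_of_real t) = \<bar>s - t\<bar>"
        by (simp only: of_real_diff[symmetric] norm_of_real)
      also have "B * \<bar>s - t\<bar> \<le> B * (\<mu> ^ k * (1 - \<mu>))"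
      proof (rule mult_left_mono)
        have "\<bar>s - t\<bar> \<le> shell_radius \<mu> (Suc k) - shell_radius \<mu> k" using s t by linarith
        then show "\<bar>s - t\<bar> \<le> \<mu> ^ k * (1 - \<mu>)" by (simp add: shell_radius_def algebra_simps)
        show "0 \<le> B" using C1(1) A \<mu> by (simp add: B_def)
      qed
      also have "\<dots> = C1 / \<mu> * A"
        using \<mu> by (simp add: B_def field_simps)
      finally show ?thesis
        using A C1(1) \<mu> by (simp add: scaleR_eq_vector_scalar_mult ennreal_mult[symmetric] ennreal_leI)
    qed
  qed
qed

section \<open>Integration over geometric shells\<close>

text \<open>
  Each term is at most \<open>\<rho>^(k-j)\<close> times the \<open>p\<close>-th root of the weighted sum, with \<open>\<rho> = \<theta>^(1/p)\<close>; summing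
  the geometric series gives the bound, for \<open>p\<close> below and above 1 alike.
\<close>

lemma sum_powr_le_weighted_sum:
  fixes p \<theta> :: real
  assumes p: "0 < p" and \<theta>: "0 < \<theta>" "\<theta> < 1"
  obtains K where "0 < K" "\<And>k (x :: nat \<Rightarrow> real). (\<And>j. j \<le> k \<Longrightarrow> 0 \<le> x j) \<Longrightarrow>
     (\<Sum>j\<le>k. x j) powr p \<le> K * (\<Sum>j\<le>k. (1 / \<theta>) ^ (k - j) * x j powr p)"
proof -
  define \<rho> where "\<rho> = \<theta> powr (1 / p)"
  have \<rho>: "0 < \<rho>" "\<rho> < 1"
    using \<theta> p by (simp_all add: \<rho>_def powr01_less_one)
  show thesis
  proof (rule that)
    show "0 < (1 / (1 - \<rho>)) powr p" using \<rho> by simp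
    fix k and x :: "nat \<Rightarrow> real" assume x: "\<And>j. j \<le> k \<Longrightarrow> 0 \<le> x j"
    define Y where "Y = (\<Sum>j\<le>k. (1 / \<theta>) ^ (k - j) * x j powr p)"
    have Y0: "0 \<le> Y" unfolding Y_def using \<theta> by (intro sum_nonneg) auto
    have xj: "x j \<le> Y powr (1 / p) * \<rho> ^ (k - j)" if j: "j \<le> k" for j
    proof -
      have "(1 / \<theta>) ^ (k - j) * x j powr p \<le> Y"
        unfolding Y_def using j \<theta> by (intro member_le_sum[of j]) auto
      then have "x j powr p \<le> Y * \<theta> ^ (k - j)"
        using \<theta> by (simp add: power_divide field_simps)
      then have "(x j powr p) powr (1 / p) \<le> (Y * \<theta> ^ (k - j)) powr (1 / p)"
        using p by (intro powr_mono2) auto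
      also have "\<dots> = Y powr (1 / p) * (\<theta> ^ (k - j)) powr (1 / p)"
        using Y0 \<theta> by (simp add: powr_mult)
      also have "(\<theta> ^ (k - j)) powr (1 / p) = \<rho> ^ (k - j)"
        using \<theta> by (simp add: \<rho>_def powr_realpow[symmetric] powr_powr mult.commute)
      finally show ?thesis using p x[OF j] by (simp add: powr_powr)
    qed
    have "(\<Sum>j\<le>k. x j) \<le> (\<Sum>j\<le>k. Y powr (1 / p) * \<rho> ^ (k - j))"
      by (intro sum_mono xj) simp
    also have "\<dots> = Y powr (1 / p) * (\<Sum>j\<le>k. \<rho> ^ (k - j))" by (simp add: sum_distrib_left)
    also have "(\<Sum>j\<le>k. \<rho> ^ (k - j)) = (\<Sum>j<Suc k. \<rho> ^ j)"
      using sum.nat_diff_reindex[of "\<lambda>j. \<rho> ^ j" "Suc k"] by (simp add: lessThan_Suc_atMost)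
    also have "\<dots> = (1 - \<rho> ^ Suc k) / (1 - \<rho>)"
      unfolding sum_gp_strict using \<rho> by simp
    also have "\<dots> \<le> 1 / (1 - \<rho>)"
      using \<rho> by (intro divide_right_mono) auto
    finally have "(\<Sum>j\<le>k. x j) \<le> Y powr (1 / p) * (1 / (1 - \<rho>))"
      by (simp add: mult_left_mono)
    then have "(\<Sum>j\<le>k. x j) powr p \<le> (Y powr (1 / p) * (1 / (1 - \<rho>))) powr p"
      using p x by (intro powr_mono2 sum_nonneg) auto
    also have "\<dots> = (1 / (1 - \<rho>)) powr p * Y"
      using \<rho> p Y0 by (simp add: powr_mult powr_divide powr_powr)
    finally show "(\<Sum>j\<le>k. x j) powr p \<le> (1 / (1 - \<rho>)) powr p * (\<Sum>j\<le>k. (1 / \<theta>) ^ (k - j) * x j powr p)"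
      by (simp only: Y_def)
  qed
qed

text \<open>
  Young's inequality for convolution with a geometric sequence.
\<close>

lemma suminf_geometric_convolution_le:
  fixes X Y :: "nat \<Rightarrow> ennreal" and \<theta> :: real
  assumes \<theta>: "0 < \<theta>" "\<theta> < 1" and X: "\<And>k. X k \<le> (\<Sum>j\<le>k. ennreal (\<theta> ^ (k - j)) * Y j)"
  shows "(\<Sum>k. X k) \<le> ennreal (1 / (1 - \<theta>)) * (\<Sum>j. Y j)"
proof -
  define c where "c m = (\<Sum>i<m. \<theta> ^ i)" for m
  have c0: "0 \<le> c m" for m unfolding c_def using \<theta> by (intro sum_nonneg) auto
  have cle: "c m \<le> 1 / (1 - \<theta>)" for m
    unfolding c_def using \<theta> by (simp add: sum_gp_strict divide_right_mono)
  have partial: "(\<Sum>k<n. X k) \<le> (\<Sum>j<n. ennreal (c (n - j)) * Y j)" for n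
  proof (induction n)
    case (Suc n)
    have "(\<Sum>k<Suc n. X k) \<le> (\<Sum>j<n. ennreal (c (n - j)) * Y j) + (\<Sum>j\<le>n. ennreal (\<theta> ^ (n - j)) * Y j)"
      using Suc.IH X[of n] by (simp add: add_mono)
    also have "(\<Sum>j<n. ennreal (c (n - j)) * Y j) = (\<Sum>j\<le>n. ennreal (c (n - j)) * Y j)"
      by (simp add: lessThan_Suc_atMost[symmetric] c_def)
    also have "\<dots> + (\<Sum>j\<le>n. ennreal (\<theta> ^ (n - j)) * Y j) = (\<Sum>j\<le>n. ennreal (c (n - j) + \<theta> ^ (n - j)) * Y j)"
      using c0 \<theta> by (simp add: sum.distrib[symmetric] distrib_right[symmetric])
    also have "\<dots> = (\<Sum>j<Suc n. ennreal (c (Suc n - j)) * Y j)"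
      unfolding lessThan_Suc_atMost by (intro sum.cong) (auto simp: c_def Suc_diff_le)
    finally show ?case .
  qed simp
  have "(\<Sum>k<n. X k) \<le> ennreal (1 / (1 - \<theta>)) * (\<Sum>j. Y j)" for n
  proof -
    have "(\<Sum>j<n. ennreal (c (n - j)) * Y j) \<le> (\<Sum>j<n. ennreal (1 / (1 - \<theta>)) * Y j)"
      by (intro sum_mono mult_right_mono ennreal_leI cle) simp
    also have "\<dots> = ennreal (1 / (1 - \<theta>)) * (\<Sum>j<n. Y j)" by (simp add: sum_distrib_left)
    also have "\<dots> \<le> ennreal (1 / (1 - \<theta>)) * (\<Sum>j. Y j)"
      by (intro mult_left_mono sum_le_suminf) auto
    finally show ?thesis using partial[of n] by order
  qed
  then show ?thesis by (intro suminf_le_const) auto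
qed

lemma sets_shell [measurable]: "shell \<mu> k \<in> sets borel"
  unfolding shell_def by measurable

lemma shell_subset_unit_ball:
  assumes "0 < \<mu>" "\<mu> < 1"
  shows "shell \<mu> k \<subseteq> unit_ball"
  using shell_radius_bounds[OF assms, of "Suc k"] by (auto simp: shell_def)

lemma disjoint_shells:
  assumes \<mu>: "0 < \<mu>" "\<mu> < 1"
  shows "disjoint_family (shell \<mu> :: nat \<Rightarrow> (complex ^ 'n) set)"
proof -
  have "shell \<mu> j \<inter> shell \<mu> k = ({} :: (complex ^ 'n) set)" if "j < k" for j k
    using shell_radius_mono[OF \<mu>, of "Suc j" k] that by (auto simp: shell_def)
  then show ?thesis
    unfolding disjoint_family_on_def by (metis inf_commute linorder_neqE_nat)
qed

lemma Union_shells: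
  assumes \<mu>: "0 < \<mu>" "\<mu> < 1"
  shows "(\<Union>k. shell \<mu> k) = (unit_ball :: (complex ^ 'n) set)"
proof
  show "(\<Union>k. shell \<mu> k) \<subseteq> (unit_ball :: (complex ^ 'n) set)"
    using shell_subset_unit_ball[OF \<mu>] by auto
  show "(unit_ball :: (complex ^ 'n) set) \<subseteq> (\<Union>k. shell \<mu> k)"
  proof
    fix z :: "complex ^ 'n" assume "z \<in> unit_ball"
    then obtain n where "\<mu> ^ n < 1 - norm z"
      using real_arch_pow_inv[of "1 - norm z" \<mu>] \<mu> by auto
    then have ex: "\<exists>n. norm z < shell_radius \<mu> n"
      by (intro exI[of _ n]) (simp add: shell_radius_def)
    define k where "k = (LEAST n. norm z < shell_radius \<mu> n)"
    have k: "norm z < shell_radius \<mu> k" unfolding k_def by (rule LeastI_ex[OF ex])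
    then have "k \<noteq> 0" by (intro notI) simp
    then obtain j where j: "k = Suc j" by (cases k) auto
    have "\<not> norm z < shell_radius \<mu> j" using not_less_Least[of j "\<lambda>n. norm z < shell_radius \<mu> n"] by (simp add: k_def[symmetric] j)
    then have "z \<in> shell \<mu> j" using k by (simp add: shell_def j)
    then show "z \<in> (\<Union>k. shell \<mu> k)" by blast
  qed
qed

lemma nn_integral_shells:
  fixes F :: "complex ^ 'n \<Rightarrow> ennreal"
  assumes \<mu>: "0 < \<mu>" "\<mu> < 1" and F: "F \<in> borel_measurable ball_borel"
  shows "(\<integral>\<^sup>+z\<in>unit_ball. F z \<partial>lborel) = (\<Sum>k. \<integral>\<^sup>+z\<in>shell \<mu> k. F z \<partial>lborel)"
proof -
  define F' where "F' z = F z * indicator unit_ball z" for z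
  have [measurable]: "F' \<in> borel_measurable borel" using F unfolding F'_def ball_borel_iff .
  define \<nu> where "\<nu> = density lborel F'"
  have \<nu>: "emeasure \<nu> S = (\<integral>\<^sup>+z\<in>S. F z \<partial>lborel)" if "S \<in> sets borel" "S \<subseteq> unit_ball" for S
  proof -
    have "emeasure \<nu> S = (\<integral>\<^sup>+z. F' z * indicator S z \<partial>lborel)"
      unfolding \<nu>_def using that by (intro emeasure_density) auto
    also have "\<dots> = (\<integral>\<^sup>+z\<in>S. F z \<partial>lborel)"
      using that(2) by (intro nn_integral_cong) (auto simp: F'_def indicator_def)
    finally show ?thesis .
  qed
  have "(\<Sum>k. \<integral>\<^sup>+z\<in>shell \<mu> k. F z \<partial>lborel) = (\<Sum>k. emeasure \<nu> (shell \<mu> k))"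
    using \<nu>[OF sets_shell shell_subset_unit_ball[OF \<mu>]] by simp
  also have "\<dots> = emeasure \<nu> (\<Union>k. shell \<mu> k)"
    by (rule suminf_emeasure[OF _ disjoint_shells[OF \<mu>]]) (auto simp: \<nu>_def)
  also have "\<dots> = (\<integral>\<^sup>+z\<in>unit_ball. F z \<partial>lborel)"
    unfolding Union_shells[OF \<mu>] by (rule \<nu>) auto
  finally show ?thesis by simp
qed

definition shell_volume :: "nat \<Rightarrow> real \<Rightarrow> nat \<Rightarrow> real" where
  "shell_volume N \<mu> k = shell_radius \<mu> (Suc k) ^ N - shell_radius \<mu> k ^ N"

text \<open>
  By scaling, the integral of a function that depends only on the direction over the ball of radius \<open>b\<close>
  is \<open>b^(2n)\<close> times its integral over the unit ball.  Finiteness permits subtracting two such balls.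
\<close>

lemma nn_integral_shell_homogeneous:
  fixes G :: "complex ^ 'n \<Rightarrow> ennreal"
  assumes \<mu>: "0 < \<mu>" "\<mu> < 1" and G [measurable]: "G \<in> borel_measurable borel"
    and hom: "\<And>c z. 0 < c \<Longrightarrow> G (c *\<^sub>R z) = G z"
    and fin: "(\<integral>\<^sup>+z\<in>unit_ball. G z \<partial>lborel) < top"
  shows "(\<integral>\<^sup>+z\<in>shell \<mu> k. G z \<partial>lborel)
       = ennreal (shell_volume (2 * CARD('n)) \<mu> k) * (\<integral>\<^sup>+z\<in>unit_ball. G z \<partial>lborel)"
proof -
  define N where "N = 2 * CARD('n)"
  have [measurable]: "ball (0 :: complex ^ 'n) r \<in> sets borel" for r by simp
  obtain I where I: "(\<integral>\<^sup>+z\<in>unit_ball. G z \<partial>lborel) = ennreal I" "0 \<le> I"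
    using fin by (cases "\<integral>\<^sup>+z\<in>unit_ball. G z \<partial>lborel") auto
  have J: "(\<integral>\<^sup>+z\<in>ball 0 b. G z \<partial>lborel) = ennreal (b ^ N * I)" if "0 \<le> b" for b
  proof (cases "b = 0")
    case True
    then show ?thesis by (simp add: N_def zero_power)
  next
    case False
    then have b: "0 < b" using that by simp
    have m: "(\<lambda>z. G z * indicator (ball 0 b) z) \<in> borel_measurable borel" by measurable
    have "(\<integral>\<^sup>+z. G z * indicator (ball 0 b) z \<partial>lborel)
        = ennreal (b ^ N) * (\<integral>\<^sup>+z. G (b *\<^sub>R z) * indicator (ball 0 b) (b *\<^sub>R z) \<partial>lborel)"
      using nn_integral_lborel_scale[OF m, of b] b
      by (simp add: N_def mult.commute[of 2])
    also have "(\<integral>\<^sup>+z. G (b *\<^sub>R z) * indicator (ball 0 b) (b *\<^sub>R z) \<partial>lborel) = (\<integral>\<^sup>+z\<in>unit_ball. G z \<partial>lborel)"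
      using b by (intro nn_integral_cong) (simp add: hom indicator_def)
    finally show ?thesis using I b by (simp add: ennreal_mult)
  qed
  define a b where "a = shell_radius \<mu> k" and "b = shell_radius \<mu> (Suc k)"
  have ab: "0 \<le> a" "a \<le> b" using shell_radius_bounds[OF \<mu>, of k] shell_radius_mono[OF \<mu>, of k "Suc k"]
    by (simp_all add: a_def b_def)
  have "(\<integral>\<^sup>+z\<in>ball 0 b. G z \<partial>lborel) = (\<integral>\<^sup>+z. G z * indicator (ball 0 a) z + G z * indicator (shell \<mu> k) z \<partial>lborel)"
    using ab by (intro nn_integral_cong) (auto simp: indicator_def shell_def a_def[symmetric] b_def[symmetric])
  also have "\<dots> = (\<integral>\<^sup>+z\<in>ball 0 a. G z \<partial>lborel) + (\<integral>\<^sup>+z\<in>shell \<mu> k. G z \<partial>lborel)"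
    by (rule nn_integral_add) measurable
  finally have *: "ennreal (b ^ N * I) = ennreal (a ^ N * I) + (\<integral>\<^sup>+z\<in>shell \<mu> k. G z \<partial>lborel)"
    using ab by (simp add: J)
  have "(\<integral>\<^sup>+z\<in>shell \<mu> k. G z \<partial>lborel) = ennreal (b ^ N * I) - ennreal (a ^ N * I)"
    unfolding * by simp
  also have "\<dots> = ennreal ((b ^ N - a ^ N) * I)"
    using ab I by (simp add: ennreal_minus left_diff_distrib)
  also have "\<dots> = ennreal (b ^ N - a ^ N) * ennreal I"
    using ab I power_mono[of a b N] by (intro ennreal_mult) auto
  finally show ?thesis by (simp add: I a_def b_def N_def shell_volume_def)
qed

lemma shell_volume_le:
  assumes "0 < \<mu>" "\<mu> < 1"
  shows "shell_volume N \<mu> k \<le> real N * (1 - \<mu>) * \<mu> ^ k"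
proof -
  have gen: "b ^ N - a ^ N \<le> real N * (b - a)" if "0 \<le> a" "a \<le> b" "b \<le> 1" for a b :: real
  proof (induction N)
    case (Suc N)
    have "b ^ Suc N - a ^ Suc N = b ^ N * (b - a) + a * (b ^ N - a ^ N)" by (simp add: algebra_simps)
    also have "\<dots> \<le> 1 * (b - a) + 1 * (b ^ N - a ^ N)"
      using that power_mono[of a b N] by (intro add_mono mult_right_mono) (auto simp: power_le_one)
    also have "\<dots> \<le> real (Suc N) * (b - a)" using Suc.IH by (simp add: algebra_simps)
    finally show ?case .
  qed simp
  have "shell_volume N \<mu> k \<le> real N * (shell_radius \<mu> (Suc k) - shell_radius \<mu> k)"
    unfolding shell_volume_def
    using shell_radius_bounds[OF assms] shell_radius_mono[OF assms, of k "Suc k"] by (intro gen) (auto intro: less_imp_le)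
  then show ?thesis by (simp add: shell_radius_def algebra_simps)
qed

lemma shell_volume_ge:
  assumes \<mu>: "0 < \<mu>" "\<mu> < 1" and N: "0 < N"
  shows "(1 - \<mu>) ^ N * \<mu> ^ k \<le> shell_volume N \<mu> k"
proof -
  obtain N' where N': "N = Suc N'" using N by (cases N) auto
  define a b where "a = shell_radius \<mu> k" and "b = shell_radius \<mu> (Suc k)"
  have ab: "0 \<le> a" "a \<le> b" using shell_radius_bounds[OF \<mu>, of k] shell_radius_mono[OF \<mu>, of k "Suc k"]
    by (simp_all add: a_def b_def)
  have b: "1 - \<mu> \<le> b" using shell_radius_mono[OF \<mu>, of "Suc 0" "Suc k"] by (simp add: b_def shell_radius_def)
  have "(1 - \<mu>) ^ N * \<mu> ^ k = (1 - \<mu>) ^ N' * (b - a)"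
    by (simp add: N' a_def b_def shell_radius_def algebra_simps)
  also have "\<dots> \<le> b ^ N' * (b - a)"
    using \<mu> b ab by (intro mult_right_mono power_mono) auto
  also have "\<dots> = b ^ N - a * b ^ N'" by (simp add: N' algebra_simps)
  also have "\<dots> \<le> b ^ N - a * a ^ N'" using ab by (intro diff_left_mono mult_left_mono power_mono) auto
  finally show ?thesis by (simp add: N' a_def b_def shell_volume_def)
qed

lemma defect_on_shell:
  assumes \<mu>: "0 < \<mu>" "\<mu> < 1" and z: "z \<in> shell \<mu> k"
  shows "defect z powr \<alpha> \<le> (2 / \<mu>) powr \<bar>\<alpha>\<bar> * (\<mu> ^ k) powr \<alpha>"
    and "(\<mu> ^ k) powr \<alpha> \<le> (2 / \<mu>) powr \<bar>\<alpha>\<bar> * defect z powr \<alpha>"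
proof -
  have nz: "norm z < 1" using subsetD[OF shell_subset_unit_ball[OF \<mu>] z] by simp
  have d: "defect z = (1 - norm z) * (1 + norm z)" by (simp add: defect_def power2_eq_square algebra_simps)
  have z': "\<mu> * \<mu> ^ k \<le> 1 - norm z" "1 - norm z \<le> \<mu> ^ k"
    using z by (auto simp: shell_def shell_radius_def)
  have "\<mu> * \<mu> ^ k \<le> (1 - norm z) * 1" using z' by simp
  also have "\<dots> \<le> defect z" unfolding d using nz by (intro mult_left_mono) auto
  finally have lo: "\<mu> * \<mu> ^ k \<le> defect z" .
  have "defect z \<le> \<mu> ^ k * 2" unfolding d using z' nz \<mu> by (intro mult_mono) auto
  also have "\<dots> \<le> \<mu> ^ k * (2 / \<mu>)" using \<mu> by (intro mult_left_mono) (auto simp: field_simps)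
  finally have hi: "defect z \<le> 2 / \<mu> * \<mu> ^ k" by (simp add: mult.commute)
  have lo': "\<mu> ^ k \<le> 2 / \<mu> * defect z"
  proof -
    have "\<mu> ^ k \<le> defect z / \<mu>" using lo \<mu> by (simp add: field_simps)
    also have "\<dots> \<le> 2 / \<mu> * defect z" using \<mu> defect_pos[OF nz] by (simp add: field_simps)
    finally show ?thesis .
  qed
  have "1 \<le> 2 / \<mu>" using \<mu> by simp
  then show "defect z powr \<alpha> \<le> (2 / \<mu>) powr \<bar>\<alpha>\<bar> * (\<mu> ^ k) powr \<alpha>"
    "(\<mu> ^ k) powr \<alpha> \<le> (2 / \<mu>) powr \<bar>\<alpha>\<bar> * defect z powr \<alpha>"
    using defect_pos[OF nz] \<mu> hi lo' by (auto intro!: powr_ratio_le)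
qed

text \<open>
  The \<open>k\<close>-th shell contributes at most a constant times \<open>\<mu>^(k (\<alpha> + 1))\<close>.
\<close>

lemma nn_integral_weight_finite:
  assumes "-1 < \<alpha>"
  shows "(\<integral>\<^sup>+z\<in>(unit_ball :: (complex ^ 'n) set). ennreal (defect z powr \<alpha>) \<partial>lborel) < top"
proof -
  define \<mu> :: real where "\<mu> = 1 / 2"
  have \<mu>: "0 < \<mu>" "\<mu> < 1" by (simp_all add: \<mu>_def)
  define N where "N = 2 * CARD('n)"
  define V where "V = ball_volume TYPE('n)"
  have V: "0 < V" by (simp add: V_def)
  have vol: "(\<integral>\<^sup>+z\<in>(unit_ball :: (complex ^ 'n) set). 1 \<partial>lborel) = ennreal V"
    by (simp add: V_def emeasure_ball)
  define K where "K = (2 / \<mu>) powr \<bar>\<alpha>\<bar> * (real N * (1 - \<mu>)) * V"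
  have K: "0 \<le> K" using \<mu> V by (simp add: K_def)
  define \<rho> where "\<rho> = \<mu> powr (\<alpha> + 1)"
  have \<rho>: "0 < \<rho>" "\<rho> < 1" using \<mu> assms by (simp_all add: \<rho>_def powr01_less_one)
  \<comment> \<open>a sequence concentrated at 0 makes the convolution a plain geometric series\<close>
  define Y where "Y j = (if j = 0 then ennreal K else 0)" for j :: nat
  have "(\<integral>\<^sup>+z\<in>(shell \<mu> k :: (complex ^ 'n) set). ennreal (defect z powr \<alpha>) \<partial>lborel) \<le> (\<Sum>j\<le>k. ennreal (\<rho> ^ (k - j)) * Y j)" for k
  proof -
    have "(\<integral>\<^sup>+z\<in>(shell \<mu> k :: (complex ^ 'n) set). ennreal (defect z powr \<alpha>) \<partial>lborel)
        \<le> (\<integral>\<^sup>+z. ennreal ((2 / \<mu>) powr \<bar>\<alpha>\<bar> * (\<mu> ^ k) powr \<alpha>) * (1 * indicator (shell \<mu> k :: (complex ^ 'n) set) z) \<partial>lborel)"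
      using defect_on_shell(1)[OF \<mu>, of _ k \<alpha>] by (intro nn_integral_mono) (auto simp: indicator_def ennreal_leI)
    also have "\<dots> = ennreal ((2 / \<mu>) powr \<bar>\<alpha>\<bar> * (\<mu> ^ k) powr \<alpha>) * (\<integral>\<^sup>+z\<in>(shell \<mu> k :: (complex ^ 'n) set). 1 \<partial>lborel)"
      by (rule nn_integral_cmult) simp
    also have "(\<integral>\<^sup>+z\<in>(shell \<mu> k :: (complex ^ 'n) set). 1 \<partial>lborel) = ennreal (shell_volume N \<mu> k) * ennreal V"
      using nn_integral_shell_homogeneous[OF \<mu>, of "\<lambda>_ :: complex ^ 'n. 1" k] vol by (simp add: N_def)
    also have "\<dots> \<le> ennreal (real N * (1 - \<mu>) * \<mu> ^ k) * ennreal V"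
      by (intro mult_right_mono ennreal_leI shell_volume_le \<mu>) simp
    also have "ennreal ((2 / \<mu>) powr \<bar>\<alpha>\<bar> * (\<mu> ^ k) powr \<alpha>) * (ennreal (real N * (1 - \<mu>) * \<mu> ^ k) * ennreal V)
        = ennreal (K * \<rho> ^ k)"
    proof -
      have "(\<mu> ^ k) powr \<alpha> * \<mu> ^ k = \<rho> ^ k"
        using \<mu> by (simp add: \<rho>_def powr_add powr_realpow[symmetric] powr_powr mult.commute flip: powr_add)
          (simp add: algebra_simps)
      then have "((2 / \<mu>) powr \<bar>\<alpha>\<bar> * (\<mu> ^ k) powr \<alpha>) * ((real N * (1 - \<mu>) * \<mu> ^ k) * V) = K * \<rho> ^ k"
        by (simp add: K_def mult_ac)
      then show ?thesis using \<mu> V by (simp add: ennreal_mult[symmetric])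
    qed
    also have "\<dots> = (\<Sum>j\<le>k. ennreal (\<rho> ^ (k - j)) * Y j)"
      using K \<rho> by (simp add: Y_def if_distrib[of "(*) _"] sum.delta ennreal_mult mult.commute cong: if_cong)
    finally show ?thesis by (simp add: mult_left_mono)
  qed
  from suminf_geometric_convolution_le[OF \<rho> this]
  have "(\<integral>\<^sup>+z\<in>(unit_ball :: (complex ^ 'n) set). ennreal (defect z powr \<alpha>) \<partial>lborel) \<le> ennreal (1 / (1 - \<rho>)) * (\<Sum>j. Y j)"
    by (subst nn_integral_shells[OF \<mu>]) simp_all
  also have "(\<Sum>j. Y j) = ennreal K"
    unfolding Y_def by (subst suminf_finite[of "{0}"]) auto
  also have "ennreal (1 / (1 - \<rho>)) * ennreal K < top"
    by (simp add: ennreal_mult_less_top)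
  finally show ?thesis .
qed

section \<open>The function is dominated by the radial area integral\<close>

text \<open>
  For \<open>z = 0\<close> the convention \<open>1 / 0 = 0\<close> gives the origin.
\<close>

definition ray_point :: "real \<Rightarrow> complex ^ 'n \<Rightarrow> complex ^ 'n" where
  "ray_point r z = r *\<^sub>R ((1 / norm z) *\<^sub>R z)"

lemma norm_ray_point_le: "norm (ray_point r z) \<le> \<bar>r\<bar>"
  by (cases "z = 0") (simp_all add: ray_point_def)

lemma ray_point_0 [simp]: "ray_point 0 z = 0" "ray_point r 0 = 0"
  by (simp_all add: ray_point_def)

lemma ray_point_norm: "ray_point (norm z) z = z"
  by (cases "z = 0") (simp_all add: ray_point_def)

lemma ray_point_scaleR: "0 < c \<Longrightarrow> ray_point r (c *\<^sub>R z) = ray_point r z"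
  by (simp add: ray_point_def)

lemma measurable_ray_point [measurable]: "ray_point r \<in> borel_measurable borel"
  unfolding ray_point_def[abs_def] by measurable

definition ray_increment :: "(complex ^ 'n \<Rightarrow> complex) \<Rightarrow> real \<Rightarrow> nat \<Rightarrow> complex ^ 'n \<Rightarrow> real" where
  "ray_increment f \<mu> j z = cmod (f (ray_point (shell_radius \<mu> (Suc j)) z) - f (ray_point (shell_radius \<mu> j) z))"

lemma ray_increment_scaleR: "0 < c \<Longrightarrow> ray_increment f \<mu> j (c *\<^sub>R z) = ray_increment f \<mu> j z"
  by (simp add: ray_increment_def ray_point_scaleR)

lemma measurable_ray_increment:
  fixes f :: "complex ^ 'n \<Rightarrow> complex"
  assumes f: "f \<in> hol_ball" and \<mu>: "0 < \<mu>" "\<mu> < 1"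
  shows "ray_increment f \<mu> j \<in> borel_measurable borel"
proof -
  define f' where "f' z = indicator unit_ball z *\<^sub>R f z" for z
  have [measurable]: "f' \<in> borel_measurable borel"
    unfolding f'_def using line_holD(1)[OF hol_ball_line_hol[OF f]]
    by (intro borel_measurable_continuous_on_indicator) auto
  have eq: "f (ray_point (shell_radius \<mu> i) z) = f' (ray_point (shell_radius \<mu> i) z)" for i z
    using norm_ray_point_le[of "shell_radius \<mu> i" z] shell_radius_bounds[OF \<mu>, of i]
    by (simp add: f'_def)
  show ?thesis
    unfolding ray_increment_def[abs_def] eq by measurable
qed

lemma ray_increment_integral_finite:
  fixes f :: "complex ^ 'n \<Rightarrow> complex"
  assumes f: "f \<in> hol_ball" and \<mu>: "0 < \<mu>" "\<mu> < 1" and p: "0 < p"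
  shows "(\<integral>\<^sup>+z\<in>unit_ball. ennreal (ray_increment f \<mu> j z powr p) \<partial>lborel) < top"
proof -
  note sr = shell_radius_bounds[OF \<mu>]
  have "compact (f ` cball 0 (shell_radius \<mu> (Suc j)))"
    using line_holD(1)[OF hol_ball_line_hol[OF f]] sr(2)[of "Suc j"]
    by (intro compact_continuous_image) (auto intro: continuous_on_subset)
  then obtain M where M: "\<And>z. z \<in> cball 0 (shell_radius \<mu> (Suc j)) \<Longrightarrow> cmod (f z) \<le> M"
    by (meson bounded_iff compact_imp_bounded imageI)
  have "ray_increment f \<mu> j z \<le> M + M" for z
  proof -
    have "norm (ray_point (shell_radius \<mu> (Suc j)) z) \<le> shell_radius \<mu> (Suc j)"
      using norm_ray_point_le[of "shell_radius \<mu> (Suc j)" z] sr(1)[of "Suc j"] by simp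
    moreover have "norm (ray_point (shell_radius \<mu> j) z) \<le> shell_radius \<mu> (Suc j)"
      using norm_ray_point_le[of "shell_radius \<mu> j" z] sr(1)[of j] shell_radius_mono[OF \<mu>, of j "Suc j"] by simp
    ultimately show ?thesis
      unfolding ray_increment_def by (intro order_trans[OF norm_triangle_ineq4] add_mono M) auto
  qed
  then have "(\<integral>\<^sup>+z\<in>(unit_ball :: (complex ^ 'n) set). ennreal (ray_increment f \<mu> j z powr p) \<partial>lborel)
      \<le> (\<integral>\<^sup>+z. ennreal ((M + M) powr p) * indicator (unit_ball :: (complex ^ 'n) set) z \<partial>lborel)"
    using p by (intro nn_integral_mono mult_right_mono ennreal_leI powr_mono2) (auto simp: ray_increment_def)
  also have "\<dots> = ennreal ((M + M) powr p) * emeasure lborel (unit_ball :: (complex ^ 'n) set)"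
    by (rule nn_integral_cmult_indicator) simp
  also have "\<dots> < top"
    using emeasure_lborel_ball_finite[of "0 :: complex ^ 'n" 1] by (simp add: ennreal_mult_less_top)
  finally show ?thesis .
qed

text \<open>
  The increment depends only on the direction, so the two integrals are proportional to the volumes of
  the shells, which decrease like \<open>\<mu>^k\<close>.
\<close>

lemma nn_integral_ray_increment_shells:
  fixes f :: "complex ^ 'n \<Rightarrow> complex"
  assumes f: "f \<in> hol_ball" and \<mu>: "0 < \<mu>" "\<mu> < 1" and p: "0 < p" and jk: "j \<le> k"
  shows "(\<integral>\<^sup>+z\<in>shell \<mu> k. ennreal (ray_increment f \<mu> j z powr p) \<partial>lborel)
       \<le> ennreal (2 * real CARD('n) * (1 - \<mu>) / (1 - \<mu>) ^ (2 * CARD('n)) * \<mu> ^ (k - j))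
         * (\<integral>\<^sup>+z\<in>shell \<mu> j. ennreal (ray_increment f \<mu> j z powr p) \<partial>lborel)"
proof -
  define N where "N = 2 * CARD('n)"
  define L where "L = real N * (1 - \<mu>) / (1 - \<mu>) ^ N"
  have L: "0 \<le> L" using \<mu> by (simp add: L_def)
  define I where "I = (\<integral>\<^sup>+z\<in>(unit_ball :: (complex ^ 'n) set). ennreal (ray_increment f \<mu> j z powr p) \<partial>lborel)"
  have [measurable]: "ray_increment f \<mu> j \<in> borel_measurable borel"
    using f \<mu> by (rule measurable_ray_increment)
  have sh: "(\<integral>\<^sup>+z\<in>shell \<mu> i. ennreal (ray_increment f \<mu> j z powr p) \<partial>lborel) = ennreal (shell_volume N \<mu> i) * I" for i
    unfolding I_def N_def
    by (rule nn_integral_shell_homogeneous[OF \<mu>])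
       (simp_all add: ray_increment_scaleR ray_increment_integral_finite[OF f \<mu> p])
  have "shell_volume N \<mu> k \<le> real N * (1 - \<mu>) * \<mu> ^ k" by (rule shell_volume_le[OF \<mu>])
  also have "\<dots> = L * \<mu> ^ (k - j) * ((1 - \<mu>) ^ N * \<mu> ^ j)"
    using \<mu> jk by (simp add: L_def power_add[symmetric])
  also have "\<dots> \<le> L * \<mu> ^ (k - j) * shell_volume N \<mu> j"
    using L \<mu> by (intro mult_left_mono shell_volume_ge) (auto simp: N_def)
  finally have "ennreal (shell_volume N \<mu> k) \<le> ennreal (L * \<mu> ^ (k - j) * shell_volume N \<mu> j)"
    by (rule ennreal_leI)
  also have "\<dots> = ennreal (L * \<mu> ^ (k - j)) * ennreal (shell_volume N \<mu> j)"
    using L \<mu> by (intro ennreal_mult') simp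
  finally have "ennreal (shell_volume N \<mu> k) * I \<le> ennreal (L * \<mu> ^ (k - j)) * ennreal (shell_volume N \<mu> j) * I"
    by (rule mult_right_mono) simp
  moreover have "2 * real CARD('n) * (1 - \<mu>) / (1 - \<mu>) ^ (2 * CARD('n)) = L"
    by (simp add: L_def N_def)
  ultimately show ?thesis
    unfolding sh by (simp only: mult.assoc)
qed

text \<open>
  Along the ray through \<open>z\<close> the difference \<open>f z - f 0\<close> is the sum of the increments over the inner shells
  and of one last increment inside the shell of \<open>z\<close>.  Each increment \<open>j\<close> is first moved from shell \<open>k\<close>
  to shell \<open>j\<close>, where the area function dominates it; the total weight is a geometric convolution.
\<close>

lemma nn_integral_le_area_R:
  fixes p q \<gamma> \<alpha> :: real
  assumes p: "0 < p" and q: "0 < q" and \<gamma>: "0 < \<gamma>" and \<alpha>: "-1 < \<alpha>"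
  obtains C where "0 < C"
    "\<And>f :: complex ^ 'n \<Rightarrow> complex. f \<in> hol_ball \<Longrightarrow>
       weighted_integral \<alpha> (\<lambda>z. ennreal (cmod (f z - f 0) powr p))
       \<le> ennreal C * weighted_integral \<alpha> (\<lambda>z. epowr (area_R \<gamma> q f z) p)"
proof -
  obtain \<mu> C where \<mu>: "0 < \<mu>" "\<mu> < 1" and C: "0 < C"
    and osc: "\<And>(f :: complex ^ 'n \<Rightarrow> complex) k r s t \<zeta>. f \<in> hol_ball \<Longrightarrow> norm \<zeta> = 1 \<Longrightarrow>
       shell_radius \<mu> k \<le> r \<Longrightarrow> r \<le> shell_radius \<mu> (Suc k) \<Longrightarrow>
       shell_radius \<mu> k \<le> s \<Longrightarrow> s \<le> shell_radius \<mu> (Suc k) \<Longrightarrow>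
       shell_radius \<mu> k \<le> t \<Longrightarrow> t \<le> shell_radius \<mu> (Suc k) \<Longrightarrow>
       ennreal (cmod (f (s *\<^sub>R \<zeta>) - f (t *\<^sub>R \<zeta>))) \<le> ennreal C * area_R \<gamma> q f (r *\<^sub>R \<zeta>)"
    using oscillation_le_area_R[where 'n = 'n, OF q \<gamma>] by blast
  \<comment> \<open>weight and volume of shell k decay like theta^(2 k); one factor theta^k pays for the Hardy weights\<close>
  define \<theta> where "\<theta> = \<mu> powr ((\<alpha> + 1) / 2)"
  have \<theta>: "0 < \<theta>" "\<theta> < 1" using \<mu> \<alpha> by (simp_all add: \<theta>_def powr01_less_one)
  have \<theta>2: "\<mu> powr \<alpha> * \<mu> = \<theta> * \<theta>"
  proof -
    have "\<theta> * \<theta> = \<mu> powr ((\<alpha> + 1) / 2 + (\<alpha> + 1) / 2)" unfolding \<theta>_def powr_add ..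
    also have "\<dots> = \<mu> powr \<alpha> * \<mu> powr 1" by (simp only: field_sum_of_halves powr_add)
    finally show ?thesis using \<mu> by simp
  qed
  obtain K where K: "0 < K" "\<And>k (x :: nat \<Rightarrow> real). (\<And>j. j \<le> k \<Longrightarrow> 0 \<le> x j) \<Longrightarrow>
     (\<Sum>j\<le>k. x j) powr p \<le> K * (\<Sum>j\<le>k. (1 / \<theta>) ^ (k - j) * x j powr p)"
    using sum_powr_le_weighted_sum[OF p \<theta>] by blast
  define M where "M = (2 / \<mu>) powr \<bar>\<alpha>\<bar>"
  have M: "0 < M" using \<mu> by (simp add: M_def)
  define L where "L = 2 * real CARD('n) * (1 - \<mu>) / (1 - \<mu>) ^ (2 * CARD('n))"
  have L: "0 < L" using \<mu> by (simp add: L_def)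
  define D where "D = K * C powr p * (M * L * M + 1)"
  have D: "0 < D" using K(1) C M L by (simp add: D_def add_pos_pos)
  show thesis
  proof (rule that)
    show "0 < 1 / (1 - \<theta>) * D" using \<theta> D by simp
    fix f :: "complex ^ 'n \<Rightarrow> complex" assume f: "f \<in> hol_ball"
    have mf [measurable]: "f \<in> borel_measurable ball_borel"
      by (intro line_hol_measurable hol_ball_line_hol f)
    have mA [measurable]: "area_R \<gamma> q f \<in> borel_measurable ball_borel"
      unfolding area_R_def by (intro measurable_area_int measurable_radial f \<gamma>)
    have mI [measurable]: "ray_increment f \<mu> j \<in> borel_measurable borel" for j
      using f \<mu> by (rule measurable_ray_increment)
    define F where "F z = ennreal (cmod (f z - f 0) powr p) * ennreal (defect z powr \<alpha>)" for z
    define H where "H z = epowr (area_R \<gamma> q f z) p * ennreal (defect z powr \<alpha>)" for z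
    have mF: "F \<in> borel_measurable ball_borel" unfolding F_def by measurable
    have mH: "H \<in> borel_measurable ball_borel" unfolding H_def by measurable
    have mHs [measurable]: "(\<lambda>z. H z * indicator (shell \<mu> k) z) \<in> borel_measurable borel" for k
      using mH sets_shell shell_subset_unit_ball[OF \<mu>] by (rule measurable_on_subset_of_ball)
    define X Y where "X k = (\<integral>\<^sup>+z\<in>shell \<mu> k. F z \<partial>lborel)" and "Y k = (\<integral>\<^sup>+z\<in>shell \<mu> k. H z \<partial>lborel)" for k
    have incr: "ennreal (cmod (f (ray_point s z) - f (ray_point t z)) powr p) \<le> ennreal (C powr p) * epowr (area_R \<gamma> q f z) p"
      if z: "z \<in> shell \<mu> k" "z \<noteq> 0" and st: "shell_radius \<mu> k \<le> s" "s \<le> shell_radius \<mu> (Suc k)"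
        "shell_radius \<mu> k \<le> t" "t \<le> shell_radius \<mu> (Suc k)" for z k s t
    proof -
      have "ennreal (cmod (f (ray_point s z) - f (ray_point t z))) \<le> ennreal C * area_R \<gamma> q f (norm z *\<^sub>R ((1 / norm z) *\<^sub>R z))"
        unfolding ray_point_def by (rule osc[OF f]) (use z st in \<open>auto simp: shell_def\<close>)
      also have "norm z *\<^sub>R ((1 / norm z) *\<^sub>R z) = z" using z(2) by simp
      finally have "epowr (ennreal (cmod (f (ray_point s z) - f (ray_point t z)))) p \<le> epowr (ennreal C * area_R \<gamma> q f z) p"
        using p by (intro epowr_mono) auto
      then show ?thesis using C by (simp add: epowr_ennreal epowr_cmult)
    qed
    have G: "ennreal ((\<mu> ^ j) powr \<alpha>) * (\<integral>\<^sup>+z\<in>shell \<mu> j. ennreal (ray_increment f \<mu> j z powr p) \<partial>lborel) \<le> ennreal (C powr p * M) * Y j" for j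
    proof -
      have "ennreal ((\<mu> ^ j) powr \<alpha>) * (\<integral>\<^sup>+z\<in>shell \<mu> j. ennreal (ray_increment f \<mu> j z powr p) \<partial>lborel)
          = (\<integral>\<^sup>+z. ennreal ((\<mu> ^ j) powr \<alpha>) * (ennreal (ray_increment f \<mu> j z powr p) * indicator (shell \<mu> j) z) \<partial>lborel)"
        by (rule nn_integral_cmult[symmetric]) measurable
      also have "\<dots> \<le> (\<integral>\<^sup>+z. ennreal (C powr p * M) * (H z * indicator (shell \<mu> j) z) \<partial>lborel)"
      proof (rule nn_integral_mono)
        fix z :: "complex ^ 'n"
        show "ennreal ((\<mu> ^ j) powr \<alpha>) * (ennreal (ray_increment f \<mu> j z powr p) * indicator (shell \<mu> j) z)
            \<le> ennreal (C powr p * M) * (H z * indicator (shell \<mu> j) z)"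
        proof (cases "z \<in> shell \<mu> j \<and> z \<noteq> 0")
          case True
          have "ennreal (ray_increment f \<mu> j z powr p) \<le> ennreal (C powr p) * epowr (area_R \<gamma> q f z) p"
            unfolding ray_increment_def
            using True shell_radius_mono[OF \<mu>, of j "Suc j"] by (intro incr[of _ j]) auto
          moreover have "ennreal ((\<mu> ^ j) powr \<alpha>) \<le> ennreal M * ennreal (defect z powr \<alpha>)"
            using defect_on_shell(2)[OF \<mu>, of z j \<alpha>] True M by (simp add: M_def ennreal_mult[symmetric] ennreal_leI)
          ultimately have "ennreal ((\<mu> ^ j) powr \<alpha>) * ennreal (ray_increment f \<mu> j z powr p)
              \<le> (ennreal M * ennreal (defect z powr \<alpha>)) * (ennreal (C powr p) * epowr (area_R \<gamma> q f z) p)"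
            by (intro mult_mono) auto
          also have "\<dots> = ennreal (C powr p * M) * H z" using M by (simp add: H_def ennreal_mult mult_ac)
          finally show ?thesis using True by simp
        qed (auto simp: ray_increment_def)
      qed
      also have "\<dots> = ennreal (C powr p * M) * Y j"
        unfolding Y_def by (rule nn_integral_cmult) measurable
      finally show ?thesis .
    qed
    have XY: "X k \<le> (\<Sum>j\<le>k. ennreal (\<theta> ^ (k - j)) * (ennreal D * Y j))" for k
    proof -
      define c where "c j = K * (1 / \<theta>) ^ (k - j) * (M * (\<mu> ^ k) powr \<alpha>)" for j
      have c0: "0 \<le> c j" for j using K(1) \<theta> M by (simp add: c_def)
      have point: "F z * indicator (shell \<mu> k) z
          \<le> (\<Sum>j<k. ennreal (c j) * (ennreal (ray_increment f \<mu> j z powr p) * indicator (shell \<mu> k) z))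
            + ennreal (K * C powr p) * (H z * indicator (shell \<mu> k) z)" for z
      proof (cases "z \<in> shell \<mu> k \<and> z \<noteq> 0")
        case True
        then have z: "z \<in> shell \<mu> k" "z \<noteq> 0" by auto
        define x where "x j = (if j < k then ray_increment f \<mu> j z else cmod (f z - f (ray_point (shell_radius \<mu> k) z)))" for j
        have x0: "0 \<le> x j" for j by (simp add: x_def ray_increment_def)
        have "f z - f 0 = (\<Sum>j<k. f (ray_point (shell_radius \<mu> (Suc j)) z) - f (ray_point (shell_radius \<mu> j) z))
            + (f z - f (ray_point (shell_radius \<mu> k) z))"
          using sum_lessThan_telescope[of "\<lambda>j. f (ray_point (shell_radius \<mu> j) z)" k] by simp
        then have "cmod (f z - f 0) \<le> cmod (\<Sum>j<k. f (ray_point (shell_radius \<mu> (Suc j)) z) - f (ray_point (shell_radius \<mu> j) z))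
            + cmod (f z - f (ray_point (shell_radius \<mu> k) z))"
          by (simp only: norm_triangle_ineq)
        also have "\<dots> \<le> (\<Sum>j<k. ray_increment f \<mu> j z) + cmod (f z - f (ray_point (shell_radius \<mu> k) z))"
          unfolding ray_increment_def by (intro add_right_mono norm_sum)
        also have "\<dots> = (\<Sum>j\<le>k. x j)"
          by (simp add: lessThan_Suc_atMost[symmetric] x_def)
        finally have "cmod (f z - f 0) powr p \<le> (\<Sum>j\<le>k. x j) powr p"
          using p by (intro powr_mono2) auto
        also have "\<dots> \<le> K * (\<Sum>j\<le>k. (1 / \<theta>) ^ (k - j) * x j powr p)" by (rule K(2)[OF x0])
        also have "\<dots> = (\<Sum>j<k. K * (1 / \<theta>) ^ (k - j) * ray_increment f \<mu> j z powr p) + K * x k powr p"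
          by (simp add: lessThan_Suc_atMost[symmetric] x_def sum_distrib_left distrib_left mult.assoc)
        finally have "cmod (f z - f 0) powr p * defect z powr \<alpha>
            \<le> ((\<Sum>j<k. K * (1 / \<theta>) ^ (k - j) * ray_increment f \<mu> j z powr p) + K * x k powr p) * defect z powr \<alpha>"
          by (intro mult_right_mono) auto
        also have "\<dots> = (\<Sum>j<k. K * (1 / \<theta>) ^ (k - j) * ray_increment f \<mu> j z powr p * defect z powr \<alpha>) + K * x k powr p * defect z powr \<alpha>"
          by (simp add: distrib_right sum_distrib_right)
        also have "\<dots> \<le> (\<Sum>j<k. c j * ray_increment f \<mu> j z powr p) + K * x k powr p * defect z powr \<alpha>"
        proof (intro add_right_mono sum_mono)
          fix j
          have "K * (1 / \<theta>) ^ (k - j) * ray_increment f \<mu> j z powr p * defect z powr \<alpha>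
              \<le> K * (1 / \<theta>) ^ (k - j) * ray_increment f \<mu> j z powr p * (M * (\<mu> ^ k) powr \<alpha>)"
            using defect_on_shell(1)[OF \<mu> z(1), of \<alpha>] K(1) \<theta> by (intro mult_left_mono) (auto simp: M_def)
          then show "K * (1 / \<theta>) ^ (k - j) * ray_increment f \<mu> j z powr p * defect z powr \<alpha> \<le> c j * ray_increment f \<mu> j z powr p"
            by (simp add: c_def mult_ac)
        qed
        finally have "ennreal (cmod (f z - f 0) powr p * defect z powr \<alpha>)
            \<le> ennreal ((\<Sum>j<k. c j * ray_increment f \<mu> j z powr p) + K * x k powr p * defect z powr \<alpha>)"
          by (rule ennreal_leI)
        also have "\<dots> = (\<Sum>j<k. ennreal (c j) * ennreal (ray_increment f \<mu> j z powr p))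
            + ennreal K * (ennreal (x k powr p) * ennreal (defect z powr \<alpha>))"
          using c0 K(1) by (simp add: sum_nonneg ennreal_mult sum_ennreal[symmetric] mult.assoc)
        also have "ennreal K * (ennreal (x k powr p) * ennreal (defect z powr \<alpha>)) \<le> ennreal K * (ennreal (C powr p) * epowr (area_R \<gamma> q f z) p * ennreal (defect z powr \<alpha>))"
        proof (intro mult_left_mono mult_right_mono)
          have "ennreal (cmod (f (ray_point (norm z) z) - f (ray_point (shell_radius \<mu> k) z)) powr p) \<le> ennreal (C powr p) * epowr (area_R \<gamma> q f z) p"
            using z(1) shell_radius_mono[OF \<mu>, of k "Suc k"] by (intro incr[OF z]) (auto simp: shell_def)
          then show "ennreal (x k powr p) \<le> ennreal (C powr p) * epowr (area_R \<gamma> q f z) p"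
            by (simp add: x_def ray_point_norm)
        qed auto
        finally show ?thesis
          using z K(1) by (simp add: F_def H_def ennreal_mult mult.assoc add_left_mono)
      qed (auto simp: F_def)
      have "X k \<le> (\<integral>\<^sup>+z. (\<Sum>j<k. ennreal (c j) * (ennreal (ray_increment f \<mu> j z powr p) * indicator (shell \<mu> k) z))
            + ennreal (K * C powr p) * (H z * indicator (shell \<mu> k) z) \<partial>lborel)"
        unfolding X_def by (intro nn_integral_mono point)
      also have "\<dots> = (\<Sum>j<k. ennreal (c j) * (\<integral>\<^sup>+z\<in>shell \<mu> k. ennreal (ray_increment f \<mu> j z powr p) \<partial>lborel)) + ennreal (K * C powr p) * Y k"
        unfolding Y_def by (subst nn_integral_add) (simp_all add: nn_integral_sum nn_integral_cmult)
      also have "\<dots> \<le> (\<Sum>j<k. ennreal (\<theta> ^ (k - j)) * (ennreal D * Y j)) + ennreal (\<theta> ^ (k - k)) * (ennreal D * Y k)"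
      proof (intro add_mono sum_mono)
        have "K * C powr p * 1 \<le> D" unfolding D_def using K(1) C M L by (intro mult_left_mono) auto
        then show "ennreal (K * C powr p) * Y k \<le> ennreal (\<theta> ^ (k - k)) * (ennreal D * Y k)"
          by (simp add: mult_right_mono ennreal_leI)
        fix j assume "j \<in> {..<k}"
        then have jk: "j \<le> k" by simp
        have "(\<mu> ^ k) powr \<alpha> = (\<mu> ^ (k - j)) powr \<alpha> * (\<mu> ^ j) powr \<alpha>"
          using jk \<mu> by (simp add: powr_mult[symmetric] power_add[symmetric])
        moreover have "(1 / \<theta>) ^ (k - j) * ((\<mu> ^ (k - j)) powr \<alpha> * \<mu> ^ (k - j)) = \<theta> ^ (k - j)"
        proof -
          have "(\<mu> ^ (k - j)) powr \<alpha> = (\<mu> powr \<alpha>) ^ (k - j)"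
            using \<mu> by (simp add: powr_realpow[symmetric] powr_powr mult.commute)
          then have "(1 / \<theta>) ^ (k - j) * ((\<mu> ^ (k - j)) powr \<alpha> * \<mu> ^ (k - j)) = (1 / \<theta> * (\<mu> powr \<alpha> * \<mu>)) ^ (k - j)"
            by (simp only: power_mult_distrib)
          then show ?thesis using \<theta> by (simp add: \<theta>2)
        qed
        ultimately have cc: "c j * (L * \<mu> ^ (k - j)) = K * M * L * \<theta> ^ (k - j) * (\<mu> ^ j) powr \<alpha>"
          by (simp add: c_def mult_ac)
        have "ennreal (c j) * (\<integral>\<^sup>+z\<in>shell \<mu> k. ennreal (ray_increment f \<mu> j z powr p) \<partial>lborel)
            \<le> ennreal (c j) * (ennreal (L * \<mu> ^ (k - j)) * (\<integral>\<^sup>+z\<in>shell \<mu> j. ennreal (ray_increment f \<mu> j z powr p) \<partial>lborel))"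
          using nn_integral_ray_increment_shells[OF f \<mu> p jk] by (intro mult_left_mono) (auto simp: L_def)
        also have "\<dots> = ennreal (K * M * L * \<theta> ^ (k - j)) * (ennreal ((\<mu> ^ j) powr \<alpha>) * (\<integral>\<^sup>+z\<in>shell \<mu> j. ennreal (ray_increment f \<mu> j z powr p) \<partial>lborel))"
        proof -
          have "ennreal (c j) * ennreal (L * \<mu> ^ (k - j)) = ennreal (c j * (L * \<mu> ^ (k - j)))"
            using c0[of j] L \<mu> by (simp add: ennreal_mult)
          also have "\<dots> = ennreal (K * M * L * \<theta> ^ (k - j)) * ennreal ((\<mu> ^ j) powr \<alpha>)"
            unfolding cc using K(1) M L \<theta> by (intro ennreal_mult) auto
          finally have e: "ennreal (c j) * ennreal (L * \<mu> ^ (k - j)) = ennreal (K * M * L * \<theta> ^ (k - j)) * ennreal ((\<mu> ^ j) powr \<alpha>)" .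
          have "a * (b * z) = c' * (d * z)" if "a * b = c' * d" for a b c' d z :: ennreal
            using that by (metis mult.assoc)
          from this[OF e] show ?thesis .
        qed
        also have "\<dots> \<le> ennreal (K * M * L * \<theta> ^ (k - j)) * (ennreal (C powr p * M) * Y j)"
          by (intro mult_left_mono G) simp
        also have "\<dots> = ennreal (\<theta> ^ (k - j) * (K * C powr p * (M * L * M))) * Y j"
        proof -
          have "ennreal (K * M * L * \<theta> ^ (k - j)) * ennreal (C powr p * M) = ennreal ((K * M * L * \<theta> ^ (k - j)) * (C powr p * M))"
            using K(1) M L \<theta> by (intro ennreal_mult[symmetric]) auto
          also have "(K * M * L * \<theta> ^ (k - j)) * (C powr p * M) = \<theta> ^ (k - j) * (K * C powr p * (M * L * M))"
            by (simp only: mult_ac)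
          finally show ?thesis by (simp only: mult.assoc[symmetric, of "ennreal _" "ennreal _" "Y j"])
        qed
        also have "\<dots> \<le> ennreal (\<theta> ^ (k - j) * D) * Y j"
          unfolding D_def using K(1) \<theta> by (intro mult_right_mono ennreal_leI mult_left_mono) auto
        also have "\<dots> = ennreal (\<theta> ^ (k - j)) * (ennreal D * Y j)"
          using \<theta> D by (simp add: ennreal_mult mult.assoc)
        finally show "ennreal (c j) * (\<integral>\<^sup>+z\<in>shell \<mu> k. ennreal (ray_increment f \<mu> j z powr p) \<partial>lborel)
            \<le> ennreal (\<theta> ^ (k - j)) * (ennreal D * Y j)" .
      qed
      also have "\<dots> = (\<Sum>j\<le>k. ennreal (\<theta> ^ (k - j)) * (ennreal D * Y j))"
        by (simp add: lessThan_Suc_atMost[symmetric])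
      finally show ?thesis .
    qed
    have "(\<integral>\<^sup>+z\<in>unit_ball. F z \<partial>lborel) = (\<Sum>k. X k)"
      unfolding X_def by (rule nn_integral_shells[OF \<mu> mF])
    also have "\<dots> \<le> ennreal (1 / (1 - \<theta>)) * (\<Sum>j. ennreal D * Y j)"
      by (rule suminf_geometric_convolution_le[OF \<theta> XY])
    also have "\<dots> = ennreal (1 / (1 - \<theta>) * D) * (\<Sum>j. Y j)"
      using \<theta> D by (subst ennreal_suminf_cmult) (simp add: mult.assoc[symmetric] ennreal_mult[symmetric])
    also have "(\<Sum>j. Y j) = (\<integral>\<^sup>+z\<in>unit_ball. H z \<partial>lborel)"
      unfolding Y_def by (rule nn_integral_shells[OF \<mu> mH, symmetric])
    finally show "weighted_integral \<alpha> (\<lambda>z. ennreal (cmod (f z - f 0) powr p))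
       \<le> ennreal (1 / (1 - \<theta>) * D) * weighted_integral \<alpha> (\<lambda>z. epowr (area_R \<gamma> q f z) p)"
      by (simp only: F_def H_def)
  qed
qed

section \<open>Norm comparison\<close>

lemma space_vol_w: "space (vol_w \<alpha>) = unit_ball"
  by (simp add: vol_w_def vol_def space_restrict_space)

lemma Lp_norm_mono:
  fixes F G :: "complex ^ 'n \<Rightarrow> ennreal"
  assumes "0 < p" "\<And>z. norm z < 1 \<Longrightarrow> F z \<le> G z"
  shows "Lp_norm p \<alpha> F \<le> Lp_norm p \<alpha> G"
  unfolding Lp_norm_def using assms
  by (intro epowr_mono nn_integral_mono) (auto simp: space_vol_w)

lemma Lp_norm_le:
  fixes F G :: "complex ^ 'n \<Rightarrow> ennreal"
  assumes \<alpha>: "-1 < \<alpha>" and p: "0 < p" and C: "0 < C"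
    and [measurable]: "F \<in> borel_measurable ball_borel" "G \<in> borel_measurable ball_borel"
    and le: "weighted_integral \<alpha> (\<lambda>z. epowr (F z) p)
       \<le> ennreal C * weighted_integral \<alpha> (\<lambda>z. epowr (G z) p)"
  shows "Lp_norm p \<alpha> F \<le> ennreal (C powr (1 / p)) * Lp_norm p \<alpha> G"
proof -
  obtain c where c: "0 < c" "\<And>F :: complex ^ 'n \<Rightarrow> ennreal. F \<in> borel_measurable ball_borel \<Longrightarrow>
     (\<integral>\<^sup>+z. F z \<partial>vol_w \<alpha>) = ennreal c * weighted_integral \<alpha> (\<lambda>z. F z)"
    using nn_integral_vol_w_constant[where 'n = 'n, OF \<alpha>] by blast
  have "(\<integral>\<^sup>+z. epowr (F z) p \<partial>vol_w \<alpha>) = ennreal c * weighted_integral \<alpha> (\<lambda>z. epowr (F z) p)"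
    by (rule c(2)) measurable
  also have "\<dots> \<le> ennreal c * (ennreal C * weighted_integral \<alpha> (\<lambda>z. epowr (G z) p))"
    by (intro mult_left_mono le) simp
  also have "\<dots> = ennreal C * (ennreal c * weighted_integral \<alpha> (\<lambda>z. epowr (G z) p))"
    by (simp add: mult.left_commute)
  also have "ennreal c * weighted_integral \<alpha> (\<lambda>z. epowr (G z) p) = (\<integral>\<^sup>+z. epowr (G z) p \<partial>vol_w \<alpha>)"
    by (rule c(2)[symmetric]) measurable
  finally have "epowr (\<integral>\<^sup>+z. epowr (F z) p \<partial>vol_w \<alpha>) (1 / p) \<le> epowr (ennreal C * (\<integral>\<^sup>+z. epowr (G z) p \<partial>vol_w \<alpha>)) (1 / p)"
    using p by (intro epowr_mono) auto
  then show ?thesis using C by (simp add: Lp_norm_def epowr_cmult)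
qed

lemma Lp_norm_finite_iff:
  fixes F :: "complex ^ 'n \<Rightarrow> ennreal"
  assumes \<alpha>: "-1 < \<alpha>" and [measurable]: "F \<in> borel_measurable ball_borel"
  shows "Lp_norm p \<alpha> F < top \<longleftrightarrow> weighted_integral \<alpha> (\<lambda>z. epowr (F z) p) < top"
proof -
  obtain c where c: "0 < c" "\<And>F :: complex ^ 'n \<Rightarrow> ennreal. F \<in> borel_measurable ball_borel \<Longrightarrow>
     (\<integral>\<^sup>+z. F z \<partial>vol_w \<alpha>) = ennreal c * weighted_integral \<alpha> (\<lambda>z. F z)"
    using nn_integral_vol_w_constant[where 'n = 'n, OF \<alpha>] by blast
  have "(\<integral>\<^sup>+z. epowr (F z) p \<partial>vol_w \<alpha>) = ennreal c * weighted_integral \<alpha> (\<lambda>z. epowr (F z) p)"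
    by (rule c(2)) measurable
  then show ?thesis
    using c(1) by (simp add: Lp_norm_def less_top[symmetric] ennreal_mult_eq_top_iff)
qed

lemma powr_add_le:
  fixes a b p :: real
  assumes "0 \<le> a" "0 \<le> b" "0 < p"
  shows "(a + b) powr p \<le> 2 powr p * (a powr p + b powr p)"
proof -
  have "(a + b) powr p \<le> (2 * max a b) powr p" using assms by (intro powr_mono2) auto
  also have "\<dots> = 2 powr p * max a b powr p" using assms by (simp add: powr_mult)
  also have "\<dots> \<le> 2 powr p * (a powr p + b powr p)" by (intro mult_left_mono) (auto simp: max_def)
  finally show ?thesis .
qed

text \<open>
  Constants have finite norm because \<open>\<alpha> > -1\<close>.
\<close>

lemma Lp_norm_add_constant_finite:
  fixes f :: "complex ^ 'n \<Rightarrow> complex"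
  assumes \<alpha>: "-1 < \<alpha>" and p: "0 < p" and [measurable]: "f \<in> borel_measurable ball_borel"
    and fin: "Lp_norm p \<alpha> (\<lambda>z. ennreal (cmod (f z))) < top"
  shows "Lp_norm p \<alpha> (\<lambda>z. ennreal (cmod (f z + a))) < top"
proof -
  define w where "w z = ennreal (defect z powr \<alpha>)" for z :: "complex ^ 'n"
  have [measurable]: "w \<in> borel_measurable ball_borel" unfolding w_def by measurable
  have m1: "(\<lambda>z. ennreal (cmod (f z) powr p) * w z * indicator unit_ball z) \<in> borel_measurable borel"
    unfolding ball_borel_iff[symmetric] by measurable
  have m2: "(\<lambda>z. w z * indicator unit_ball z) \<in> borel_measurable borel"
    unfolding ball_borel_iff[symmetric] by measurable
  have "(\<integral>\<^sup>+z\<in>unit_ball. ennreal (cmod (f z + a) powr p) * w z \<partial>lborel)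
      \<le> (\<integral>\<^sup>+z. ennreal (2 powr p) * ((ennreal (cmod (f z) powr p) * w z * indicator unit_ball z)
            + ennreal (cmod a powr p) * (w z * indicator unit_ball z)) \<partial>lborel)"
  proof (rule nn_integral_mono)
    fix z
    have "cmod (f z + a) powr p \<le> (cmod (f z) + cmod a) powr p"
      using p by (intro powr_mono2 norm_triangle_ineq) auto
    also have "\<dots> \<le> 2 powr p * (cmod (f z) powr p + cmod a powr p)"
      using p by (intro powr_add_le) auto
    finally have "ennreal (cmod (f z + a) powr p) \<le> ennreal (2 powr p) * (ennreal (cmod (f z) powr p) + ennreal (cmod a powr p))"
      by (simp add: ennreal_mult[symmetric] ennreal_leI flip: ennreal_plus)
    then have "ennreal (cmod (f z + a) powr p) * w z * indicator unit_ball z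
        \<le> ennreal (2 powr p) * (ennreal (cmod (f z) powr p) + ennreal (cmod a powr p)) * w z * indicator unit_ball z"
      by (intro mult_right_mono) auto
    then show "ennreal (cmod (f z + a) powr p) * w z * indicator unit_ball z
        \<le> ennreal (2 powr p) * ((ennreal (cmod (f z) powr p) * w z * indicator unit_ball z)
            + ennreal (cmod a powr p) * (w z * indicator unit_ball z))"
      by (simp only: mult.assoc distrib_right)
  qed
  also have "\<dots> = ennreal (2 powr p) * ((\<integral>\<^sup>+z\<in>unit_ball. ennreal (cmod (f z) powr p) * w z \<partial>lborel)
      + ennreal (cmod a powr p) * (\<integral>\<^sup>+z\<in>unit_ball. w z \<partial>lborel))"
    using m1 m2 by (simp add: nn_integral_cmult nn_integral_add)
  also have "\<dots> < top"
  proof -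
    have "(\<integral>\<^sup>+z\<in>unit_ball. ennreal (cmod (f z) powr p) * w z \<partial>lborel) < top"
      using fin unfolding w_def by (subst (asm) Lp_norm_finite_iff[OF \<alpha>]) (simp_all add: epowr_ennreal)
    moreover have "(\<integral>\<^sup>+z\<in>unit_ball. w z \<partial>lborel) < top"
      unfolding w_def by (rule nn_integral_weight_finite[OF \<alpha>])
    ultimately show ?thesis by (simp add: ennreal_mult_less_top)
  qed
  finally show ?thesis
    unfolding w_def by (subst Lp_norm_finite_iff[OF \<alpha>]) (simp_all add: epowr_ennreal)
qed

lemma area_R_le_area_grad:
  assumes "f \<in> hol_ball" "0 < q"
  shows "area_R \<gamma> q f z \<le> area_grad \<gamma> q f z"
  unfolding area_R_def area_grad_def using assms radial_deriv_le_cgrad[OF assms(1)]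
  by (intro area_int_mono) (auto intro: mult_left_mono)

lemma area_grad_le_area_inv_grad:
  assumes "f \<in> hol_ball" "0 < q"
  shows "area_grad \<gamma> q f z \<le> area_inv_grad \<gamma> q f z"
  unfolding area_grad_def area_inv_grad_def
proof (rule area_int_mono)
  fix w :: "complex ^ 'a" assume w: "norm w < 1"
  show "norm ((1 - (norm w)\<^sup>2) *\<^sub>R cgrad f w) \<le> norm (inv_grad f w)"
    using cgrad_le_inv_grad[OF assms(1) w] defect_pos[OF w] by (simp add: defect_def)
qed (use assms in auto)

theorem theorem1p2:
  fixes q \<gamma> \<alpha> p :: real
  assumes "1 < q" and "\<gamma> > 0" and "\<alpha> > -1" and "0 < p"
  shows "(\<forall>f \<in> (hol_ball :: (complex ^ 'n \<Rightarrow> complex) set).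
            (f \<in> bergman_space p \<alpha> \<longleftrightarrow> area_R \<gamma> q f \<in> Lp_space p \<alpha>) \<and>
            (f \<in> bergman_space p \<alpha> \<longleftrightarrow> area_grad \<gamma> q f \<in> Lp_space p \<alpha>) \<and>
            (f \<in> bergman_space p \<alpha> \<longleftrightarrow> area_inv_grad \<gamma> q f \<in> Lp_space p \<alpha>))
       \<and> comparable_on (hol_ball :: (complex ^ 'n \<Rightarrow> complex) set)
            (\<lambda>f. Lp_norm p \<alpha> (area_R \<gamma> q f))
            (\<lambda>f. Lp_norm p \<alpha> (\<lambda>z. ennreal (norm (f z - f 0))))
       \<and> comparable_on (hol_ball :: (complex ^ 'n \<Rightarrow> complex) set)
            (\<lambda>f. Lp_norm p \<alpha> (area_grad \<gamma> q f))
            (\<lambda>f. Lp_norm p \<alpha> (\<lambda>z. ennreal (norm (f z - f 0))))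
       \<and> comparable_on (hol_ball :: (complex ^ 'n \<Rightarrow> complex) set)
            (\<lambda>f. Lp_norm p \<alpha> (area_inv_grad \<gamma> q f))
            (\<lambda>f. Lp_norm p \<alpha> (\<lambda>z. ennreal (norm (f z - f 0))))"
proof -
  have q: "0 < q" using assms(1) by simp
  define X where "X f = Lp_norm p \<alpha> (\<lambda>z. ennreal (norm (f z - f 0)))" for f :: "complex ^ 'n \<Rightarrow> complex"
  have mR: "area_R \<gamma> q f \<in> borel_measurable ball_borel" if "f \<in> hol_ball" for f :: "complex ^ 'n \<Rightarrow> complex"
    unfolding area_R_def by (intro measurable_area_int measurable_radial that assms)
  have mG: "area_grad \<gamma> q f \<in> borel_measurable ball_borel" if "f \<in> hol_ball" for f :: "complex ^ 'n \<Rightarrow> complex"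
    unfolding area_grad_def by (intro measurable_area_int measurable_cgrad that assms)
  have mI: "area_inv_grad \<gamma> q f \<in> borel_measurable ball_borel" if "f \<in> hol_ball" for f :: "complex ^ 'n \<Rightarrow> complex"
    unfolding area_inv_grad_def by (intro measurable_area_int measurable_inv_grad that assms)
  have mf: "f \<in> borel_measurable ball_borel" if "f \<in> hol_ball" for f :: "complex ^ 'n \<Rightarrow> complex"
    by (intro line_hol_measurable hol_ball_line_hol that)
  have mX: "(\<lambda>z. ennreal (norm (f z - f 0))) \<in> borel_measurable ball_borel" if "f \<in> hol_ball" for f :: "complex ^ 'n \<Rightarrow> complex"
    using mf[OF that] by measurable
  obtain C1 where C1: "0 < C1"
    "\<And>f :: complex ^ 'n \<Rightarrow> complex. f \<in> hol_ball \<Longrightarrow>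
       weighted_integral \<alpha> (\<lambda>z. epowr (area_inv_grad \<gamma> q f z) p)
       \<le> ennreal C1 * weighted_integral \<alpha> (\<lambda>z. ennreal (cmod (f z - f 0) powr p))"
    using nn_integral_area_inv_grad_le[where 'n = 'n and \<alpha> = \<alpha>, OF assms(4) q assms(2)] by blast
  obtain C2 where C2: "0 < C2"
    "\<And>f :: complex ^ 'n \<Rightarrow> complex. f \<in> hol_ball \<Longrightarrow>
       weighted_integral \<alpha> (\<lambda>z. ennreal (cmod (f z - f 0) powr p))
       \<le> ennreal C2 * weighted_integral \<alpha> (\<lambda>z. epowr (area_R \<gamma> q f z) p)"
    using nn_integral_le_area_R[where 'n = 'n, OF assms(4) q assms(2) assms(3)] by blast
  define C where "C = max (C1 powr (1 / p)) (C2 powr (1 / p))"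
  have C: "0 < C" using C1(1) by (simp add: C_def less_max_iff_disj)
  have up: "Lp_norm p \<alpha> (area_inv_grad \<gamma> q f) \<le> ennreal C * X f" if f: "f \<in> hol_ball" for f :: "complex ^ 'n \<Rightarrow> complex"
  proof -
    have "Lp_norm p \<alpha> (area_inv_grad \<gamma> q f) \<le> ennreal (C1 powr (1 / p)) * X f"
      unfolding X_def using C1 f by (intro Lp_norm_le mI mX assms) (simp_all add: epowr_ennreal)
    also have "\<dots> \<le> ennreal C * X f" by (intro mult_right_mono ennreal_leI) (auto simp: C_def)
    finally show ?thesis .
  qed
  have low: "X f \<le> ennreal C * Lp_norm p \<alpha> (area_R \<gamma> q f)" if f: "f \<in> hol_ball" for f :: "complex ^ 'n \<Rightarrow> complex"
  proof -
    have "X f \<le> ennreal (C2 powr (1 / p)) * Lp_norm p \<alpha> (area_R \<gamma> q f)"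
      unfolding X_def using C2 f by (intro Lp_norm_le mR mX assms) (simp_all add: epowr_ennreal)
    also have "\<dots> \<le> ennreal C * Lp_norm p \<alpha> (area_R \<gamma> q f)" by (intro mult_right_mono ennreal_leI) (auto simp: C_def)
    finally show ?thesis .
  qed
  have between: "ennreal (inverse C) * X f \<le> Lp_norm p \<alpha> A \<and> Lp_norm p \<alpha> A \<le> ennreal C * X f"
    if f: "f \<in> hol_ball" and A: "\<And>z. area_R \<gamma> q f z \<le> A z" "\<And>z. A z \<le> area_inv_grad \<gamma> q f z"
    for f :: "complex ^ 'n \<Rightarrow> complex" and A
  proof
    have le: "Lp_norm p \<alpha> (area_R \<gamma> q f) \<le> Lp_norm p \<alpha> A" "Lp_norm p \<alpha> A \<le> Lp_norm p \<alpha> (area_inv_grad \<gamma> q f)"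
      using A by (auto intro: Lp_norm_mono assms)
    have "X f \<le> ennreal C * Lp_norm p \<alpha> A"
      by (rule order_trans[OF low[OF f] mult_left_mono[OF le(1)]]) simp
    then have "ennreal (inverse C) * X f \<le> ennreal (inverse C) * (ennreal C * Lp_norm p \<alpha> A)"
      by (intro mult_left_mono) auto
    also have "\<dots> = Lp_norm p \<alpha> A"
      using C by (simp add: mult.assoc[symmetric] ennreal_mult[symmetric])
    finally show "ennreal (inverse C) * X f \<le> Lp_norm p \<alpha> A" .
    show "Lp_norm p \<alpha> A \<le> ennreal C * X f"
      by (rule order_trans[OF le(2) up[OF f]])
  qed
  have comparable: "comparable_on hol_ball (\<lambda>f. Lp_norm p \<alpha> (A f)) X"
    if "\<And>(f :: complex ^ 'n \<Rightarrow> complex) z. f \<in> hol_ball \<Longrightarrow> area_R \<gamma> q f z \<le> A f z \<and> A f z \<le> area_inv_grad \<gamma> q f z" for A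
    unfolding comparable_on_def using C between that by blast
  have membership: "f \<in> bergman_space p \<alpha> \<longleftrightarrow> A \<in> Lp_space p \<alpha>"
    if f: "f \<in> hol_ball" and mA: "A \<in> borel_measurable ball_borel"
      and A: "\<And>z. area_R \<gamma> q f z \<le> A z" "\<And>z. A z \<le> area_inv_grad \<gamma> q f z"
    for f :: "complex ^ 'n \<Rightarrow> complex" and A
  proof -
    have "f \<in> bergman_space p \<alpha> \<longleftrightarrow> Lp_norm p \<alpha> (\<lambda>z. ennreal (norm (f z))) < top"
      using f mf[OF f] by (simp add: bergman_space_def measurable_vol_w)
    also have "\<dots> \<longleftrightarrow> X f < top"
    proof
      assume "Lp_norm p \<alpha> (\<lambda>z. ennreal (norm (f z))) < top"
      from Lp_norm_add_constant_finite[OF assms(3,4) mf[OF f] this, of "- f 0"]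
      show "X f < top" by (simp add: X_def)
    next
      assume "X f < top"
      moreover have "(\<lambda>z. f z - f 0) \<in> borel_measurable ball_borel" using mf[OF f] by measurable
      ultimately show "Lp_norm p \<alpha> (\<lambda>z. ennreal (norm (f z))) < top"
        using Lp_norm_add_constant_finite[OF assms(3,4), of "\<lambda>z. f z - f 0" "f 0"] by (simp add: X_def)
    qed
    also have "\<dots> \<longleftrightarrow> Lp_norm p \<alpha> A < top"
    proof
      assume "X f < top"
      then have "ennreal C * X f < top" by (simp add: ennreal_mult_less_top)
      then show "Lp_norm p \<alpha> A < top" using between[OF f A] by (auto intro: le_less_trans)
    next
      assume "Lp_norm p \<alpha> A < top"
      then have "ennreal (inverse C) * X f < top" using between[OF f A] by (auto intro: le_less_trans)
      then show "X f < top" using C by (auto simp: ennreal_mult_less_top ennreal_eq_0_iff)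
    qed
    also have "\<dots> \<longleftrightarrow> A \<in> Lp_space p \<alpha>"
      using mA by (simp add: Lp_space_def measurable_vol_w)
    finally show ?thesis .
  qed
  have RG: "area_R \<gamma> q f z \<le> area_grad \<gamma> q f z" and GI: "area_grad \<gamma> q f z \<le> area_inv_grad \<gamma> q f z"
    if "f \<in> hol_ball" for f :: "complex ^ 'n \<Rightarrow> complex" and z
    using that q by (auto intro: area_R_le_area_grad area_grad_le_area_inv_grad)
  have RI: "area_R \<gamma> q f z \<le> area_inv_grad \<gamma> q f z" if "f \<in> hol_ball" for f :: "complex ^ 'n \<Rightarrow> complex" and z
    using RG[OF that] GI[OF that] by (rule order_trans)
  show ?thesis
    unfolding X_def[symmetric]
    by (intro conjI ballI membership comparable mR mG mI) (auto intro: RG GI RI)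
qed

end
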